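(* Let $n\in\mathbb N_0$, $t\in\mathbb C$, let $\alpha,\beta\in\mathbb C$ with $-\alpha,-\beta\notin\mathbb N_0$, and let $c\in\mathbb C\setminus[0,\infty)$. Then $$\int_C {}_1F_1\!\left(\begin{matrix}-z\\ \alpha\end{matrix};\frac{t(1-c)}{c}\right)M_n(z;\beta,c)\,\Gamma(-z)\,\Gamma(z+\beta)\,(-c)^z\,dz=\frac{t^n e^{-t}}{(1-c)^{\beta}(\alpha)_n\,c^n}\;{}_1F_1\!\left(\begin{matrix}\alpha-\beta\\ \alpha+n\end{matrix};t\right),$$ where $C$ is a complex contour from $-i\infty$ to $i\infty$ separating the increasing poles at $z\in\mathbb N_0$ from the decreasing poles at $z\in\{-\beta,-\beta-1,-\beta-2,\dots\}$.
   Context: $\mathbb N_0=\{0,1,2,\dots\}$. Pochhammer symbol: $(a)_n=a(a+1)\cdots(a+n-1)$, with $(a)_0=1$. Generalized hypergeometric series: ${}_1F_1\!\left(\begin{matrix}a\\ b\end{matrix};z\right)=\sum_{k\ge0}\frac{(a)_k}{(b)_k}\frac{z^k}{k!}$ and ${}_2F_1\!\left(\begin{matrix}a_1,\,a_2\\ b\end{matrix};z\right)=\sum_{k\ge0}\frac{(a_1)_k(a_2)_k}{(b)_k}\frac{z^k}{k!}$. Meixner polynomials: $M_n(z;\beta,c)={}_2F_1\!\left(\begin{matrix}-n,\,-z\\ \beta\end{matrix};1-\frac1c\right)$. $\Gamma$ is the gamma function.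
   Formalization: The printed right-hand side lacks a normalising factor: the formal theorem multiplies it by 2πiΓ(β) (for n=0, t=0, β=1, c=-1 the integral is πi, not 1/2); the contour C is taken to have bounded real part. *)

theory Defs
  imports "HOL-Analysis.Analysis"
begin

definition hyp_1F1 :: "complex \<Rightarrow> complex \<Rightarrow> complex \<Rightarrow> complex" where
  "hyp_1F1 a b z = (\<Sum>k. pochhammer a k / pochhammer b k * (z ^ k / fact k))"

definition hyp_2F1 :: "complex \<Rightarrow> complex \<Rightarrow> complex \<Rightarrow> complex \<Rightarrow> complex" where
  "hyp_2F1 a1 a2 b z = (\<Sum>k. pochhammer a1 k * pochhammer a2 k / pochhammer b k * (z ^ k / fact k))"

definition Meixner :: "nat \<Rightarrow> complex \<Rightarrow> complex \<Rightarrow> complex \<Rightarrow> complex" where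
  "Meixner n z \<beta> c = hyp_2F1 (- of_nat n) (- z) \<beta> (1 - 1 / c)"

(* A contour from -i*infinity to i*infinity, parametrised by the whole real line. It stays in a
   vertical strip, so for large imaginary part it behaves like a vertical line. Vertical lines
   and their finite indentations are special cases; simplicity of the curve is not required. *)
definition vertical_contour :: "(real \<Rightarrow> complex) \<Rightarrow> bool" where
  "vertical_contour \<gamma> \<longleftrightarrow>
     (\<forall>a b. \<gamma> piecewise_C1_differentiable_on {a..b}) \<and>
     bounded (range (\<lambda>s. Re (\<gamma> s))) \<and>
     filterlim (\<lambda>s. Im (\<gamma> s)) at_bot at_bot \<and>
     filterlim (\<lambda>s. Im (\<gamma> s)) at_top at_top"

(* A contour in a vertical strip has a half-plane on each side of it. A point lies to the right
   (left) if it can be joined to the right (left) half-plane without meeting the contour; in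
   particular it is not on the contour. *)
definition right_of_contour :: "(real \<Rightarrow> complex) \<Rightarrow> complex \<Rightarrow> bool" where
  "right_of_contour \<gamma> p \<longleftrightarrow>
     (\<forall>\<^sub>F x in at_top. connected_component (- range \<gamma>) p (complex_of_real x))"

definition left_of_contour :: "(real \<Rightarrow> complex) \<Rightarrow> complex \<Rightarrow> bool" where
  "left_of_contour \<gamma> p \<longleftrightarrow>
     (\<forall>\<^sub>F x in at_bot. connected_component (- range \<gamma>) p (complex_of_real x))"

definition separates_poles :: "(real \<Rightarrow> complex) \<Rightarrow> complex \<Rightarrow> bool" where
  "separates_poles \<gamma> \<beta> \<longleftrightarrow>
     (\<forall>k::nat. right_of_contour \<gamma> (of_nat k)) \<and>
     (\<forall>k::nat. left_of_contour \<gamma> (- \<beta> - of_nat k))"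

(* The Henstock-Kurzweil integral over UNIV is the limit of the integrals over [a,b] as a and b
   tend independently to -infinity and infinity, so convergence is part of the claim. The finitely
   many corners in each [a,b] do not affect its value. *)
definition has_infinite_contour_integral ::
    "(complex \<Rightarrow> complex) \<Rightarrow> complex \<Rightarrow> (real \<Rightarrow> complex) \<Rightarrow> bool"
    (infixr "has'_infinite'_contour'_integral" 50) where
  "(f has_infinite_contour_integral I) \<gamma> \<longleftrightarrow>
     ((\<lambda>s. f (\<gamma> s) * vector_derivative \<gamma> (at s)) has_integral I) UNIV"

end

theory Submission
  imports Defs "HOL-Complex_Analysis.Complex_Analysis"
begin

text \<open>
  Write \<open>c = - exp w\<close> with \<open>\<bar>Im w\<bar> < pi\<close>, so that \<open>(- c) powr z = exp (w * z)\<close>, and regard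
  \<open>G \<mapsto> \<integral> G(z) Gamma(- z) Gamma(z + b) exp(w z) dz\<close> along the contour as a linear functional of \<open>G\<close>.
  On entire functions of minimal exponential type it is well behaved: the Gamma factors decay almost like
  \<open>exp (- pi * \<bar>Im z\<bar>)\<close>, which beats both \<open>exp (w * z)\<close> and the growth of \<open>G\<close>.

  The contour may oscillate wildly inside its strip, so no estimate on it is available. The remedy is to replace
  it by the line \<open>Re z = N + 1/2\<close> far to the right: closing a long piece of the contour by this line gives a
  loop that winds \<open>-1\<close> times around the poles \<open>0, \<dots>, N\<close> and \<open>0\<close> times around the poles on the left, and the
  residue theorem expresses the functional as an absolutely convergent line integral plus a finite sum of residues
  (\<open>contour_integral_eq_barnes_value\<close>).
  The functional equation of Gamma and the translation \<open>z \<mapsto> z + 1\<close>, which takes one line to the next, give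
  \<open>barnes_integral_rise\<close> and \<open>barnes_integral_shift\<close>. For \<open>G = 1\<close> these two relations amount to a first-order
  differential equation in \<open>w\<close>, solved by \<open>(1 + exp w) powr (- b)\<close>; the residue at \<open>0\<close>, which is all that
  survives as \<open>w\<close> tends to minus infinity, fixes the constant (\<open>barnes_integral_one\<close>). The relations then
  carry this over to the products \<open>(- z)\<^sub>k (z + b)\<^sub>j\<close> (\<open>barnes_integral_falling_rising\<close>).

  By Pfaff's transformation the Meixner polynomial is a combination of the \<open>(z + \<beta>)\<^sub>j\<close>, and the confluent series
  is a combination of the \<open>(- z)\<^sub>k\<close>. The finite sum over \<open>j\<close> is evaluated by the Chu-Vandermonde identity; it
  vanishes for \<open>k < n\<close>, which is the orthogonality of the Meixner polynomials to lower powers. The infinite sum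
  over \<open>k\<close> may be taken outside the integral because the tails are uniformly small against
  \<open>exp (\<eta> * norm z)\<close> for every \<open>\<eta> > 0\<close> (\<open>barnes_integral_newton_series\<close>). What remains is
  a confluent series at \<open>- t\<close>, and Kummer's transformation turns it into the stated one.
\<close>

section \<open>Decay of the Gamma function in vertical strips\<close>

text \<open>
  By Euler's product, \<open>norm (Gamma (x + iy)) / Gamma x\<close> is the infinite product of the factors
  \<open>(x + k) / norm (x + k + iy)\<close>, and each of them increases with \<open>x\<close>. This transports decay from
  a line with integer abscissa, where it follows from the reflection formula, to every line on its left.
\<close>

lemma norm_Gamma_ratio_mono:
  fixes x y M :: real
  assumes "0 < x" "x \<le> M"
  shows "norm (Gamma (Complex x y)) / Gamma x \<le> norm (Gamma (Complex M y)) / Gamma M"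
proof -
  define q where "q = (\<lambda>u n. norm (Gamma_series (Complex u y) n) / Gamma_series u n)"
  have q_eq: "q u n = (\<Prod>k\<le>n. (u + real k) / norm (Complex (u + real k) y))"
    if "0 < u" "n > 0" for u n
  proof -
    have [simp]: "norm (exp (Complex u y * complex_of_real (ln (real n)))) = exp (u * ln (real n))"
      by (simp add: norm_exp_eq_Re)
    have cs: "Complex u y + of_nat k = Complex (u + real k) y" for k
      by (simp add: complex_eq_iff)
    have "norm (pochhammer (Complex u y) (n + 1)) = (\<Prod>k\<le>n. norm (Complex (u + real k) y))"
      by (simp add: pochhammer_prod cs lessThan_Suc_atMost atLeast0LessThan prod_norm del: of_nat_Suc)
    moreover have "pochhammer u (n + 1) = (\<Prod>k\<le>n. u + real k)"
      by (simp add: pochhammer_prod atLeast0LessThan lessThan_Suc_atMost)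
    ultimately show ?thesis
      using that by (simp add: q_def Gamma_series_def norm_mult norm_divide prod_dividef Ln_of_nat)
  qed
  have lim: "q u \<longlonglongrightarrow> norm (Gamma (Complex u y)) / Gamma u" if "0 < u" for u
    unfolding q_def using that by (intro tendsto_intros) (auto simp: Gamma_eq_zero_iff elim: nonpos_Ints_cases)
  show ?thesis
  proof (rule tendsto_le [OF _ lim lim])
    show "\<forall>\<^sub>F n in sequentially. q x n \<le> q M n"
    proof (rule eventually_sequentiallyI [of 1])
      fix n :: nat assume n: "1 \<le> n"
      have "(x + real k) / norm (Complex (x + real k) y) \<le> (M + real k) / norm (Complex (M + real k) y)" for k
      proof -
        define u v where "u = x + real k" and "v = M + real k"
        have uv: "0 < u" "u \<le> v" using assms by (auto simp: u_def v_def)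
        have "u\<^sup>2 \<le> v\<^sup>2" using uv by (simp add: power_mono)
        hence "u\<^sup>2 * (v\<^sup>2 + y\<^sup>2) \<le> v\<^sup>2 * (u\<^sup>2 + y\<^sup>2)"
          using mult_right_mono [of "u\<^sup>2" "v\<^sup>2" "y\<^sup>2"] by (simp add: algebra_simps)
        hence "sqrt (u\<^sup>2 * (v\<^sup>2 + y\<^sup>2)) \<le> sqrt (v\<^sup>2 * (u\<^sup>2 + y\<^sup>2))"
          by (rule real_sqrt_le_mono)
        hence "u * sqrt (v\<^sup>2 + y\<^sup>2) \<le> v * sqrt (u\<^sup>2 + y\<^sup>2)"
          using uv by (simp add: real_sqrt_mult)
        moreover have "sqrt (v\<^sup>2 + y\<^sup>2) > 0" "sqrt (u\<^sup>2 + y\<^sup>2) > 0"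
          using uv by (auto simp: add_pos_nonneg)
        ultimately show ?thesis
          unfolding u_def [symmetric] v_def [symmetric] by (simp add: complex_norm field_simps)
      qed
      then show "q x n \<le> q M n"
        using n assms by (simp add: q_eq) (intro prod_mono, auto)
    qed
  qed (use assms in auto)
qed

text \<open>
  The reflection formula gives \<open>(norm (Gamma (1 + iy)))\<^sup>2 = pi * y / sinh (pi * y)\<close>. The constant and the
  linear factor are generous, because only the exponential rate matters later.
\<close>

lemma norm_Gamma_one_plus_imaginary:
  fixes y :: real
  assumes "1 \<le> \<bar>y\<bar>"
  shows "norm (Gamma (Complex 1 y)) \<le> 4 * (1 + \<bar>y\<bar>) * exp (- pi * \<bar>y\<bar> / 2)"
proof -
  define z where "z = Complex 0 y"
  have znz: "z \<noteq> 0" using assms by (auto simp: z_def complex_eq_iff)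
  have zni: "z \<notin> \<int>\<^sub>\<le>\<^sub>0" using assms by (auto simp: z_def complex_eq_iff elim!: nonpos_Ints_cases)
  have G1: "Gamma (1 + z) = z * Gamma z"
    using Gamma_plus1 [OF zni] by (simp add: add.commute)
  have c1: "Complex 1 y = 1 + z" by (simp add: z_def complex_eq_iff)
  have c2: "cnj (1 + z) = 1 - z" by (simp add: z_def complex_eq_iff)
  have "of_real ((norm (Gamma (1 + z)))\<^sup>2) = Gamma (1 + z) * cnj (Gamma (1 + z))"
    by (metis complex_norm_square)
  also have "\<dots> = (z * Gamma z) * Gamma (1 - z)"
    by (metis cnj_Gamma c2 G1)
  also have "\<dots> = z * (Gamma z * Gamma (1 - z))" by simp
  also have "\<dots> = z * (of_real pi / sin (of_real pi * z))"
    by (simp add: Gamma_reflection_complex)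
  finally have "(norm (Gamma (1 + z)))\<^sup>2 = norm (z * (of_real pi / sin (of_real pi * z)))"
    by (metis norm_of_real abs_of_nonneg zero_le_power2)
  also have "\<dots> = \<bar>y\<bar> * pi / norm (sin (of_real pi * z))"
  proof -
    have "norm z = \<bar>y\<bar>" by (simp add: z_def complex_norm)
    then show ?thesis by (simp add: norm_mult norm_divide)
  qed
  finally have sq: "(norm (Gamma (1 + z)))\<^sup>2 = \<bar>y\<bar> * pi / norm (sin (of_real pi * z))" .
  have S: "exp (pi * \<bar>y\<bar>) / 4 \<le> norm (sin (of_real pi * z))"
  proof -
    have e1: "norm (exp (\<i> * (of_real pi * z))) = exp (- (pi * y))" "norm (exp (- (\<i> * (of_real pi * z)))) = exp (pi * y)"
      by (simp_all add: z_def)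
    have "norm (exp (\<i> * (of_real pi * z)) - exp (- (\<i> * (of_real pi * z)))) \<ge> \<bar>exp (- (pi * y)) - exp (pi * y)\<bar>"
      using norm_triangle_ineq3 [of "exp (\<i> * (of_real pi * z))" "exp (- (\<i> * (of_real pi * z)))"] e1 by simp
    hence "\<bar>exp (- (pi * y)) - exp (pi * y)\<bar> / 2 \<le> norm (sin (of_real pi * z))"
      by (simp add: sin_exp_eq norm_divide norm_mult)
    moreover have "\<bar>exp (- (pi * y)) - exp (pi * y)\<bar> \<ge> exp (pi * \<bar>y\<bar>) / 2"
    proof -
      have p: "pi * \<bar>y\<bar> \<ge> 1" using assms pi_gt3 mult_mono[of 1 pi 1 "\<bar>y\<bar>"] by simp
      have "exp (pi * \<bar>y\<bar>) \<ge> 2" using exp_ge_add_one_self [of "pi * \<bar>y\<bar>"] p by linarith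
      moreover have "exp (- (pi * \<bar>y\<bar>)) \<le> 1" by simp
      ultimately have "exp (pi * \<bar>y\<bar>) / 2 \<le> exp (pi * \<bar>y\<bar>) - exp (- (pi * \<bar>y\<bar>))" by linarith
      also have "\<dots> \<le> \<bar>exp (- (pi * y)) - exp (pi * y)\<bar>"
        by (cases "y \<ge> 0") auto
      finally show ?thesis .
    qed
    ultimately show ?thesis by argo
  qed
  have "(norm (Gamma (1 + z)))\<^sup>2 \<le> \<bar>y\<bar> * pi / (exp (pi * \<bar>y\<bar>) / 4)"
    unfolding sq using S by (intro divide_left_mono) (auto intro!: mult_pos_pos simp: less_le_trans[OF _ S])
  also have "\<dots> = 4 * pi * \<bar>y\<bar> * exp (- pi * \<bar>y\<bar>)"
    by (simp add: exp_minus field_simps)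
  also have "\<dots> \<le> 16 * (1 + \<bar>y\<bar>)\<^sup>2 * exp (- pi * \<bar>y\<bar>)"
  proof (rule mult_right_mono)
    have "4 * pi * \<bar>y\<bar> \<le> 16 * \<bar>y\<bar>" using pi_less_4 by (intro mult_right_mono) auto
    also have "\<dots> \<le> 16 * (1 + \<bar>y\<bar>)\<^sup>2" by (simp add: power2_eq_square algebra_simps)
    finally show "4 * pi * \<bar>y\<bar> \<le> 16 * (1 + \<bar>y\<bar>)\<^sup>2" .
  qed simp
  also have "\<dots> = (4 * (1 + \<bar>y\<bar>) * exp (- pi * \<bar>y\<bar> / 2))\<^sup>2"
    by (simp add: power_mult_distrib exp_double [symmetric]) (simp add: power2_eq_square algebra_simps)
  finally show ?thesis
    unfolding c1 by (rule power2_le_imp_le) simp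
qed

lemma power_le_exp_scaled:
  fixes \<eta> :: real
  assumes "\<eta> > 0"
  shows "\<exists>C>0. \<forall>u\<ge>0. (1 + u) ^ m \<le> C * exp (\<eta> * u)"
proof -
  define C where "C = fact m * exp \<eta> / \<eta> ^ m"
  have "(1 + u) ^ m \<le> C * exp (\<eta> * u)" if "u \<ge> 0" for u
  proof -
    have "\<eta> ^ m * (1 + u) ^ m / fact m \<le> exp \<eta> * exp (\<eta> * u)"
    proof -
      have s: "summable (\<lambda>k. (\<eta> * (1 + u)) ^ k /\<^sub>R fact k)" by (rule summable_exp_generic)
      show ?thesis
        using sum_le_suminf [OF s, of "{m}"] assms that
        unfolding power_mult_distrib [symmetric] mult_exp_exp
        by (simp add: exp_def divide_inverse mult.commute ring_distribs)
    qed
    then show ?thesis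
      using assms by (simp add: C_def divide_le_eq le_divide_eq mult_ac)
  qed
  moreover have "C > 0" using assms by (simp add: C_def)
  ultimately show ?thesis by blast
qed

text \<open>
  The functional equation moves the strip into the right half-plane; for \<open>1 \<le> \<bar>Im z\<bar>\<close> the factors
  that it divides by have norm at least \<open>1\<close>. There the monotonicity of the ratio compares with the line
  \<open>Re z = M\<close>, and the functional equation compares that line with \<open>Re z = 1\<close> at the cost of a
  polynomial, which \<open>exp (\<eta> * \<bar>Im z\<bar>)\<close> absorbs.
\<close>

lemma Gamma_vertical_strip_decay:
  fixes \<rho> \<eta> :: real
  assumes "\<eta> > 0"
  shows "\<exists>C>0. \<forall>z. \<bar>Re z\<bar> \<le> \<rho> \<longrightarrow> 1 \<le> \<bar>Im z\<bar> \<longrightarrow>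
           norm (Gamma z) \<le> C * exp (- (pi / 2 - \<eta>) * \<bar>Im z\<bar>)"
proof -
  obtain p :: nat where p: "\<rho> + 1 \<le> real p" using real_arch_simple by blast
  \<comment> \<open>Translation by \<open>p\<close> takes the strip into \<open>1 \<le> Re z \<le> M\<close>.\<close>
  define M where "M = 2 * p + 1"
  have "compact ((Gamma :: real \<Rightarrow> real) ` {1..real M})"
    by (intro compact_continuous_image continuous_intros) (auto elim!: nonpos_Ints_cases)
  then obtain D0 where D0: "\<And>x. x \<in> {1..real M} \<Longrightarrow> Gamma x \<le> D0"
    by (metis bounded_real compact_imp_bounded imageI abs_le_D1)
  define D where "D = max 1 D0"
  have D: "\<And>x. x \<in> {1..real M} \<Longrightarrow> Gamma x \<le> D" "D > 0" using D0 by (force simp: D_def)+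
  obtain C0 where C0: "C0 > 0" "\<And>u. u \<ge> 0 \<Longrightarrow> (1 + u) ^ (M + 1) \<le> C0 * exp (\<eta> * u)"
    using power_le_exp_scaled [OF assms] by metis
  define C where "C = D / Gamma (real M) * real M ^ M * 4 * C0"
  have "real M \<ge> 1" by (simp add: M_def)
  hence Mpos: "Gamma (real M) > 0" by (intro Gamma_real_pos) linarith
  have "C > 0" unfolding C_def using D Mpos C0 \<open>real M \<ge> 1\<close> by (intro mult_pos_pos divide_pos_pos) auto
  have "norm (Gamma z) \<le> C * exp (- (pi / 2 - \<eta>) * \<bar>Im z\<bar>)" if z: "\<bar>Re z\<bar> \<le> \<rho>" "1 \<le> \<bar>Im z\<bar>" for z
  proof -
    define x y where "x = Re z + real p" and "y = Im z"
    have y: "1 \<le> \<bar>y\<bar>" using z by (simp add: y_def)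
    have zp: "z + of_nat p = Complex x y" by (simp add: x_def y_def complex_eq_iff)
    have x: "1 \<le> x" "x \<le> real M" using z p by (auto simp: x_def M_def)
    have zni: "w \<notin> \<int>\<^sub>\<le>\<^sub>0" if "Im w = y" for w :: complex using y that by (auto elim!: nonpos_Ints_cases)
    have "pochhammer z p = Gamma (z + of_nat p) / Gamma z" by (intro pochhammer_Gamma zni) (simp add: y_def)
    moreover have "Gamma z \<noteq> 0" by (intro Gamma_nonzero zni) (simp add: y_def)
    ultimately have "Gamma (Complex x y) = pochhammer z p * Gamma z" by (simp add: zp)
    moreover have "norm (pochhammer z p) \<ge> 1"
    proof -
      have "1 \<le> norm (z + of_nat k)" for k
        using abs_Im_le_cmod [of "z + of_nat k"] z by simp
      hence "(\<Prod>k=0..<p. 1) \<le> (\<Prod>k=0..<p. norm (z + of_nat k))" by (intro prod_mono) auto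
      then show ?thesis by (simp add: pochhammer_prod prod_norm)
    qed
    ultimately have "norm (Gamma z) \<le> norm (Gamma (Complex x y))"
      by (simp add: norm_mult mult_le_cancel_right1)
    also have "norm (Gamma (Complex x y)) \<le> Gamma x * (norm (Gamma (Complex (real M) y)) / Gamma (real M))"
      using norm_Gamma_ratio_mono [of x "real M" y] x Gamma_real_pos [of x] by (simp add: field_simps)
    also have "\<dots> \<le> D * (norm (Gamma (Complex (real M) y)) / Gamma (real M))"
      using D x Mpos by (intro mult_right_mono) auto
    also have "Complex (real M) y = Complex 1 y + of_nat (2 * p)"
      by (simp add: complex_eq_iff M_def)
    also have "Gamma (Complex 1 y + of_nat (2 * p)) = pochhammer (Complex 1 y) (2*p) * Gamma (Complex 1 y)"
      using pochhammer_Gamma [of "Complex 1 y" "2 * p"] Gamma_nonzero [of "Complex 1 y"] zni [of "Complex 1 y"] by simp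
    also have "D * (norm \<dots> / Gamma (real M)) \<le> D * (((real M ^ M * (1 + \<bar>y\<bar>) ^ M) * (4 * (1 + \<bar>y\<bar>) * exp (- pi * \<bar>y\<bar> / 2))) / Gamma (real M))"
    proof (intro mult_left_mono divide_right_mono, unfold norm_mult, rule mult_mono)
      have f: "norm (Complex 1 y + of_nat k) \<le> real M * (1 + \<bar>y\<bar>)" if "k < 2 * p" for k
      proof -
        have "norm (Complex 1 y + of_nat k) \<le> \<bar>1 + real k\<bar> + \<bar>y\<bar>"
          using cmod_le [of "Complex 1 y + of_nat k"] by simp
        also have "\<dots> \<le> real M + real M * \<bar>y\<bar>"
          using that mult_right_mono[OF \<open>real M \<ge> 1\<close>, of "\<bar>y\<bar>"] by (intro add_mono) (auto simp: M_def)
        finally show ?thesis by (simp add: algebra_simps)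
      qed
      have "norm (pochhammer (Complex 1 y) (2*p)) \<le> (\<Prod>k=0..<2*p. real M * (1 + \<bar>y\<bar>))"
        unfolding pochhammer_prod prod_norm [symmetric] by (intro prod_mono) (auto intro: f)
      also have "\<dots> = (real M * (1 + \<bar>y\<bar>)) ^ (2 * p)" by simp
      also have "\<dots> \<le> (real M * (1 + \<bar>y\<bar>)) ^ M"
      proof (rule power_increasing)
        show "1 \<le> real M * (1 + \<bar>y\<bar>)" using \<open>real M \<ge> 1\<close> mult_mono[of 1 "real M" 1 "1 + \<bar>y\<bar>"] by simp
      qed (simp add: M_def)
      finally show "norm (pochhammer (Complex 1 y) (2*p)) \<le> real M ^ M * (1 + \<bar>y\<bar>) ^ M"
        by (simp add: power_mult_distrib)
    qed (use norm_Gamma_one_plus_imaginary [OF y] D Mpos in auto)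
    also have "\<dots> = D / Gamma (real M) * real M ^ M * 4 * exp (- pi * \<bar>y\<bar> / 2) * (1 + \<bar>y\<bar>) ^ (M + 1)"
      by simp
    also have "\<dots> \<le> D / Gamma (real M) * real M ^ M * 4 * exp (- pi * \<bar>y\<bar> / 2) * (C0 * exp (\<eta> * \<bar>y\<bar>))"
      using D Mpos by (intro mult_left_mono C0) auto
    also have "\<dots> = C * exp (- (pi / 2 - \<eta>) * \<bar>Im z\<bar>)"
      by (simp add: C_def y_def mult_exp_exp algebra_simps)
    finally show ?thesis .
  qed
  then show ?thesis using \<open>C > 0\<close> by blast
qed

section \<open>Winding numbers of a contour closed by a vertical line\<close>

text \<open>
  The library works with paths on the unit interval, whereas the contour is parametrised by the real line.
  This translates a finite piece of it, together with its contour integral.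
\<close>

lemma reparametrized_arc:
  fixes \<gamma> :: "real \<Rightarrow> complex"
  assumes pw: "\<gamma> piecewise_C1_differentiable_on {a..b}" and "a < b"
  defines "g \<equiv> (\<lambda>u. \<gamma> ((b - a) * u + a))"
  shows "valid_path g" and "path_image g = \<gamma> ` {a..b}"
    and "(f has_contour_integral i) g \<Longrightarrow>
          ((\<lambda>s. f (\<gamma> s) * vector_derivative \<gamma> (at s)) has_integral i) {a..b}"
proof -
  have img: "(\<lambda>u. (b - a) * u + a) ` {0..1} = {a..b}"
    using \<open>a < b\<close> by (subst image_affinity_atLeastAtMost) auto
  show "valid_path g"
    using piecewise_C1_differentiable_affine [of \<gamma> "b - a" a "{0..1}"] pw
    by (simp add: valid_path_def img g_def o_def)
  show "path_image g = \<gamma> ` {a..b}"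
    unfolding path_image_def g_def using img by (metis image_image)
  assume "(f has_contour_integral i) g"
  hence hi: "((\<lambda>u. f (g u) * vector_derivative g (at u)) has_integral i) {0..1}"
    by (simp add: has_contour_integral)
  obtain S where S: "finite S" "\<gamma> C1_differentiable_on {a..b} - S"
    using pw unfolding piecewise_C1_differentiable_on_def by blast
  let ?F = "\<lambda>s. f (\<gamma> s) * vector_derivative \<gamma> (at s)"
  define S' where "S' = (\<lambda>s. (s - a) / (b - a)) ` S"
  have "((\<lambda>u. (b - a) *\<^sub>R ?F ((b - a) *\<^sub>R u + a)) has_integral i) {0..1}"
  proof (rule has_integral_spike_finite [OF _ _ hi])
    show "finite S'" using S by (simp add: S'_def)
    fix u assume u: "u \<in> {0..1} - S'"
    define s where "s = (b - a) * u + a"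
    have "s \<in> {a..b}" unfolding s_def img [symmetric] using u by blast
    moreover have "s \<notin> S"
      using u \<open>a < b\<close> by (auto simp: S'_def s_def image_iff field_simps)
    ultimately obtain D where D: "(\<gamma> has_vector_derivative D) (at s)"
      using S(2) unfolding C1_differentiable_on_def by blast
    have "((\<lambda>u. (b - a) * u + a) has_vector_derivative (b - a)) (at u)"
      by (auto intro!: derivative_eq_intros simp: has_vector_derivative_def)
    hence "(g has_vector_derivative ((b - a) *\<^sub>R D)) (at u)"
      using vector_diff_chain_at [of "\<lambda>u. (b - a) * u + a" "b - a" u \<gamma> D] D
      by (simp add: s_def g_def o_def)
    hence "vector_derivative g (at u) = (b - a) *\<^sub>R vector_derivative \<gamma> (at s)"
      using D by (metis vector_derivative_at)
    then show "(b - a) *\<^sub>R ?F ((b - a) *\<^sub>R u + a) = f (g u) * vector_derivative g (at u)"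
      by (simp add: g_def s_def)
  qed
  hence "((\<lambda>u. ?F ((b - a) *\<^sub>R u + a)) has_integral i /\<^sub>R (b - a)) {0..1}"
    using \<open>a < b\<close> has_integral_cmul [of _ i "{0..1}" "inverse (b - a)"] by fastforce
  then show "(?F has_integral i) {a..b}"
    using has_integral_affinity_iff [of "b - a" ?F a i a b] \<open>a < b\<close> by simp
qed

text \<open>
  The arc \<open>g\<close> runs upwards inside the strip \<open>l < Re z < R\<close> and is closed through the line \<open>Re z = R\<close>. The
  connected set \<open>T\<close> joins \<open>p\<close> to one side of the strip without meeting \<open>g\<close>, at heights between the end
  points of \<open>g\<close>, so it meets neither horizontal segment.

  If \<open>T\<close> leads to the left and stays to the left of the line, it avoids the loop, and the winding
  number is that at a point outside the half-plane containing the loop. If it leads to the right, it crosses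
  the closing line; then the same argument applies to the loop closed on the far left instead, and the two loops
  differ by a rectangle around \<open>p\<close>.
\<close>

lemma winding_number_right_closure:
  fixes g :: "real \<Rightarrow> complex" and T :: "complex set"
  assumes g: "path g" "pathstart g = A" "pathfinish g = B"
    and AB: "Im A < Im B" "l < Re A" "Re A < R" "l < Re B" "Re B < R"
    and pg: "path_image g \<subseteq> {z. l < Re z \<and> Re z < R}"
    and T: "connected T" "T \<inter> path_image g = {}" "T \<subseteq> {z. Im A < Im z \<and> Im z < Im B}" "p \<in> T"
  defines "loop \<equiv> g +++ linepath B (Complex R (Im B)) +++
     linepath (Complex R (Im B)) (Complex R (Im A)) +++ linepath (Complex R (Im A)) A"
  shows "T \<subseteq> {z. Re z < R} \<Longrightarrow> \<exists>x\<in>T. Re x \<le> l \<Longrightarrow> winding_number loop p = 0"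
    and "Re p < R \<Longrightarrow> bounded T \<Longrightarrow> \<exists>x\<in>T. R \<le> Re x \<Longrightarrow> winding_number loop p = -1"
proof -
  let ?A1 = "Complex R (Im A)" and ?B1 = "Complex R (Im B)"
  have hor: "closed_segment z w \<subseteq> {x. Im x = Im z}" if "Im z = Im w" for z w
    using that by (auto simp: closed_segment_same_Im)
  have ver: "closed_segment z w \<subseteq> {x. Re x = Re z}" if "Re z = Re w" for z w
    using that by (auto simp: closed_segment_same_Re)
  have hA: "closed_segment A z \<subseteq> {x. Im x = Im A}" "closed_segment z A \<subseteq> {x. Im x = Im A}" if "Im z = Im A" for z
    using that hor by metis+
  have hB: "closed_segment B z \<subseteq> {x. Im x = Im B}" "closed_segment z B \<subseteq> {x. Im x = Im B}" if "Im z = Im B" for z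
    using that hor by metis+
  have disj: "T \<inter> closed_segment A z = {}" "T \<inter> closed_segment z A = {}" if "Im z = Im A" for z
    using hA[OF that] T by fastforce+
  have disjB: "T \<inter> closed_segment B z = {}" "T \<inter> closed_segment z B = {}" if "Im z = Im B" for z
    using hB[OF that] T by fastforce+
  {
    assume T1: "T \<subseteq> {z. Re z < R}" "\<exists>x\<in>T. Re x \<le> l"
    then obtain x where x: "x \<in> T" "Re x \<le> l" by blast
    have img: "path_image loop \<subseteq> {z. l < Re z}"
    proof -
      have "convex {z. l < Re z}" by (rule convex_halfspace_Re_gt)
      hence "closed_segment z w \<subseteq> {z. l < Re z}" if "l < Re z" "l < Re w" for z w
        using that by (intro closed_segment_subset) auto
      then show ?thesis
        unfolding loop_def using pg AB g
        by (intro subset_path_image_join) (auto simp del: in_segment)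
    qed
    have "T \<inter> path_image loop = {}"
    proof -
      have "T \<inter> closed_segment ?B1 ?A1 = {}" using ver[of ?B1 ?A1] T1 by fastforce
      then show ?thesis
        using T(2) g disj(2)[of ?A1] disjB(1)[of ?B1]
        by (simp add: loop_def path_image_join Int_Un_distrib del: in_segment)
    qed
    hence "winding_number loop p = winding_number loop x"
      using T x g by (intro winding_number_eq [of loop p T x]) (auto simp: loop_def)
    also have "\<dots> = 0"
      using x img g
      by (intro winding_number_zero_outside [of loop "{z. l < Re z}"] convex_halfspace_Re_gt) (auto simp: loop_def)
    finally show "winding_number loop p = 0" .
  }
  {
    assume p: "Re p < R" and "bounded T" and "\<exists>x\<in>T. R \<le> Re x"
    then obtain x where x: "x \<in> T" "R \<le> Re x" by blast
    from \<open>bounded T\<close> obtain L0 where L0: "\<And>z. z \<in> T \<Longrightarrow> norm z \<le> L0"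
      unfolding bounded_iff by blast
    \<comment> \<open>Far enough to the left to pass both \<open>T\<close> and the strip.\<close>
    define L where "L = max (L0 + 1) (\<bar>l\<bar> + \<bar>R\<bar> + 1)"
    have L: "\<And>z. z \<in> T \<Longrightarrow> norm z < L" "L > \<bar>l\<bar> + \<bar>R\<bar>"
      using L0 by (force simp: L_def)+
    let ?A2 = "Complex (-L) (Im A)" and ?B2 = "Complex (-L) (Im B)"
    define left_loop where "left_loop = g +++ linepath B ?B2 +++ linepath ?B2 ?A2 +++ linepath ?A2 A"
    have Re_T: "- L < Re z" if "z \<in> T" for z
      using L(1)[OF that] abs_Re_le_cmod [of z] by linarith
    have Tver: "T \<inter> closed_segment ?B2 ?A2 = {}"
      using ver[of ?B2 ?A2] Re_T by fastforce
    have img: "path_image left_loop \<subseteq> {z. Re z < R}"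
    proof -
      have "convex {z. Re z < R}" by (rule convex_halfspace_Re_lt)
      hence "closed_segment z w \<subseteq> {z. Re z < R}" if "Re z < R" "Re w < R" for z w
        using that by (intro closed_segment_subset) auto
      then show ?thesis
        unfolding left_loop_def using pg AB g L(2)
        by (intro subset_path_image_join) (auto simp del: in_segment)
    qed
    have "T \<inter> path_image left_loop = {}"
      using T(2) g Tver disj(2)[of ?A2] disjB(1)[of ?B2]
      by (simp add: left_loop_def path_image_join Int_Un_distrib del: in_segment)
    hence "winding_number left_loop p = winding_number left_loop x"
      using T x g by (intro winding_number_eq [of left_loop p T x]) (auto simp: left_loop_def)
    also have "\<dots> = 0"
      using x img g
      by (intro winding_number_zero_outside [of left_loop "{z. Re z < R}"] convex_halfspace_Re_lt) (auto simp: left_loop_def)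
    finally have W0: "winding_number left_loop p = 0" .
    have pT: "p \<notin> closed_segment z w" if "T \<inter> closed_segment z w = {}" for z w
      using that T by blast
    have pv: "p \<notin> closed_segment ?A1 ?B1" "p \<notin> closed_segment ?B1 ?A1"
      using ver[of ?A1 ?B1] ver[of ?B1 ?A1] p by fastforce+
    have pvl: "p \<notin> closed_segment ?A2 ?B2" "p \<notin> closed_segment ?B2 ?A2"
      using Tver T by (auto simp: closed_segment_commute simp del: in_segment)
    \<comment> \<open>The two loops differ by the rectangle with corners \<open>?A2\<close>, \<open>?A1\<close>, \<open>?B1\<close>, \<open>?B2\<close>.\<close>
    let ?W = "\<lambda>z w. winding_number (linepath z w) p"
    have rev: "?W z w = - ?W w z" if "p \<notin> closed_segment w z" for z w
      using winding_number_reversepath [of "linepath w z" p] that by simp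
    have ph: "p \<notin> closed_segment A ?A1" "p \<notin> closed_segment ?A1 A" "p \<notin> closed_segment A ?A2" "p \<notin> closed_segment ?A2 A"
       "p \<notin> closed_segment B ?B1" "p \<notin> closed_segment ?B1 B" "p \<notin> closed_segment B ?B2" "p \<notin> closed_segment ?B2 B"
      by (auto intro!: pT disj disjB simp del: in_segment)
    have pl: "p \<notin> closed_segment ?A2 ?A1" "p \<notin> closed_segment ?B1 ?B2"
      using hor[of ?A2 ?A1] hor[of ?B1 ?B2] T by fastforce+
    have pg0: "p \<notin> path_image g" using T by blast
    have W1: "winding_number loop p = winding_number g p + (?W B ?B1 + (?W ?B1 ?A1 + ?W ?A1 A))"
      unfolding loop_def using g pg0 ph pv
      by (simp add: winding_number_join path_image_join del: in_segment)
    have W2: "winding_number left_loop p = winding_number g p + (?W B ?B2 + (?W ?B2 ?A2 + ?W ?A2 A))"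
      unfolding left_loop_def using g pg0 ph pvl
      by (simp add: winding_number_join path_image_join del: in_segment)
    have W3: "winding_number (rectpath ?A2 ?B1) p = ?W ?A2 ?A1 + (?W ?A1 ?B1 + (?W ?B1 ?B2 + ?W ?B2 ?A2))"
      unfolding rectpath_def Let_def using pl pv pvl
      by (simp add: winding_number_join path_image_join del: in_segment)
    have "p \<in> box ?A2 ?B1"
      using T Re_T[OF T(4)] p by (auto simp: in_box_complex_iff)
    hence "winding_number (rectpath ?A2 ?B1) p = 1" by (rule winding_number_rectpath)
    moreover have "?W ?A2 ?A1 = ?W ?A2 A + ?W A ?A1"
      using AB L(2) by (intro winding_number_split_linepath pl) (auto simp: closed_segment_same_Im closed_segment_eq_real_ivl)
    moreover have "?W ?B1 ?B2 = ?W ?B1 B + ?W B ?B2"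
      using AB L(2) by (intro winding_number_split_linepath pl) (auto simp: closed_segment_same_Im closed_segment_eq_real_ivl)
    ultimately show "winding_number loop p = -1"
      using W0 W1 W2 W3 rev[of ?B1 ?A1] rev[of A ?A1] rev[of ?B1 B] rev[of A ?A2] rev[of B ?B2] pv ph by simp algebra
  }
qed

section \<open>From a separating contour to a vertical line\<close>

text \<open>
  Within a bounded range of heights only a compact piece of the contour is visible.
\<close>

lemma closed_range_vertical_contour:
  assumes "vertical_contour \<gamma>"
  shows "closed (range \<gamma>)"
proof -
  have cont: "continuous_on {a..b} \<gamma>" for a b
    using assms by (auto simp: vertical_contour_def piecewise_C1_differentiable_on_def)
  have "z \<in> range \<gamma>" if z: "z \<in> closure (range \<gamma>)" for z
  proof -
    define Y where "Y = \<bar>Im z\<bar> + 1"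
    obtain a where a: "\<And>s. s \<le> a \<Longrightarrow> Im (\<gamma> s) \<le> - Y"
      using assms unfolding vertical_contour_def filterlim_at_bot eventually_at_bot_linorder by blast
    obtain b where b: "\<And>s. s \<ge> b \<Longrightarrow> Im (\<gamma> s) \<ge> Y"
      using assms unfolding vertical_contour_def filterlim_at_top eventually_at_top_linorder by blast
    let ?U = "{x. - Y < Im x} \<inter> {x. Im x < Y}"
    have "open ?U" by (intro open_Int open_halfspace_Im_gt open_halfspace_Im_lt)
    moreover have "z \<in> ?U" by (auto simp: Y_def)
    ultimately have "z \<in> closure (?U \<inter> range \<gamma>)"
      using z open_Int_closure_subset by blast
    moreover have "?U \<inter> range \<gamma> \<subseteq> \<gamma> ` {a..b}"
    proof clarsimp
      fix s assume "- Y < Im (\<gamma> s)" "Im (\<gamma> s) < Y"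
      hence "a \<le> s" "s \<le> b" using a[of s] b[of s] by linarith+
      then show "\<gamma> s \<in> \<gamma> ` {a..b}" by auto
    qed
    moreover have "closed (\<gamma> ` {a..b})"
      by (intro compact_imp_closed compact_continuous_image cont) auto
    ultimately have "z \<in> \<gamma> ` {a..b}" by (meson closure_minimal subsetD)
    then show ?thesis by auto
  qed
  then show ?thesis using closure_subset_eq [of "range \<gamma>"] by blast
qed

text \<open>
  Connected components of an open set are path components, and the image of a path is compact. Compactness
  matters: the set that joins a pole to a half-plane has to lie within a bounded range of heights.
\<close>

lemma compact_connected_joining:
  assumes "vertical_contour \<gamma>" "connected_component (- range \<gamma>) p x"
  obtains T where "connected T" "compact T" "p \<in> T" "x \<in> T" "T \<inter> range \<gamma> = {}"
proof -
  have "open (- range \<gamma>)" using closed_range_vertical_contour [OF assms(1)] by (simp add: open_Compl)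
  then have "path_component (- range \<gamma>) p x"
    using assms(2) by (simp add: open_path_connected_component)
  then obtain g where "path g" "path_image g \<subseteq> - range \<gamma>" "pathstart g = p" "pathfinish g = x"
    unfolding path_component_def by blast
  then show ?thesis
    by (intro that [of "path_image g"]) (auto simp: connected_path_image compact_path_image)
qed

lemma right_of_contour_joined:
  assumes "vertical_contour \<gamma>" "right_of_contour \<gamma> p"
  obtains T where "connected T" "compact T" "p \<in> T" "T \<inter> range \<gamma> = {}" "\<exists>x\<in>T. X \<le> Re x"
proof -
  from assms(2) have "\<forall>\<^sub>F x in at_top. connected_component (- range \<gamma>) p (complex_of_real x) \<and> X \<le> x"
    unfolding right_of_contour_def by (intro eventually_conj eventually_ge_at_top)
  then obtain x where "connected_component (- range \<gamma>) p (complex_of_real x)" "X \<le> x"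
    using eventually_happens' [OF trivial_limit_at_top_linorder] by blast
  moreover from this obtain T where "connected T" "compact T" "p \<in> T" "complex_of_real x \<in> T" "T \<inter> range \<gamma> = {}"
    using compact_connected_joining [OF assms(1)] by blast
  ultimately show ?thesis by (intro that [of T] bexI [of _ "complex_of_real x"]) auto
qed

lemma left_of_contour_joined:
  assumes "vertical_contour \<gamma>" "left_of_contour \<gamma> p"
  obtains T where "connected T" "compact T" "p \<in> T" "T \<inter> range \<gamma> = {}" "\<exists>x\<in>T. Re x \<le> X"
proof -
  from assms(2) have "\<forall>\<^sub>F x in at_bot. connected_component (- range \<gamma>) p (complex_of_real x) \<and> x \<le> X"
    unfolding left_of_contour_def by (intro eventually_conj eventually_le_at_bot)
  then obtain x where "connected_component (- range \<gamma>) p (complex_of_real x)" "x \<le> X"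
    using eventually_happens' [OF trivial_limit_at_bot_linorder] by blast
  moreover from this obtain T where "connected T" "compact T" "p \<in> T" "complex_of_real x \<in> T" "T \<inter> range \<gamma> = {}"
    using compact_connected_joining [OF assms(1)] by blast
  ultimately show ?thesis by (intro that [of T] bexI [of _ "complex_of_real x"]) auto
qed

text \<open>
  This is the residue theorem for the loop consisting of a long piece of the contour and of the line
  \<open>Re z = R\<close>. The poles in \<open>P\<close> have winding number \<open>-1\<close>, those in \<open>Q\<close> have winding number \<open>0\<close>. The
  horizontal segments have length at most \<open>R - l\<close>, so uniform smallness of \<open>f\<close> at large heights
  suffices, and the two ends of the contour may recede independently. Each pole in \<open>Q\<close> needs an escape
  route to the left that does not cross the line: a route that merely avoids the contour could wander to its
  right, so \<open>R\<close> has to be chosen after the routes.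
\<close>

lemma vertical_contour_to_line:
  fixes f :: "complex \<Rightarrow> complex" and l R r :: real
  assumes vc: "vertical_contour \<gamma>"
    and strip: "\<And>s. l < Re (\<gamma> s)" "\<And>s. Re (\<gamma> s) < R" "R < r"
    and fin: "finite P" "finite Q" "P \<inter> Q = {}"
    and holo: "f holomorphic_on {z. l < Re z \<and> Re z < r} - (P \<union> Q)"
    and left_of_line: "\<And>p. p \<in> P \<Longrightarrow> Re p < R"
    and P: "\<And>p. p \<in> P \<Longrightarrow> right_of_contour \<gamma> p"
    and Q: "\<And>q. q \<in> Q \<Longrightarrow> \<exists>T. connected T \<and> compact T \<and> q \<in> T \<and> T \<inter> range \<gamma> = {} \<and>
               T \<subseteq> {z. Re z < R} \<and> (\<exists>x\<in>T. Re x \<le> l)"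
    and decay: "\<And>e. e > 0 \<Longrightarrow> \<exists>Y. \<forall>z. l \<le> Re z \<longrightarrow> Re z \<le> R \<longrightarrow> Y \<le> \<bar>Im z\<bar> \<longrightarrow> norm (f z) \<le> e"
    and line: "((\<lambda>y. f (Complex R y)) has_integral I) UNIV"
  shows "(f has_infinite_contour_integral
           (\<i> * I - 2 * of_real pi * \<i> * (\<Sum>p\<in>P. residue f p))) \<gamma>"
proof -
  define J where "J = \<i> * I - 2 * of_real pi * \<i> * (\<Sum>p\<in>P. residue f p)"
  have lR: "l < R" using strip(1) [of 0] strip(2) [of 0] by linarith
  obtain TQ where TQ: "\<And>q. q \<in> Q \<Longrightarrow> connected (TQ q) \<and> compact (TQ q) \<and> q \<in> TQ q \<and> TQ q \<inter> range \<gamma> = {} \<and>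
               TQ q \<subseteq> {z. Re z < R} \<and> (\<exists>x\<in>TQ q. Re x \<le> l)"
    using Q by metis
  have "\<exists>T. connected T \<and> compact T \<and> p \<in> T \<and> T \<inter> range \<gamma> = {} \<and> (\<exists>x\<in>T. R \<le> Re x)" if "p \<in> P" for p
    by (rule right_of_contour_joined [OF vc P[OF that], of R]) blast
  then obtain TP where TP: "\<And>p. p \<in> P \<Longrightarrow> connected (TP p) \<and> compact (TP p) \<and> p \<in> TP p \<and> TP p \<inter> range \<gamma> = {} \<and>
               (\<exists>x\<in>TP p. R \<le> Re x)"
    by metis
  have off_contour: "x \<notin> range \<gamma>" if "x \<in> P \<union> Q" for x
  proof (cases "x \<in> P")
    case True
    then show ?thesis using TP [OF True] by (metis IntI empty_iff)
  next
    case False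
    then show ?thesis using TQ [of x] that by (metis IntI empty_iff UnE)
  qed
  have Re_poles: "Re x < R" if "x \<in> P \<union> Q" for x
  proof (cases "x \<in> P")
    case True
    then show ?thesis using left_of_line by simp
  next
    case False
    then have "x \<in> TQ x" "TQ x \<subseteq> {z. Re z < R}" using TQ [of x] that by simp_all
    then show ?thesis by blast
  qed
  have "bounded ((\<Union>p\<in>P. TP p) \<union> (\<Union>q\<in>Q. TQ q))"
    using fin TP TQ by (auto intro!: bounded_UN compact_imp_bounded)
  then obtain Y1 where Y1: "\<And>z. z \<in> (\<Union>p\<in>P. TP p) \<union> (\<Union>q\<in>Q. TQ q) \<Longrightarrow> norm z \<le> Y1"
    unfolding bounded_iff by blast
  have "\<exists>B>0. \<forall>a b. ball 0 B \<subseteq> cbox a b \<longrightarrow>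
     (\<exists>z. ((\<lambda>x. if x \<in> UNIV then f (\<gamma> x) * vector_derivative \<gamma> (at x) else 0) has_integral z) (cbox a b) \<and>
          norm (z - J) < e)" if "e > 0" for e
  proof -
    \<comment> \<open>Each horizontal segment may contribute \<open>e / 4\<close>, and the truncated line \<open>e / 2\<close>.\<close>
    define e1 where "e1 = e / (4 * (R - l))"
    have "e1 > 0" using that lR by (simp add: e1_def)
    from decay [OF this] obtain Y0 where
      Y0: "\<And>z. l \<le> Re z \<Longrightarrow> Re z \<le> R \<Longrightarrow> Y0 \<le> \<bar>Im z\<bar> \<Longrightarrow> norm (f z) \<le> e1" by blast
    obtain B1 where B1: "B1 > 0"
      "\<And>a b. ball 0 B1 \<subseteq> cbox a b \<Longrightarrow>
        \<exists>z. ((\<lambda>y. f (Complex R y)) has_integral z) (cbox a b) \<and> norm (z - I) < e / 2"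
    proof -
      have "e / 2 > 0" using \<open>e > 0\<close> by simp
      with line obtain B1 where "B1 > 0" and
        "\<forall>a b. ball 0 B1 \<subseteq> cbox a b \<longrightarrow>
           (\<exists>z. ((\<lambda>y. if y \<in> UNIV then f (Complex R y) else 0) has_integral z) (cbox a b) \<and> norm (z - I) < e / 2)"
        unfolding has_integral' [of _ _ UNIV] by blast
      then show thesis by (intro that [of B1]) simp_all
    qed
    define Y where "Y = Max {1, Y0, Y1 + 1, B1}"
    have Y: "1 \<le> Y" "Y0 \<le> Y" "Y1 < Y" "B1 \<le> Y" by (auto simp: Y_def intro: less_le_trans [of Y1 "Y1 + 1"])
    obtain s1 where s1: "\<And>s. s \<le> s1 \<Longrightarrow> Im (\<gamma> s) \<le> - Y"
      using vc unfolding vertical_contour_def filterlim_at_bot eventually_at_bot_linorder by blast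
    obtain s2 where s2: "\<And>s. s \<ge> s2 \<Longrightarrow> Im (\<gamma> s) \<ge> Y"
      using vc unfolding vertical_contour_def filterlim_at_top eventually_at_top_linorder by blast
    define S where "S = Max {1, -s1, s2}"
    have S: "S \<ge> 1" "- s1 \<le> S" "s2 \<le> S" by (auto simp: S_def)
    show ?thesis
    proof (rule exI [of _ "S + 1"], intro conjI allI impI)
      show "S + 1 > 0" using S by linarith
      fix a b :: real
      assume "ball 0 (S + 1) \<subseteq> cbox a b"
      moreover have "S \<in> ball 0 (S + 1)" "- S \<in> ball 0 (S + 1)" using S by (auto simp: dist_real_def)
      ultimately have "S \<in> cbox a b" "- S \<in> cbox a b" by blast+
      hence ab: "a \<le> - S" "S \<le> b" by simp_all
      hence "a < b" using S by linarith
      define A B where "A = \<gamma> a" and "B = \<gamma> b"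
      have AB: "Im A \<le> - Y" "Y \<le> Im B" using s1[of a] s2[of b] ab S by (auto simp: A_def B_def)
      have ABRe: "l < Re A" "Re A < R" "l < Re B" "Re B < R" using strip by (auto simp: A_def B_def)
      have pw: "\<gamma> piecewise_C1_differentiable_on {a..b}" using vc by (simp add: vertical_contour_def)
      define g where "g = (\<lambda>u. \<gamma> ((b - a) * u + a))"
      note arc = reparametrized_arc [OF pw \<open>a < b\<close>, folded g_def]
      have gends: "pathstart g = A" "pathfinish g = B"
        by (auto simp: g_def A_def B_def pathstart_def pathfinish_def)
      let ?A1 = "Complex R (Im A)" and ?B1 = "Complex R (Im B)"
      define loop where "loop = g +++ linepath B ?B1 +++ linepath ?B1 ?A1 +++ linepath ?A1 A"
      define U where "U = {z. l < Re z \<and> Re z < r}"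
      have U: "open U" "convex U"
      proof -
        have "U = {z. l < Re z} \<inter> {z. Re z < r}" by (auto simp: U_def)
        then show "open U" "convex U"
          by (auto intro!: open_Int convex_Int open_halfspace_Re_gt open_halfspace_Re_lt
                convex_halfspace_Re_gt convex_halfspace_Re_lt)
      qed
      have pg: "path_image g \<subseteq> {z. l < Re z \<and> Re z < R}" "path_image g \<subseteq> range \<gamma>"
        using arc(2) strip by auto
      have notg: "x \<notin> path_image g" if "x \<in> P \<union> Q" for x
        using off_contour [OF that] pg(2) by blast
      have Im_PQ: "\<bar>Im x\<bar> < Y" if "x \<in> P \<union> Q" for x
      proof -
        have "x \<in> (\<Union>p\<in>P. TP p) \<union> (\<Union>q\<in>Q. TQ q)"
        proof (cases "x \<in> P")
          case True
          then show ?thesis using TP [OF True] by (intro UnI1 UN_I [of x]) simp_all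
        next
          case False
          then show ?thesis using TQ [of x] that by (intro UnI2 UN_I [of x]) simp_all
        qed
        then show ?thesis using Y1 [of x] abs_Im_le_cmod [of x] Y by linarith
      qed
      have ReR: "Re x < R" if "x \<in> P \<union> Q" for x
        using Re_poles [OF that] .
      have seg1: "closed_segment B ?B1 \<subseteq> {z. l < Re z \<and> Re z \<le> R \<and> Im z = Im B}"
        using ABRe by (auto simp: closed_segment_same_Im closed_segment_eq_real_ivl)
      have seg2: "closed_segment ?A1 A \<subseteq> {z. l < Re z \<and> Re z \<le> R \<and> Im z = Im A}"
        using ABRe by (auto simp: closed_segment_same_Im closed_segment_eq_real_ivl)
      have seg3: "closed_segment ?B1 ?A1 \<subseteq> {z. Re z = R}"
        by (auto simp: closed_segment_same_Re)
      define V where "V = U - (P \<union> Q)"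
      have "open V" using U fin by (auto simp: V_def intro!: open_Diff finite_imp_closed)
      have inV: "path_image g \<subseteq> V" "closed_segment B ?B1 \<subseteq> V" "closed_segment ?A1 A \<subseteq> V" "closed_segment ?B1 ?A1 \<subseteq> V"
      proof -
        show "path_image g \<subseteq> V" using pg notg strip(3) by (fastforce simp: V_def U_def)
        have *: "x \<in> V" if "l < Re x" "Re x \<le> R" "Y \<le> \<bar>Im x\<bar>" for x
          using that Im_PQ[of x] strip(3) by (auto simp: V_def U_def)
        show "closed_segment B ?B1 \<subseteq> V" "closed_segment ?A1 A \<subseteq> V"
          using AB seg1 seg2 Y * by (force, force)
        show "closed_segment ?B1 ?A1 \<subseteq> V"
          using seg3 ReR lR strip(3) by (fastforce simp: V_def U_def)
      qed
      have vl: "valid_path loop"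
        using arc(1) gends by (auto simp: loop_def intro!: valid_path_join)
      have ploop: "path_image loop \<subseteq> V"
        using inV gends unfolding loop_def by (intro subset_path_image_join) (auto simp del: in_segment)
      have loopU: "path_image loop \<subseteq> U" using ploop by (auto simp: V_def)
      have closed_loop: "pathfinish loop = pathstart loop" using gends by (simp add: loop_def)
      have "contour_integral loop f = 2 * pi * \<i> * (\<Sum>p\<in>P \<union> Q. winding_number loop p * residue f p)"
      proof (rule Residue_theorem [of U])
        show "\<forall>z. z \<notin> U \<longrightarrow> winding_number loop z = 0"
          using loopU vl U closed_loop
          by (auto intro!: winding_number_zero_outside [of loop U] simp: valid_path_imp_path)
      qed (use U fin holo ploop vl closed_loop in \<open>simp_all add: U_def V_def convex_connected\<close>)
      also have "(\<Sum>p\<in>P \<union> Q. winding_number loop p * residue f p) =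
           (\<Sum>p\<in>P. winding_number loop p * residue f p) + (\<Sum>p\<in>Q. winding_number loop p * residue f p)"
        using fin by (intro sum.union_disjoint) auto
      also have "(\<Sum>p\<in>Q. winding_number loop p * residue f p) = 0"
      proof (intro sum.neutral ballI)
        fix q assume q: "q \<in> Q"
        have ImT: "TQ q \<subseteq> {z. Im A < Im z \<and> Im z < Im B}"
        proof clarify
          fix z assume "z \<in> TQ q"
          hence "norm z \<le> Y1" using q by (intro Y1) blast
          hence "\<bar>Im z\<bar> < Y" using abs_Im_le_cmod [of z] Y by linarith
          then show "Im A < Im z \<and> Im z < Im B" using AB by linarith
        qed
        have "winding_number loop q = 0"
          unfolding loop_def
          by (rule winding_number_right_closure(1) [of _ _ _ l, where T = "TQ q"])
             (use arc(1) gends AB ABRe Y pg TQ[OF q] ImT in \<open>auto simp: valid_path_imp_path\<close>)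
        then show "winding_number loop q * residue f q = 0" by simp
      qed
      also have "(\<Sum>p\<in>P. winding_number loop p * residue f p) = (\<Sum>p\<in>P. - residue f p)"
      proof (intro sum.cong refl)
        fix p assume p: "p \<in> P"
        have ImT: "TP p \<subseteq> {z. Im A < Im z \<and> Im z < Im B}"
        proof clarify
          fix z assume "z \<in> TP p"
          hence "norm z \<le> Y1" using p by (intro Y1) blast
          hence "\<bar>Im z\<bar> < Y" using abs_Im_le_cmod [of z] Y by linarith
          then show "Im A < Im z \<and> Im z < Im B" using AB by linarith
        qed
        have "winding_number loop p = -1"
          unfolding loop_def
          by (rule winding_number_right_closure(2) [of _ _ _ l, where T = "TP p"])
             (use arc(1) gends AB ABRe Y pg TP[OF p] left_of_line[OF p] ImT in \<open>auto simp: valid_path_imp_path compact_imp_bounded\<close>)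
        then show "winding_number loop p * residue f p = - residue f p" by simp
      qed
      finally have res: "contour_integral loop f = - (2 * of_real pi * \<i> * (\<Sum>p\<in>P. residue f p))"
        by (simp add: sum_negf)
      have holoV: "f holomorphic_on V" using holo by (simp add: V_def U_def)
      have ci: "f contour_integrable_on h" if "valid_path h" "path_image h \<subseteq> V" for h
        using contour_integrable_holomorphic_simple [OF holoV \<open>open V\<close>] that by blast
      obtain j where j: "(f has_contour_integral j) g" using ci [OF arc(1) inV(1)] unfolding contour_integrable_on_def by blast
      obtain j1 where j1: "(f has_contour_integral j1) (linepath B ?B1)" using ci [of "linepath B ?B1"] inV(2) unfolding contour_integrable_on_def by auto
      obtain j2 where j2: "(f has_contour_integral j2) (linepath ?A1 A)" using ci [of "linepath ?A1 A"] inV(3) unfolding contour_integrable_on_def by auto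
      have "ball 0 B1 \<subseteq> cbox (Im A) (Im B)" using AB Y by (auto simp: dist_real_def)
      then obtain z where z: "((\<lambda>y. f (Complex R y)) has_integral z) (cbox (Im A) (Im B))" "norm (z - I) < e / 2"
        using B1 by blast
      have "Im A < Im B" using AB Y by linarith
      have "(f has_contour_integral (\<i> * z)) (linepath ?A1 ?B1)"
        using z \<open>Im A < Im B\<close> by (subst has_contour_integral_linepath_same_Re_iff) (auto simp: mult.assoc [symmetric])
      hence j3: "(f has_contour_integral (- (\<i> * z))) (linepath ?B1 ?A1)"
        by (rule has_contour_integral_reverse_linepath)
      have "(f has_contour_integral (j + (j1 + (- (\<i> * z) + j2)))) loop"
        unfolding loop_def using arc(1) gends
        by (intro has_contour_integral_join j j1 j2 j3 valid_path_join) auto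
      hence jeq: "j + (j1 + (- (\<i> * z) + j2)) = - (2 * of_real pi * \<i> * (\<Sum>p\<in>P. residue f p))"
        using res by (simp add: contour_integral_unique)
      have "norm j1 \<le> e1 * norm (?B1 - B)"
        by (rule has_contour_integral_bound_linepath [OF j1]) (use \<open>e1 > 0\<close> seg1 AB Y in \<open>auto intro!: Y0\<close>)
      also have "\<dots> \<le> e1 * (R - l)"
        using ABRe \<open>e1 > 0\<close> by (intro mult_left_mono) (simp_all add: cmod_def)
      also have "\<dots> = e / 4" using lR by (simp add: e1_def field_simps)
      finally have n1: "norm j1 \<le> e / 4" .
      have "norm j2 \<le> e1 * norm (A - ?A1)"
        by (rule has_contour_integral_bound_linepath [OF j2]) (use \<open>e1 > 0\<close> seg2 AB Y in \<open>auto intro!: Y0\<close>)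
      also have "\<dots> \<le> e1 * (R - l)"
        using ABRe \<open>e1 > 0\<close> by (intro mult_left_mono) (simp_all add: cmod_def)
      also have "\<dots> = e / 4" using lR by (simp add: e1_def field_simps)
      finally have n2: "norm j2 \<le> e / 4" .
      have "j - J = \<i> * (z - I) - j1 - j2"
        using jeq by (simp add: J_def algebra_simps eq_neg_iff_add_eq_0)
      hence "norm (j - J) \<le> norm (\<i> * (z - I)) + norm j1 + norm j2"
        by (metis norm_triangle_ineq4 add_right_mono order_trans)
      also have "\<dots> < e" using z(2) n1 n2 by (simp add: norm_mult)
      finally have "norm (j - J) < e" .
      moreover have "((\<lambda>x. if x \<in> UNIV then f (\<gamma> x) * vector_derivative \<gamma> (at x) else 0) has_integral j) (cbox a b)"
        using arc(3) [OF j] by simp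
      ultimately show "\<exists>z. ((\<lambda>x. if x \<in> UNIV then f (\<gamma> x) * vector_derivative \<gamma> (at x) else 0) has_integral z) (cbox a b) \<and>
          norm (z - J) < e" by blast
    qed
  qed
  then show ?thesis
    unfolding has_infinite_contour_integral_def J_def [symmetric] has_integral' [of _ _ UNIV] by blast
qed

section \<open>The Barnes kernel and its line integrals\<close>

text \<open>
  The explicit bound serves both for integrability and for all later estimates of line integrals.
\<close>

lemma exponential_decay_integral:
  fixes f :: "real \<Rightarrow> complex"
  assumes cont: "continuous_on UNIV f" and bd: "\<And>y. norm (f y) \<le> C * exp (- \<delta> * \<bar>y\<bar>)" and "\<delta> > 0"
  shows "f integrable_on UNIV" and "norm (integral UNIV f) \<le> 2 * C / \<delta>"
proof -
  let ?g = "\<lambda>y::real. exp (- \<delta> * \<bar>y\<bar>)"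
  have 1: "(?g has_integral (1 / \<delta>)) {0..}"
    using has_integral_exp_minus_to_infinity [OF \<open>\<delta> > 0\<close>, of 0]
    by (rule has_integral_eq [rotated, OF has_integral_eq_rhs]) auto
  have "?g absolutely_integrable_on {0..}"
    using 1 by (intro nonnegative_absolutely_integrable_1) (auto simp: has_integral_integrable)
  moreover have "integral {0..} ?g = 1 / \<delta>" using 1 by (rule integral_unique)
  ultimately have "?g absolutely_integrable_on {..0} \<and> integral {..0} ?g = 1 / \<delta>"
    using has_absolute_integral_reflect_real [of "{..0}" "{0..}" ?g "1 / \<delta>"] by auto
  hence 2: "(?g has_integral (1 / \<delta>)) {..0}"
    by (metis has_integral_iff set_lebesgue_integral_eq_integral(1))
  have "(?g has_integral (1 / \<delta> + 1 / \<delta>)) ({..0} \<union> {0..})"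
  proof (rule has_integral_Un [OF 2 1])
    have "{..0} \<inter> {0..} = {0::real}" by auto
    then show "negligible ({..0} \<inter> {0..} :: real set)" by simp
  qed
  moreover have "{..0} \<union> {0..} = (UNIV :: real set)" by auto
  ultimately have g: "((\<lambda>y. C * ?g y) has_integral C * (1 / \<delta> + 1 / \<delta>)) UNIV"
    by (intro has_integral_mult_right) simp
  show f: "f integrable_on UNIV"
  proof (rule measurable_bounded_by_integrable_imp_integrable [OF _ _ bd])
    show "f \<in> borel_measurable (lebesgue_on UNIV)"
      using cont by (intro continuous_imp_measurable_on_sets_lebesgue) auto
  qed (use g in \<open>auto simp: has_integral_integrable\<close>)
  have "norm (integral UNIV f) \<le> integral UNIV (\<lambda>y. C * ?g y)"
    using g by (intro integral_norm_bound_integral f bd) (auto simp: has_integral_integrable)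
  also have "\<dots> = C * (1 / \<delta> + 1 / \<delta>)" using g by (rule integral_unique)
  also have "\<dots> = 2 * C / \<delta>" by simp
  finally show "norm (integral UNIV f) \<le> 2 * C / \<delta>" .
qed

definition barnes_kernel :: "complex \<Rightarrow> complex \<Rightarrow> complex \<Rightarrow> complex" where
  "barnes_kernel b w z = Gamma (- z) * Gamma (z + b) * exp (w * z)"

lemma barnes_kernel_holomorphic:
  assumes "\<And>z k. z \<in> S \<Longrightarrow> z \<noteq> of_nat k" "\<And>z k. z \<in> S \<Longrightarrow> z \<noteq> - b - of_nat k"
  shows "barnes_kernel b w holomorphic_on S"
  unfolding barnes_kernel_def
proof (intro holomorphic_intros)
  fix z assume z: "z \<in> S"
  show "- z \<notin> \<int>\<^sub>\<le>\<^sub>0"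
    using assms(1) [OF z] by (auto elim!: nonpos_Ints_cases' simp: minus_equation_iff)
  show "z + b \<notin> \<int>\<^sub>\<le>\<^sub>0"
  proof
    assume "z + b \<in> \<int>\<^sub>\<le>\<^sub>0"
    then obtain k where "z + b = - of_nat k" by (auto elim: nonpos_Ints_cases')
    then show False using assms(2) [OF z, of k] by (simp add: algebra_simps eq_neg_iff_add_eq_0)
  qed
qed

text \<open>
  Each Gamma factor contributes a rate close to \<open>pi / 2\<close>, and \<open>exp (w * z)\<close> costs at most \<open>\<bar>Im w\<bar>\<close>.
\<close>

lemma barnes_kernel_strip_decay:
  assumes "0 < \<delta>" "\<delta> < pi - \<bar>Im w\<bar>"
  shows "\<exists>C>0. \<exists>Y. \<forall>z. \<bar>Re z\<bar> \<le> \<rho> \<longrightarrow> Y \<le> \<bar>Im z\<bar> \<longrightarrow>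
            norm (barnes_kernel b w z) \<le> C * exp (- \<delta> * \<bar>Im z\<bar>)"
proof -
  define \<eta> where "\<eta> = min (pi / 2) ((pi - \<bar>Im w\<bar> - \<delta>) / 2)"
  have \<eta>: "0 < \<eta>" "\<eta> \<le> pi / 2" "\<delta> \<le> pi - \<bar>Im w\<bar> - 2 * \<eta>" using assms by (auto simp: \<eta>_def min_def field_simps)
  obtain C1 where C1: "C1 > 0" "\<And>z. \<bar>Re z\<bar> \<le> \<rho> \<Longrightarrow> 1 \<le> \<bar>Im z\<bar> \<Longrightarrow> norm (Gamma z) \<le> C1 * exp (- (pi / 2 - \<eta>) * \<bar>Im z\<bar>)"
    using Gamma_vertical_strip_decay [OF \<eta>(1)] by metis
  obtain C2 where C2: "C2 > 0" "\<And>z. \<bar>Re z\<bar> \<le> \<rho> + \<bar>Re b\<bar> \<Longrightarrow> 1 \<le> \<bar>Im z\<bar> \<Longrightarrow> norm (Gamma z) \<le> C2 * exp (- (pi / 2 - \<eta>) * \<bar>Im z\<bar>)"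
    using Gamma_vertical_strip_decay [OF \<eta>(1)] by metis
  define C where "C = C1 * C2 * exp (\<bar>Re w\<bar> * \<rho> + (pi / 2 - \<eta>) * \<bar>Im b\<bar>)"
  have "C > 0" using C1 C2 by (simp add: C_def)
  moreover have "norm (barnes_kernel b w z) \<le> C * exp (- \<delta> * \<bar>Im z\<bar>)"
    if z: "\<bar>Re z\<bar> \<le> \<rho>" "\<bar>Im b\<bar> + 1 \<le> \<bar>Im z\<bar>" for z
  proof -
    have 1: "norm (Gamma (- z)) \<le> C1 * exp (- (pi / 2 - \<eta>) * \<bar>Im z\<bar>)"
      using C1(2) [of "- z"] z by simp
    have "norm (Gamma (z + b)) \<le> C2 * exp (- (pi / 2 - \<eta>) * \<bar>Im (z + b)\<bar>)"
      using z by (intro C2) auto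
    also have "\<dots> \<le> C2 * exp (- (pi / 2 - \<eta>) * (\<bar>Im z\<bar> - \<bar>Im b\<bar>))"
    proof -
      have "(pi / 2 - \<eta>) * (\<bar>Im z\<bar> - \<bar>Im b\<bar>) \<le> (pi / 2 - \<eta>) * \<bar>Im (z + b)\<bar>"
        using \<eta> by (intro mult_left_mono) auto
      hence "- (pi / 2 - \<eta>) * \<bar>Im (z + b)\<bar> \<le> - (pi / 2 - \<eta>) * (\<bar>Im z\<bar> - \<bar>Im b\<bar>)" by linarith
      then show ?thesis using C2(1) by (intro mult_left_mono) simp_all
    qed
    finally have 2: "norm (Gamma (z + b)) \<le> C2 * exp (- (pi / 2 - \<eta>) * (\<bar>Im z\<bar> - \<bar>Im b\<bar>))" .
    have "Re (w * z) \<le> \<bar>Re w\<bar> * \<rho> + \<bar>Im w\<bar> * \<bar>Im z\<bar>"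
    proof -
      have "Re w * Re z \<le> \<bar>Re w\<bar> * \<bar>Re z\<bar>" by (metis abs_ge_self abs_mult)
      also have "\<dots> \<le> \<bar>Re w\<bar> * \<rho>" using z by (intro mult_left_mono) auto
      finally have "Re w * Re z \<le> \<bar>Re w\<bar> * \<rho>" .
      moreover have "- (Im w * Im z) \<le> \<bar>Im w\<bar> * \<bar>Im z\<bar>" by (metis abs_ge_minus_self abs_mult)
      ultimately show ?thesis by simp
    qed
    hence 3: "norm (exp (w * z)) \<le> exp (\<bar>Re w\<bar> * \<rho> + \<bar>Im w\<bar> * \<bar>Im z\<bar>)"
      by (simp add: norm_exp_eq_Re)
    have "norm (barnes_kernel b w z) \<le> (C1 * exp (- (pi / 2 - \<eta>) * \<bar>Im z\<bar>)) *
        (C2 * exp (- (pi / 2 - \<eta>) * (\<bar>Im z\<bar> - \<bar>Im b\<bar>))) * exp (\<bar>Re w\<bar> * \<rho> + \<bar>Im w\<bar> * \<bar>Im z\<bar>)"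
      unfolding barnes_kernel_def norm_mult using C1 C2 by (intro mult_mono 1 2 3) auto
    also have "\<dots> = C * exp (- (pi - \<bar>Im w\<bar> - 2 * \<eta>) * \<bar>Im z\<bar>)"
      by (simp add: C_def mult_exp_exp) (simp add: algebra_simps)
    also have "\<dots> \<le> C * exp (- \<delta> * \<bar>Im z\<bar>)"
    proof -
      have "\<delta> * \<bar>Im z\<bar> \<le> (pi - \<bar>Im w\<bar> - 2 * \<eta>) * \<bar>Im z\<bar>"
        using \<eta> by (intro mult_right_mono) auto
      hence "- (pi - \<bar>Im w\<bar> - 2 * \<eta>) * \<bar>Im z\<bar> \<le> - \<delta> * \<bar>Im z\<bar>" by linarith
      then show ?thesis using \<open>C > 0\<close> by (intro mult_left_mono) simp_all
    qed
    finally show ?thesis .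
  qed
  ultimately show ?thesis by blast
qed

lemma barnes_kernel_line_decay:
  assumes "0 < \<delta>" "\<delta> < pi - \<bar>Im w\<bar>" and R: "\<And>k::nat. R \<noteq> real k" "0 < R + Re b"
  shows "\<exists>C>0. \<forall>y. norm (barnes_kernel b w (Complex R y)) \<le> C * exp (- \<delta> * \<bar>y\<bar>)"
    and "continuous_on UNIV (\<lambda>y. barnes_kernel b w (Complex R y))"
proof -
  have "barnes_kernel b w holomorphic_on {z. Re z = R}"
  proof (rule barnes_kernel_holomorphic)
    fix z k assume "z \<in> {z. Re z = R}"
    then show "z \<noteq> of_nat k" "z \<noteq> - b - of_nat k" using R(1) [of k] R(2) by auto
  qed
  hence "continuous_on {z. Re z = R} (barnes_kernel b w)" by (rule holomorphic_on_imp_continuous_on)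
  moreover have cC: "continuous_on UNIV (\<lambda>y. Complex R y)"
    unfolding Complex_eq by (intro continuous_intros)
  ultimately show cont: "continuous_on UNIV (\<lambda>y. barnes_kernel b w (Complex R y))"
    by (rule continuous_on_compose2 [of "{z. Re z = R}"]) auto
  obtain C1 Y where C1: "C1 > 0" "\<And>z. \<bar>Re z\<bar> \<le> \<bar>R\<bar> \<Longrightarrow> Y \<le> \<bar>Im z\<bar> \<Longrightarrow>
            norm (barnes_kernel b w z) \<le> C1 * exp (- \<delta> * \<bar>Im z\<bar>)"
    using barnes_kernel_strip_decay [OF assms(1,2)] by metis
  have "compact ((\<lambda>y. barnes_kernel b w (Complex R y)) ` {- \<bar>Y\<bar>..\<bar>Y\<bar>})"
    by (intro compact_continuous_image continuous_on_subset [OF cont]) auto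
  then obtain D where D: "\<And>y. y \<in> {- \<bar>Y\<bar>..\<bar>Y\<bar>} \<Longrightarrow> norm (barnes_kernel b w (Complex R y)) \<le> D"
    by (meson bounded_iff compact_imp_bounded imageI)
  have D0: "D \<ge> 0" using order_trans [OF norm_ge_zero D [of 0]] by simp
  define C where "C = C1 + D * exp (\<delta> * \<bar>Y\<bar>)"
  have "norm (barnes_kernel b w (Complex R y)) \<le> C * exp (- \<delta> * \<bar>y\<bar>)" for y
  proof (cases "Y \<le> \<bar>y\<bar>")
    case True
    then have "norm (barnes_kernel b w (Complex R y)) \<le> C1 * exp (- \<delta> * \<bar>y\<bar>)"
      using C1(2) [of "Complex R y"] by simp
    also have "\<dots> \<le> C * exp (- \<delta> * \<bar>y\<bar>)" using D0 by (intro mult_right_mono) (auto simp: C_def)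
    finally show ?thesis .
  next
    case False
    then have "y \<in> {- \<bar>Y\<bar>..\<bar>Y\<bar>}" unfolding atLeastAtMost_iff by linarith
    then have "norm (barnes_kernel b w (Complex R y)) \<le> D * 1" using D [of y] by simp
    also have "\<dots> \<le> D * exp (\<delta> * \<bar>Y\<bar> - \<delta> * \<bar>y\<bar>)"
      using False assms(1) D0 by (intro mult_left_mono) (auto simp: mult_left_mono)
    also have "\<dots> \<le> C * exp (- \<delta> * \<bar>y\<bar>)"
      using C1(1) by (simp add: C_def exp_diff exp_minus field_simps)
    finally show ?thesis .
  qed
  moreover have "C > 0" using C1 D0 by (simp add: C_def add_pos_nonneg)
  ultimately show "\<exists>C>0. \<forall>y. norm (barnes_kernel b w (Complex R y)) \<le> C * exp (- \<delta> * \<bar>y\<bar>)" by blast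
qed

text \<open>
  The constant \<open>M\<close> is uniform in \<open>G\<close>: the line integral is continuous for the norm weighted by
  \<open>exp (\<eta> * norm z)\<close>. This gives linearity, differentiability in \<open>w\<close> and the exchange with
  infinite sums.
\<close>

lemma barnes_line_integral_bound:
  assumes \<eta>: "0 \<le> \<eta>" "\<eta> < pi - \<bar>Im w\<bar>" and R: "\<And>k::nat. R \<noteq> real k" "0 < R + Re b"
  shows "\<exists>M\<ge>0. \<forall>G K. continuous_on UNIV G \<longrightarrow> (\<forall>z. norm (G z) \<le> K * exp (\<eta> * norm z)) \<longrightarrow>
           (\<lambda>y. G (Complex R y) * barnes_kernel b w (Complex R y)) integrable_on UNIV \<and>
           norm (integral UNIV (\<lambda>y. G (Complex R y) * barnes_kernel b w (Complex R y))) \<le> K * M"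
proof -
  define \<delta> where "\<delta> = (\<eta> + (pi - \<bar>Im w\<bar>)) / 2"
  have \<delta>: "\<eta> < \<delta>" "0 < \<delta>" "\<delta> < pi - \<bar>Im w\<bar>" using \<eta> by (auto simp: \<delta>_def)
  obtain C where C: "C > 0" "\<And>y. norm (barnes_kernel b w (Complex R y)) \<le> C * exp (- \<delta> * \<bar>y\<bar>)"
    using barnes_kernel_line_decay(1) [where R = R and b = b, OF \<delta>(2,3) R] by blast
  define M where "M = 2 * (exp (\<eta> * \<bar>R\<bar>) * C) / (\<delta> - \<eta>)"
  have "M \<ge> 0" using C \<delta> by (simp add: M_def)
  moreover have "(\<lambda>y. G (Complex R y) * barnes_kernel b w (Complex R y)) integrable_on UNIV \<and>
           norm (integral UNIV (\<lambda>y. G (Complex R y) * barnes_kernel b w (Complex R y))) \<le> K * M"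
    if G: "continuous_on UNIV G" "\<And>z. norm (G z) \<le> K * exp (\<eta> * norm z)" for G K
  proof -
    let ?f = "\<lambda>y. G (Complex R y) * barnes_kernel b w (Complex R y)"
    have K: "K \<ge> 0" using order_trans [OF norm_ge_zero G(2) [of 0]] by simp
    have cC: "continuous_on UNIV (\<lambda>y. Complex R y)"
      unfolding Complex_eq by (intro continuous_intros)
    have cont: "continuous_on UNIV ?f"
      by (intro continuous_on_mult barnes_kernel_line_decay(2) [where \<delta> = \<delta>] \<delta> R continuous_on_compose2 [OF G(1) cC]) auto
    have bd: "norm (?f y) \<le> (K * exp (\<eta> * \<bar>R\<bar>) * C) * exp (- (\<delta> - \<eta>) * \<bar>y\<bar>)" for y
    proof -
      have "norm (Complex R y) \<le> \<bar>R\<bar> + \<bar>y\<bar>" using cmod_le [of "Complex R y"] by simp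
      hence "\<eta> * norm (Complex R y) \<le> \<eta> * \<bar>R\<bar> + \<eta> * \<bar>y\<bar>"
        using mult_left_mono [OF _ \<eta>(1)] by (metis distrib_left)
      hence "K * exp (\<eta> * norm (Complex R y)) \<le> K * exp (\<eta> * \<bar>R\<bar> + \<eta> * \<bar>y\<bar>)"
        using K by (intro mult_left_mono) auto
      hence "norm (G (Complex R y)) \<le> K * exp (\<eta> * \<bar>R\<bar> + \<eta> * \<bar>y\<bar>)"
        using G(2) [of "Complex R y"] by linarith
      hence "norm (?f y) \<le> (K * exp (\<eta> * \<bar>R\<bar> + \<eta> * \<bar>y\<bar>)) * (C * exp (- \<delta> * \<bar>y\<bar>))"
        unfolding norm_mult using C K by (intro mult_mono) auto
      also have "\<dots> = (K * exp (\<eta> * \<bar>R\<bar>) * C) * exp (- (\<delta> - \<eta>) * \<bar>y\<bar>)"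
        by (simp add: mult_exp_exp) (simp add: algebra_simps)
      finally show ?thesis .
    qed
    show ?thesis
      using exponential_decay_integral [OF cont bd] \<delta>(1) by (simp add: M_def mult_ac)
  qed
  ultimately show ?thesis by blast
qed

text \<open>
  The value of the contour integral after moving the contour to the line \<open>Re z = N + 1/2\<close>: the first summand
  is the integral along the line, and the second collects the residues at \<open>0, \<dots>, N\<close> that were crossed.
\<close>

definition barnes_value :: "nat \<Rightarrow> complex \<Rightarrow> complex \<Rightarrow> (complex \<Rightarrow> complex) \<Rightarrow> complex" where
  "barnes_value N b w G =
     \<i> * integral UNIV (\<lambda>y. G (Complex (real N + 1/2) y) * barnes_kernel b w (Complex (real N + 1/2) y))
     + 2 * of_real pi * \<i> * (\<Sum>k\<le>N. G (of_nat k) * Gamma (of_nat k + b) * (- exp w) ^ k / fact k)"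

text \<open>
  The class of integrands: it contains the polynomials and the confluent series as a function of its
  first parameter, and it is closed under sums, products and translations. Growth at an arbitrarily small
  exponential rate is what the kernel tolerates for every \<open>w\<close> in the strip \<open>\<bar>Im w\<bar> < pi\<close>.
\<close>

definition min_exp_type :: "(complex \<Rightarrow> complex) \<Rightarrow> bool" where
  "min_exp_type G \<longleftrightarrow> G holomorphic_on UNIV \<and> (\<forall>\<eta>>0. \<exists>K. \<forall>z. norm (G z) \<le> K * exp (\<eta> * norm z))"

lemma half_integer_not_nat: "real N + 1/2 \<noteq> real k"
proof
  assume "real N + 1/2 = real k"
  hence "real (2 * N + 1) = real (2 * k)" by simp
  hence "2 * N + 1 = 2 * k" by (simp only: of_nat_eq_iff)
  then show False by presburger
qed

text \<open>
  The residue of \<open>Gamma (- z)\<close> at \<open>k\<close> is \<open>- (- 1) ^ k / fact k\<close>, and the remaining factors are continuous there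
  because \<open>- b \<notin> \<nat>\<close>.
\<close>

lemma residue_barnes_kernel:
  assumes G: "G holomorphic_on UNIV" and b: "- b \<notin> \<nat>"
  shows "residue (\<lambda>z. G z * barnes_kernel b w z) (of_nat k) =
           - (G (of_nat k) * Gamma (of_nat k + b) * (- exp w) ^ k / fact k)"
proof -
  define F where "F = (\<lambda>z. G z * Gamma (z + b) * exp (w * z))"
  define S where "S = - ((of_nat ` UNIV - {of_nat k}) \<union> (\<lambda>j. - b - of_nat j) ` UNIV :: complex set)"
  have "closed ((of_nat ` UNIV - {of_nat k} :: complex set))"
    by (rule closed_subset_Ints) auto
  moreover have "closed ((\<lambda>j. - b - of_nat j) ` UNIV :: complex set)"
  proof -
    have "(\<lambda>j. - b - of_nat j) ` (UNIV :: nat set) = (\<lambda>x. - b + x) ` ((\<lambda>j. - of_nat j) ` UNIV)"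
      by (auto simp: image_image)
    moreover have "closed ((\<lambda>j. - of_nat j) ` (UNIV :: nat set) :: complex set)"
      by (rule closed_subset_Ints) auto
    ultimately show ?thesis using closed_translation by metis
  qed
  ultimately have "open S" unfolding S_def by (intro open_Compl closed_Un)
  have kb: "of_nat k \<noteq> - b - of_nat j" for j
  proof
    assume "of_nat k = - b - of_nat j"
    hence "- b = of_nat (k + j)" by simp
    then show False using b by (metis of_nat_in_Nats)
  qed
  have "of_nat k \<in> S" using kb by (auto simp: S_def)
  have Fc: "isCont F (of_nat k)"
  proof -
    have "of_nat k + b \<notin> \<int>\<^sub>\<le>\<^sub>0"
    proof
      assume "of_nat k + b \<in> \<int>\<^sub>\<le>\<^sub>0"
      then obtain j where "of_nat k + b = - of_nat j" by (auto elim: nonpos_Ints_cases')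
      then show False using kb [of j] by (simp add: algebra_simps eq_neg_iff_add_eq_0)
    qed
    moreover have "isCont G (of_nat k)"
      using G holomorphic_on_imp_continuous_on continuous_on_eq_continuous_at by blast
    ultimately show ?thesis unfolding F_def by (intro continuous_intros) auto
  qed
  have Gam: "((\<lambda>z. Gamma (- z) * (z - of_nat k)) \<longlongrightarrow> - ((- 1) ^ k / fact k)) (at (of_nat k :: complex))"
  proof -
    have "filterlim (\<lambda>z. - z :: complex) (at (- of_nat k)) (at (of_nat k))"
      by (auto simp: filterlim_at eventually_at_filter intro!: tendsto_intros)
    from filterlim_compose [OF Gamma_residues this]
    have "((\<lambda>z. - (Gamma (- z) * (- z + of_nat k))) \<longlongrightarrow> - ((- 1) ^ k / fact k)) (at (of_nat k :: complex))"
      by (rule tendsto_minus)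
    then show ?thesis by (simp add: algebra_simps)
  qed
  have "residue (\<lambda>z. G z * barnes_kernel b w z) (of_nat k) = F (of_nat k) * - ((- 1) ^ k / fact k)"
  proof (rule residue_simple' [OF \<open>open S\<close> \<open>of_nat k \<in> S\<close>])
    show "(\<lambda>z. G z * barnes_kernel b w z) holomorphic_on S - {of_nat k}"
      by (intro holomorphic_on_mult barnes_kernel_holomorphic holomorphic_on_subset [OF G]) (auto simp: S_def)
    have "((\<lambda>z. F z * (Gamma (- z) * (z - of_nat k))) \<longlongrightarrow> F (of_nat k) * - ((- 1) ^ k / fact k)) (at (of_nat k))"
      using Fc by (intro tendsto_mult Gam) (simp add: isCont_def)
    then show "((\<lambda>z. G z * barnes_kernel b w z * (z - of_nat k)) \<longlongrightarrow> F (of_nat k) * - ((- 1) ^ k / fact k)) (at (of_nat k))"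
      by (simp add: F_def barnes_kernel_def mult_ac)
  qed
  also have "F (of_nat k) * - ((- 1) ^ k / fact k) = - (G (of_nat k) * Gamma (of_nat k + b) * (- exp w) ^ k / fact k)"
  proof -
    have "exp (w * of_nat k) = exp w ^ k" by (simp add: exp_of_nat2_mult)
    moreover have "(- exp w) ^ k = (- 1) ^ k * exp w ^ k" by (rule power_minus)
    ultimately show ?thesis by (simp add: F_def)
  qed
  finally show ?thesis .
qed

text \<open>
  The threshold for \<open>N\<close> depends only on the contour and on \<open>b\<close>: the line has to lie to the right of the
  contour, of the poles \<open>- b - j\<close>, and of the escape routes of the finitely many such poles that enter the
  strip. Its independence of \<open>w\<close> and \<open>G\<close> is what allows a fixed \<open>N\<close> when \<open>w\<close> varies.
\<close>

lemma contour_integral_eq_barnes_value: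
  assumes vc: "vertical_contour \<gamma>" and sep: "separates_poles \<gamma> b" and b: "- b \<notin> \<nat>"
  shows "\<forall>\<^sub>F N in sequentially. \<forall>w G. \<bar>Im w\<bar> < pi \<longrightarrow> min_exp_type G \<longrightarrow>
           ((\<lambda>z. G z * barnes_kernel b w z) has_infinite_contour_integral barnes_value N b w G) \<gamma>"
proof -
  obtain \<rho> where \<rho>: "\<And>s. \<bar>Re (\<gamma> s)\<bar> \<le> \<rho>"
    using vc unfolding vertical_contour_def bounded_iff by auto
  \<comment> \<open>The poles \<open>- b - j\<close> with \<open>j > n0\<close> lie to the left of the strip that contains the contour.\<close>
  define l where "l = - \<rho> - 1"
  obtain n0 :: nat where n0: "\<bar>Re b\<bar> + \<bar>l\<bar> \<le> real n0" using real_arch_simple by blast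
  define Q where "Q = (\<lambda>j. - b - of_nat j) ` {..n0}"
  have "\<exists>T. connected T \<and> compact T \<and> q \<in> T \<and> T \<inter> range \<gamma> = {} \<and> (\<exists>x\<in>T. Re x \<le> l)" if "q \<in> Q" for q
  proof -
    have "left_of_contour \<gamma> q" using that sep by (auto simp: Q_def separates_poles_def)
    then show ?thesis by (rule left_of_contour_joined [OF vc, of _ l]) blast
  qed
  then obtain T where T: "\<And>q. q \<in> Q \<Longrightarrow> connected (T q) \<and> compact (T q) \<and> q \<in> T q \<and> T q \<inter> range \<gamma> = {} \<and> (\<exists>x\<in>T q. Re x \<le> l)"
    by metis
  have "bounded (\<Union>q\<in>Q. T q)"
    using T by (intro bounded_UN) (auto simp: Q_def compact_imp_bounded)
  then obtain R0 where R0: "\<And>z. z \<in> (\<Union>q\<in>Q. T q) \<Longrightarrow> norm z \<le> R0" unfolding bounded_iff by blast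
  \<comment> \<open>Beyond \<open>R0\<close> the line avoids the escape routes of the poles on the left.\<close>
  obtain N0 :: nat where N0: "\<rho> + \<bar>R0\<bar> + \<bar>Re b\<bar> \<le> real N0" using real_arch_simple by blast
  show ?thesis
  proof (rule eventually_sequentiallyI [of N0], intro allI impI)
    fix N w G assume "N0 \<le> N" and w: "\<bar>Im w\<bar> < pi" and G: "min_exp_type G"
    have Gh: "G holomorphic_on UNIV" using G by (simp add: min_exp_type_def)
    define R where "R = real N + 1/2"
    have R: "\<rho> < R" "R0 < R" "0 < R + Re b"
      using N0 \<open>N0 \<le> N\<close> \<rho> [of 0] by (auto simp: R_def)
    have Rk: "R \<noteq> real k" for k unfolding R_def by (rule half_integer_not_nat)
    define P where "P = (of_nat ` {..N} :: complex set)"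
    define f where "f = (\<lambda>z. G z * barnes_kernel b w z)"
    define \<delta> where "\<delta> = (pi - \<bar>Im w\<bar>) / 2"
    have \<delta>: "0 < \<delta>" "\<delta> < pi - \<bar>Im w\<bar>" using w by (auto simp: \<delta>_def)
    define \<eta> where "\<eta> = \<delta> / 2"
    have \<eta>: "0 < \<eta>" "\<eta> < \<delta>" using \<delta> by (auto simp: \<eta>_def)
    obtain K where K: "\<And>z. norm (G z) \<le> K * exp (\<eta> * norm z)"
      using G \<eta>(1) unfolding min_exp_type_def by blast
    have K0: "K \<ge> 0" using order_trans [OF norm_ge_zero K [of 0]] by simp
    have Gc: "continuous_on UNIV G" using Gh by (rule holomorphic_on_imp_continuous_on)
    obtain M where M: "\<And>G K. continuous_on UNIV G \<Longrightarrow> (\<And>z. norm (G z) \<le> K * exp (\<eta> * norm z)) \<Longrightarrow>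
           (\<lambda>y. G (Complex R y) * barnes_kernel b w (Complex R y)) integrable_on UNIV"
      using barnes_line_integral_bound [where \<eta> = \<eta> and w = w and R = R and b = b] \<eta> \<delta> Rk R by auto
    have int: "(\<lambda>y. f (Complex R y)) integrable_on UNIV"
      unfolding f_def using M [OF Gc K] by simp
    have "(f has_infinite_contour_integral
           (\<i> * integral UNIV (\<lambda>y. f (Complex R y)) - 2 * of_real pi * \<i> * (\<Sum>p\<in>P. residue f p))) \<gamma>"
    proof (rule vertical_contour_to_line [where l = l and R = R and r = "real N + 1" and Q = Q])
      show "l < Re (\<gamma> s)" "Re (\<gamma> s) < R" for s using \<rho> [of s] R by (auto simp: l_def)
      show "R < real N + 1" by (simp add: R_def)
      show "P \<inter> Q = {}"
      proof -
        have "of_nat k \<noteq> - b - of_nat j" for k j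
        proof
          assume "of_nat k = - b - of_nat j"
          hence "- b = of_nat (k + j)" by simp
          then show False using b by (metis of_nat_in_Nats)
        qed
        then show ?thesis by (auto simp: P_def Q_def)
      qed
      show "f holomorphic_on {z. l < Re z \<and> Re z < real N + 1} - (P \<union> Q)"
        unfolding f_def
      proof (intro holomorphic_on_mult barnes_kernel_holomorphic holomorphic_on_subset [OF Gh])
        fix z k assume z: "z \<in> {z. l < Re z \<and> Re z < real N + 1} - (P \<union> Q)"
        show "z \<noteq> of_nat k" using z by (auto simp: P_def)
        show "z \<noteq> - b - of_nat k"
        proof
          assume eq: "z = - b - of_nat k"
          have "k \<le> n0" using z eq n0 by (auto simp: le_diff_eq)
          then show False using z eq by (auto simp: Q_def)
        qed
      qed auto
      show "Re p < R" if "p \<in> P" for p using that by (auto simp: P_def R_def)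
      show "right_of_contour \<gamma> p" if "p \<in> P" for p using that sep by (auto simp: P_def separates_poles_def)
      show "\<exists>T. connected T \<and> compact T \<and> q \<in> T \<and> T \<inter> range \<gamma> = {} \<and> T \<subseteq> {z. Re z < R} \<and> (\<exists>x\<in>T. Re x \<le> l)"
        if q: "q \<in> Q" for q
      proof -
        have "T q \<subseteq> {z. Re z < R}"
        proof clarify
          fix z assume "z \<in> T q"
          hence "norm z \<le> R0" using q by (intro R0) blast
          then show "Re z < R" using abs_Re_le_cmod [of z] R by linarith
        qed
        then show ?thesis using T [OF q] by blast
      qed
      show "((\<lambda>y. f (Complex R y)) has_integral integral UNIV (\<lambda>y. f (Complex R y))) UNIV"
        using int by (rule integrable_integral)
      show "\<exists>Y. \<forall>z. l \<le> Re z \<longrightarrow> Re z \<le> R \<longrightarrow> Y \<le> \<bar>Im z\<bar> \<longrightarrow> norm (f z) \<le> e" if "e > 0" for e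
      proof -
        define \<sigma> where "\<sigma> = \<bar>l\<bar> + \<bar>R\<bar>"
        obtain C Y where C: "C > 0" "\<And>z. \<bar>Re z\<bar> \<le> \<sigma> \<Longrightarrow> Y \<le> \<bar>Im z\<bar> \<Longrightarrow>
            norm (barnes_kernel b w z) \<le> C * exp (- \<delta> * \<bar>Im z\<bar>)"
          using barnes_kernel_strip_decay [OF \<delta>] by metis
        define D where "D = K * exp (\<eta> * \<sigma>) * C"
        have fb: "norm (f z) \<le> D * exp (- (\<delta> - \<eta>) * \<bar>Im z\<bar>)" if z: "\<bar>Re z\<bar> \<le> \<sigma>" "Y \<le> \<bar>Im z\<bar>" for z
        proof -
          have "norm z \<le> \<sigma> + \<bar>Im z\<bar>" using cmod_le [of z] z by linarith
          hence "\<eta> * norm z \<le> \<eta> * \<sigma> + \<eta> * \<bar>Im z\<bar>"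
            using mult_left_mono [of "norm z" "\<sigma> + \<bar>Im z\<bar>" \<eta>] \<eta>(1) by (simp add: distrib_left)
          hence "K * exp (\<eta> * norm z) \<le> K * exp (\<eta> * \<sigma> + \<eta> * \<bar>Im z\<bar>)"
            using K0 by (intro mult_left_mono) auto
          hence "norm (G z) \<le> K * exp (\<eta> * \<sigma> + \<eta> * \<bar>Im z\<bar>)" using K [of z] by linarith
          hence "norm (f z) \<le> (K * exp (\<eta> * \<sigma> + \<eta> * \<bar>Im z\<bar>)) * (C * exp (- \<delta> * \<bar>Im z\<bar>))"
            unfolding f_def norm_mult using C z K0 by (intro mult_mono) auto
          also have "\<dots> = D * exp (- (\<delta> - \<eta>) * \<bar>Im z\<bar>)"
            by (simp add: D_def mult_exp_exp) (simp add: algebra_simps)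
          finally show ?thesis .
        qed
        have "((\<lambda>u. D * exp (- (\<delta> - \<eta>) * u)) \<longlongrightarrow> 0) at_top"
        proof -
          have "filterlim (\<lambda>u. - (\<delta> - \<eta>) * u) at_bot at_top"
            using \<eta> by (intro filterlim_tendsto_neg_mult_at_bot [OF tendsto_const] filterlim_ident) auto
          from tendsto_mult_right_zero [OF filterlim_compose [OF exp_at_bot this], of D] show ?thesis .
        qed
        hence "\<forall>\<^sub>F u in at_top. D * exp (- (\<delta> - \<eta>) * u) < e"
          using \<open>e > 0\<close> by (rule order_tendstoD)
        then obtain Y' where Y': "\<And>u. u \<ge> Y' \<Longrightarrow> D * exp (- (\<delta> - \<eta>) * u) < e"
          unfolding eventually_at_top_linorder by blast
        have "norm (f z) \<le> e" if "l \<le> Re z" "Re z \<le> R" "max Y Y' \<le> \<bar>Im z\<bar>" for z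
        proof -
          have "\<bar>Re z\<bar> \<le> \<sigma>" using that unfolding \<sigma>_def by linarith
          then show ?thesis using fb [of z] Y' [of "\<bar>Im z\<bar>"] that by simp
        qed
        then show ?thesis by blast
      qed
    qed (auto simp: P_def Q_def intro: vc)
    also have "(\<Sum>p\<in>P. residue f p) = - (\<Sum>k\<le>N. G (of_nat k) * Gamma (of_nat k + b) * (- exp w) ^ k / fact k)"
      unfolding P_def f_def
      by (subst sum.reindex) (auto simp: inj_on_def residue_barnes_kernel [OF Gh b] sum_negf)
    finally show "((\<lambda>z. G z * barnes_kernel b w z) has_infinite_contour_integral barnes_value N b w G) \<gamma>"
      by (simp add: barnes_value_def f_def R_def)
  qed
qed

section \<open>Entire functions of minimal exponential type\<close>

lemma min_exp_type_bound:
  assumes "min_exp_type G" "\<eta> > 0"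
  obtains K where "K \<ge> 0" "\<And>z. norm (G z) \<le> K * exp (\<eta> * norm z)"
proof -
  obtain K where K: "\<And>z. norm (G z) \<le> K * exp (\<eta> * norm z)"
    using assms unfolding min_exp_type_def by blast
  have "K \<ge> 0" using order_trans [OF norm_ge_zero K [of 0]] by simp
  then show ?thesis using K that by blast
qed

lemma min_exp_type_continuous:
  assumes "min_exp_type G"
  shows "continuous_on UNIV G"
  by (rule holomorphic_on_imp_continuous_on) (use assms in \<open>simp add: min_exp_type_def\<close>)

lemma min_exp_type_const: "min_exp_type (\<lambda>_. c)"
proof -
  have "norm c \<le> norm c * exp (\<eta> * norm z)" if "\<eta> > 0" for \<eta> and z :: complex
    using that by (simp add: mult_le_cancel_left1)
  then show ?thesis unfolding min_exp_type_def by (auto intro!: exI [of _ "norm c"])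
qed

lemma min_exp_type_ident: "min_exp_type (\<lambda>z. z)"
  unfolding min_exp_type_def
proof (intro conjI allI impI)
  fix \<eta> :: real assume "\<eta> > 0"
  have "norm z \<le> 1 / \<eta> * exp (\<eta> * norm z)" for z :: complex
  proof -
    have "\<eta> * norm z \<le> exp (\<eta> * norm z)" using exp_ge_add_one_self [of "\<eta> * norm z"] by linarith
    then show ?thesis using \<open>\<eta> > 0\<close> by (simp add: field_simps)
  qed
  then show "\<exists>K. \<forall>z. norm z \<le> K * exp (\<eta> * norm (z :: complex))" by blast
qed (intro holomorphic_intros)

lemma min_exp_type_add:
  assumes "min_exp_type F" "min_exp_type G"
  shows "min_exp_type (\<lambda>z. F z + G z)"
  unfolding min_exp_type_def
proof (intro conjI allI impI)
  show "(\<lambda>z. F z + G z) holomorphic_on UNIV"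
    using assms by (auto simp: min_exp_type_def intro!: holomorphic_intros)
  fix \<eta> :: real assume "\<eta> > 0"
  obtain K where K: "\<And>z. norm (F z) \<le> K * exp (\<eta> * norm z)" using min_exp_type_bound [OF assms(1) \<open>\<eta> > 0\<close>] by blast
  obtain L where L: "\<And>z. norm (G z) \<le> L * exp (\<eta> * norm z)" using min_exp_type_bound [OF assms(2) \<open>\<eta> > 0\<close>] by blast
  have "norm (F z + G z) \<le> (K + L) * exp (\<eta> * norm z)" for z
    using norm_triangle_ineq [of "F z" "G z"] K [of z] L [of z] by (simp add: distrib_right)
  then show "\<exists>K. \<forall>z. norm (F z + G z) \<le> K * exp (\<eta> * norm z)" by blast
qed

lemma min_exp_type_mult:
  assumes "min_exp_type F" "min_exp_type G"
  shows "min_exp_type (\<lambda>z. F z * G z)"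
  unfolding min_exp_type_def
proof (intro conjI allI impI)
  show "(\<lambda>z. F z * G z) holomorphic_on UNIV"
    using assms by (auto simp: min_exp_type_def intro!: holomorphic_intros)
  fix \<eta> :: real assume "\<eta> > 0"
  hence h: "\<eta> / 2 > 0" by simp
  obtain K where K: "K \<ge> 0" "\<And>z. norm (F z) \<le> K * exp (\<eta> / 2 * norm z)" using min_exp_type_bound [OF assms(1) h] by blast
  obtain L where L: "L \<ge> 0" "\<And>z. norm (G z) \<le> L * exp (\<eta> / 2 * norm z)" using min_exp_type_bound [OF assms(2) h] by blast
  have "norm (F z * G z) \<le> K * L * exp (\<eta> * norm z)" for z
  proof -
    have "norm (F z * G z) \<le> (K * exp (\<eta> / 2 * norm z)) * (L * exp (\<eta> / 2 * norm z))"
      unfolding norm_mult using K L by (intro mult_mono) auto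
    also have "\<dots> = K * L * exp (\<eta> * norm z)" by (simp add: mult_exp_exp)
    finally show ?thesis .
  qed
  then show "\<exists>K. \<forall>z. norm (F z * G z) \<le> K * exp (\<eta> * norm z)" by blast
qed

lemma min_exp_type_translate:
  assumes "min_exp_type G"
  shows "min_exp_type (\<lambda>z. G (z + a))"
  unfolding min_exp_type_def
proof (intro conjI allI impI)
  have "G holomorphic_on UNIV" using assms by (simp add: min_exp_type_def)
  then have "(G \<circ> (\<lambda>z. z + a)) holomorphic_on UNIV"
    by (intro holomorphic_on_compose_gen [where t = UNIV] holomorphic_intros) auto
  then show "(\<lambda>z. G (z + a)) holomorphic_on UNIV" by (simp add: o_def)
  fix \<eta> :: real assume "\<eta> > 0"
  obtain K where K: "K \<ge> 0" "\<And>z. norm (G z) \<le> K * exp (\<eta> * norm z)" using min_exp_type_bound [OF assms \<open>\<eta> > 0\<close>] by blast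
  have "norm (G (z + a)) \<le> (K * exp (\<eta> * norm a)) * exp (\<eta> * norm z)" for z
  proof -
    have "\<eta> * norm (z + a) \<le> \<eta> * norm a + \<eta> * norm z"
      using mult_left_mono [OF norm_triangle_ineq [of z a], of \<eta>] \<open>\<eta> > 0\<close> by (simp add: distrib_left)
    hence "K * exp (\<eta> * norm (z + a)) \<le> K * exp (\<eta> * norm a + \<eta> * norm z)"
      using K by (intro mult_left_mono) auto
    then show ?thesis using K(2) [of "z + a"] by (simp add: exp_add)
  qed
  then show "\<exists>K. \<forall>z. norm (G (z + a)) \<le> K * exp (\<eta> * norm z)" by blast
qed

lemma min_exp_type_sum:
  "(\<And>i. i \<in> I \<Longrightarrow> min_exp_type (F i)) \<Longrightarrow> min_exp_type (\<lambda>z. \<Sum>i\<in>I. F i z)"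
proof (induction I rule: infinite_finite_induct)
  case (insert i I)
  then show ?case by (simp add: min_exp_type_add)
qed (simp_all add: min_exp_type_const)

lemma min_exp_type_pochhammer:
  assumes "min_exp_type F"
  shows "min_exp_type (\<lambda>z. pochhammer (F z) k)"
proof (induction k)
  case (Suc k)
  have "min_exp_type (\<lambda>z. pochhammer (F z) k * (F z + of_nat k))"
    by (intro min_exp_type_mult min_exp_type_add min_exp_type_const assms Suc)
  then show ?case by (simp add: pochhammer_Suc)
qed (simp add: min_exp_type_const)

lemma min_exp_type_uminus: "min_exp_type (\<lambda>z. - z)"
proof -
  have "(\<lambda>z :: complex. - z) = (\<lambda>z. - 1 * z)" by auto
  then show ?thesis using min_exp_type_mult [OF min_exp_type_const [of "- 1"] min_exp_type_ident] by metis
qed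

section \<open>Functional and differential equations of the Barnes integral\<close>

lemma barnes_line_integrable:
  assumes "\<bar>Im w\<bar> < pi" "min_exp_type G" "0 < real N + 1/2 + Re b"
  shows "(\<lambda>y. G (Complex (real N + 1/2) y) * barnes_kernel b w (Complex (real N + 1/2) y)) integrable_on UNIV"
proof -
  define \<eta> where "\<eta> = (pi - \<bar>Im w\<bar>) / 2"
  have \<eta>: "0 < \<eta>" "\<eta> < pi - \<bar>Im w\<bar>" using assms(1) by (auto simp: \<eta>_def)
  obtain K where K: "\<And>z. norm (G z) \<le> K * exp (\<eta> * norm z)"
    using min_exp_type_bound [OF assms(2) \<eta>(1)] by blast
  have "\<exists>M\<ge>0. \<forall>G K. continuous_on UNIV G \<longrightarrow> (\<forall>z. norm (G z) \<le> K * exp (\<eta> * norm z)) \<longrightarrow>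
       (\<lambda>y. G (Complex (real N + 1/2) y) * barnes_kernel b w (Complex (real N + 1/2) y)) integrable_on UNIV \<and>
       norm (integral UNIV (\<lambda>y. G (Complex (real N + 1/2) y) * barnes_kernel b w (Complex (real N + 1/2) y))) \<le> K * M"
    using \<eta> half_integer_not_nat assms(3) by (intro barnes_line_integral_bound) auto
  then show ?thesis using K min_exp_type_continuous [OF assms(2)] by blast
qed

lemma barnes_value_add:
  assumes "\<bar>Im w\<bar> < pi" "0 < real N + 1/2 + Re b" "min_exp_type F" "min_exp_type G"
  shows "barnes_value N b w (\<lambda>z. F z + G z) = barnes_value N b w F + barnes_value N b w G"
proof -
  let ?z = "\<lambda>y. Complex (real N + 1/2) y"
  have "integral UNIV (\<lambda>y. (F (?z y) + G (?z y)) * barnes_kernel b w (?z y)) =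
      integral UNIV (\<lambda>y. F (?z y) * barnes_kernel b w (?z y)) + integral UNIV (\<lambda>y. G (?z y) * barnes_kernel b w (?z y))"
    unfolding distrib_right by (intro integral_add barnes_line_integrable assms)
  moreover have "(\<Sum>k\<le>N. (F (of_nat k) + G (of_nat k)) * Gamma (of_nat k + b) * (- exp w) ^ k / fact k) =
      (\<Sum>k\<le>N. F (of_nat k) * Gamma (of_nat k + b) * (- exp w) ^ k / fact k) +
      (\<Sum>k\<le>N. G (of_nat k) * Gamma (of_nat k + b) * (- exp w) ^ k / fact k)"
    unfolding distrib_right add_divide_distrib by (rule sum.distrib)
  ultimately show ?thesis unfolding barnes_value_def by (simp only: distrib_left ac_simps)
qed

lemma barnes_value_cmult: "barnes_value N b w (\<lambda>z. c * F z) = c * barnes_value N b w F"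
proof -
  have S: "(\<Sum>k\<le>N. c * F (of_nat k) * Gamma (of_nat k + b) * (- exp w) ^ k / fact k) =
      c * (\<Sum>k\<le>N. F (of_nat k) * Gamma (of_nat k + b) * (- exp w) ^ k / fact k)"
    unfolding sum_distrib_left by (intro sum.cong refl) simp
  show ?thesis unfolding barnes_value_def S unfolding mult.assoc [of c] integral_mult_right
    by (simp add: algebra_simps)
qed

lemma barnes_value_sum:
  assumes "\<bar>Im w\<bar> < pi" "0 < real N + 1/2 + Re b" "\<And>i. i \<in> I \<Longrightarrow> min_exp_type (F i)"
  shows "barnes_value N b w (\<lambda>z. \<Sum>i\<in>I. F i z) = (\<Sum>i\<in>I. barnes_value N b w (F i))"
  using assms(3)
proof (induction I rule: infinite_finite_induct)
  case (insert i I)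
  then show ?case by (simp add: barnes_value_add min_exp_type_sum assms)
qed (simp_all add: barnes_value_def)

text \<open>
  Substituting \<open>z + 1\<close> for \<open>z\<close> and using \<open>- z * Gamma (- z) = Gamma (1 - z)\<close> takes the line with index \<open>Suc N\<close> to that
  with index \<open>N\<close>. On the residues it shifts the summation index, the term for \<open>0\<close> being cancelled by
  the factor \<open>z\<close>.
\<close>

lemma barnes_value_shift:
  "barnes_value (Suc N) b w (\<lambda>z. - z * P z) = exp w * barnes_value N (b + 1) w (\<lambda>z. P (z + 1))"
proof -
  have line: "- z * P z * barnes_kernel b w z = exp w * (P (u + 1) * barnes_kernel (b + 1) w u)"
    if "z = Complex (real (Suc N) + 1/2) y" "u = Complex (real N + 1/2) y" for y z u
  proof -
    have z: "z = u + 1" using that by (simp add: complex_eq_iff)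
    have "- z \<notin> \<int>\<^sub>\<le>\<^sub>0"
    proof
      assume "- z \<in> \<int>\<^sub>\<le>\<^sub>0"
      then obtain k where "z = of_nat k" by (auto elim!: nonpos_Ints_cases' simp: minus_equation_iff)
      then show False using half_integer_not_nat [of "Suc N" k] that(1) by (metis complex.sel(1) complex_Re_of_nat)
    qed
    from Gamma_plus1 [OF this] have "- z * Gamma (- z) = Gamma (- u)" by (simp add: z)
    moreover have "z + b = u + (b + 1)" by (simp add: z)
    moreover have "exp (w * z) = exp w * exp (w * u)" by (simp add: z distrib_left exp_add)
    moreover have "- z * P z * (Gamma (- z) * Gamma (z + b) * exp (w * z)) =
        P z * ((- z * Gamma (- z)) * Gamma (z + b) * exp (w * z))" by simp
    ultimately show ?thesis unfolding barnes_kernel_def z [symmetric] by (simp only: ac_simps)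
  qed
  have "(\<Sum>k\<le>Suc N. - of_nat k * P (of_nat k) * Gamma (of_nat k + b) * (- exp w) ^ k / fact k) =
        (\<Sum>k\<le>N. - of_nat (Suc k) * P (of_nat (Suc k)) * Gamma (of_nat (Suc k) + b) * (- exp w) ^ Suc k / fact (Suc k))"
    by (subst sum.atMost_Suc_shift) simp
  also have "\<dots> = exp w * (\<Sum>k\<le>N. P (of_nat k + 1) * Gamma (of_nat k + (b + 1)) * (- exp w) ^ k / fact k)"
    unfolding sum_distrib_left
  proof (intro sum.cong refl)
    fix k
    have "of_nat (Suc k) \<noteq> (0 :: complex)" by (simp del: of_nat_Suc)
    moreover have e: "of_nat (Suc k) + b = of_nat k + (b + 1)" by simp
    moreover have "of_nat (Suc k) = of_nat k + (1 :: complex)" by simp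
    ultimately show "- of_nat (Suc k) * P (of_nat (Suc k)) * Gamma (of_nat (Suc k) + b) * (- exp w) ^ Suc k / fact (Suc k) =
        exp w * (P (of_nat k + 1) * Gamma (of_nat k + (b + 1)) * (- exp w) ^ k / fact k)"
      unfolding e by (simp add: divide_simps del: of_nat_Suc) (simp add: algebra_simps)
  qed
  finally have sums: "(\<Sum>k\<le>Suc N. - of_nat k * P (of_nat k) * Gamma (of_nat k + b) * (- exp w) ^ k / fact k) =
     exp w * (\<Sum>k\<le>N. P (of_nat k + 1) * Gamma (of_nat k + (b + 1)) * (- exp w) ^ k / fact k)" .
  show ?thesis
    unfolding barnes_value_def sums line [OF refl refl] integral_mult_right
    by (simp only: distrib_left mult_ac)
qed

lemma barnes_value_rise:
  assumes "0 < real N + 1/2 + Re b" "- b \<notin> \<nat>"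
  shows "barnes_value N b w (\<lambda>z. (z + b) * P z) = barnes_value N (b + 1) w P"
proof -
  have G: "(z + b) * Gamma (z + b) = Gamma (z + (b + 1))" if "z + b \<notin> \<int>\<^sub>\<le>\<^sub>0" for z
    using Gamma_plus1 [OF that] by (simp add: add.assoc)
  have line: "(z + b) * P z * barnes_kernel b w z = P z * barnes_kernel (b + 1) w z"
    if "z = Complex (real N + 1/2) y" for z y
  proof -
    have "z + b \<notin> \<int>\<^sub>\<le>\<^sub>0" using that assms(1) by (auto elim!: nonpos_Ints_cases' simp: complex_eq_iff)
    have "(z + b) * P z * barnes_kernel b w z = P z * (Gamma (- z) * ((z + b) * Gamma (z + b)) * exp (w * z))"
      unfolding barnes_kernel_def by (simp only: ac_simps)
    then show ?thesis unfolding G [OF \<open>z + b \<notin> \<int>\<^sub>\<le>\<^sub>0\<close>] barnes_kernel_def .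
  qed
  have summand: "(of_nat k + b) * P (of_nat k) * Gamma (of_nat k + b) * X / fact k =
      P (of_nat k) * Gamma (of_nat k + (b + 1)) * X / fact k" for k X
  proof -
    have "of_nat k + b \<notin> \<int>\<^sub>\<le>\<^sub>0"
    proof
      assume "of_nat k + b \<in> \<int>\<^sub>\<le>\<^sub>0"
      then obtain j where "of_nat k + b = - of_nat j" by (auto elim: nonpos_Ints_cases')
      hence "- b = of_nat (k + j)" by (simp add: algebra_simps eq_neg_iff_add_eq_0 neg_eq_iff_add_eq_0)
      then show False using assms(2) by (metis of_nat_in_Nats)
    qed
    have "(of_nat k + b) * P (of_nat k) * Gamma (of_nat k + b) * X / fact k =
        P (of_nat k) * ((of_nat k + b) * Gamma (of_nat k + b)) * X / fact k" by (simp only: ac_simps)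
    then show ?thesis unfolding G [OF \<open>of_nat k + b \<notin> \<int>\<^sub>\<le>\<^sub>0\<close>] .
  qed
  show ?thesis unfolding barnes_value_def line [OF refl] summand ..
qed

lemma has_field_derivative_of_quadratic_remainder:
  fixes f :: "complex \<Rightarrow> complex"
  assumes "r > 0" and rem: "\<And>h. norm h < r \<Longrightarrow> norm (f (w + h) - f w - h * D) \<le> K * (norm h)\<^sup>2"
  shows "(f has_field_derivative D) (at w)"
  unfolding DERIV_def
proof -
  have "((\<lambda>h. (f (w + h) - f w) / h - D) \<longlongrightarrow> 0) (at 0)"
  proof (rule Lim_null_comparison)
    show "\<forall>\<^sub>F h in at 0. norm ((f (w + h) - f w) / h - D) \<le> K * norm h"
      unfolding eventually_at
    proof (intro exI [of _ r] conjI ballI impI)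
      fix h :: complex assume h: "h \<noteq> 0 \<and> dist h 0 < r"
      have "norm ((f (w + h) - f w) / h - D) = norm (f (w + h) - f w - h * D) / norm h"
        using h by (simp add: norm_divide [symmetric] diff_divide_distrib)
      also have "\<dots> \<le> K * (norm h)\<^sup>2 / norm h"
        using rem [of h] h by (intro divide_right_mono) auto
      also have "\<dots> = K * norm h" by (simp add: power2_eq_square)
      finally show "norm ((f (w + h) - f w) / h - D) \<le> K * norm h" .
    qed (use assms in auto)
    show "((\<lambda>h. K * norm h) \<longlongrightarrow> 0) (at (0 :: complex))" by (auto intro!: tendsto_eq_intros)
  qed
  then show "((\<lambda>h. (f (w + h) - f w) / h) \<longlongrightarrow> D) (at 0)" by (rule Lim_null [THEN iffD2])
qed

text \<open>
  The remainder \<open>exp (h * z) - 1 - h * z\<close> is bounded by a multiple of \<open>(norm h)\<^sup>2 * exp (\<eta> * norm z)\<close>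
  for small \<open>h\<close>, so the weighted bound for line integrals justifies differentiating under the integral
  sign.
\<close>

lemma has_field_derivative_barnes_value:
  assumes w: "\<bar>Im w\<bar> < pi" and N: "0 < real N + 1/2 + Re b"
  shows "((\<lambda>w. barnes_value N b w (\<lambda>_. 1)) has_field_derivative barnes_value N b w (\<lambda>z. z)) (at w)"
proof -
  define R where "R = real N + 1/2"
  define \<eta> where "\<eta> = (pi - \<bar>Im w\<bar>) / 2"
  have \<eta>: "0 < \<eta>" "\<eta> < pi - \<bar>Im w\<bar>" using w by (auto simp: \<eta>_def)
  define L where "L = (\<lambda>v G. integral UNIV (\<lambda>y. G (Complex R y) * barnes_kernel b v (Complex R y)))"
  obtain M where M: "M \<ge> 0" "\<And>G K. continuous_on UNIV G \<Longrightarrow> (\<And>z. norm (G z) \<le> K * exp (\<eta> * norm z)) \<Longrightarrow>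
       (\<lambda>y. G (Complex R y) * barnes_kernel b w (Complex R y)) integrable_on UNIV \<and> norm (L w G) \<le> K * M"
  proof -
    have "\<exists>M\<ge>0. \<forall>G K. continuous_on UNIV G \<longrightarrow> (\<forall>z. norm (G z) \<le> K * exp (\<eta> * norm z)) \<longrightarrow>
       (\<lambda>y. G (Complex R y) * barnes_kernel b w (Complex R y)) integrable_on UNIV \<and> norm (L w G) \<le> K * M"
      unfolding L_def R_def using \<eta> half_integer_not_nat N by (intro barnes_line_integral_bound) auto
    then show ?thesis using that by blast
  qed
  obtain C where C: "C > 0" "\<And>u. u \<ge> 0 \<Longrightarrow> (1 + u) ^ 2 \<le> C * exp (\<eta> / 2 * u)"
    using power_le_exp_scaled [of "\<eta> / 2" 2] \<eta> by auto
  have "((\<lambda>w. L w (\<lambda>_. 1)) has_field_derivative L w (\<lambda>z. z)) (at w)"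
  proof (rule has_field_derivative_of_quadratic_remainder [where r = "\<eta> / 2" and K = "C * M"])
    fix h :: complex assume h: "norm h < \<eta> / 2"
    let ?G = "\<lambda>z. exp (h * z) - 1 - h * z"
    have Gb: "norm (?G z) \<le> ((norm h)\<^sup>2 * C) * exp (\<eta> * norm z)" for z
    proof -
      have "norm (?G z) \<le> exp \<bar>Re (h * z)\<bar> * (norm (h * z))\<^sup>2"
        using Taylor_exp [of "h * z" 1] by (simp add: algebra_simps power2_eq_square)
      also have "\<dots> \<le> exp (\<eta> / 2 * norm z) * ((norm h)\<^sup>2 * (1 + norm z)\<^sup>2)"
      proof (intro mult_mono)
        have "\<bar>Re (h * z)\<bar> \<le> norm h * norm z" using abs_Re_le_cmod [of "h * z"] by (simp add: norm_mult)
        also have "\<dots> \<le> \<eta> / 2 * norm z" using h by (intro mult_right_mono) auto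
        finally show "exp \<bar>Re (h * z)\<bar> \<le> exp (\<eta> / 2 * norm z)" by simp
        show "(norm (h * z))\<^sup>2 \<le> (norm h)\<^sup>2 * (1 + norm z)\<^sup>2"
          unfolding norm_mult power_mult_distrib by (intro mult_left_mono power_mono) auto
      qed auto
      also have "\<dots> \<le> exp (\<eta> / 2 * norm z) * ((norm h)\<^sup>2 * (C * exp (\<eta> / 2 * norm z)))"
        by (intro mult_left_mono C) auto
      also have "\<dots> = ((norm h)\<^sup>2 * C) * exp (\<eta> * norm z)" by (simp add: mult_exp_exp)
      finally show ?thesis .
    qed
    have "continuous_on UNIV ?G" by (intro continuous_intros)
    note G = M(2) [OF this Gb]
    let ?k = "\<lambda>v y. barnes_kernel b v (Complex R y)"
    have kh: "?k (w + h) y = ?G (Complex R y) * ?k w y + (?k w y + h * (Complex R y * ?k w y))" for y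
    proof -
      have "exp ((w + h) * Complex R y) = exp (w * Complex R y) * exp (h * Complex R y)"
        by (simp add: distrib_right exp_add)
      then show ?thesis unfolding barnes_kernel_def by (simp only:) (simp add: algebra_simps)
    qed
    have i1: "?k w integrable_on UNIV"
      using barnes_line_integrable [OF w min_exp_type_const [of 1] N] by (simp add: R_def)
    have i2: "(\<lambda>y. h * (Complex R y * ?k w y)) integrable_on UNIV"
      unfolding R_def by (intro integrable_on_mult_right barnes_line_integrable [OF w min_exp_type_ident N])
    have "L (w + h) (\<lambda>_. 1) = L w ?G + (L w (\<lambda>_. 1) + h * L w (\<lambda>z. z))"
      unfolding L_def mult_1 kh using G i1 i2
      by (simp only: integral_add integrable_add integral_mult_right)
    hence "norm (L (w + h) (\<lambda>_. 1) - L w (\<lambda>_. 1) - h * L w (\<lambda>z. z)) = norm (L w ?G)" by simp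
    also have "\<dots> \<le> C * M * (norm h)\<^sup>2" using G by (simp add: mult_ac)
    finally show "norm (L (w + h) (\<lambda>_. 1) - L w (\<lambda>_. 1) - h * L w (\<lambda>z. z)) \<le> C * M * (norm h)\<^sup>2" .
  qed (use \<eta> in auto)
  moreover have "((\<lambda>w. \<Sum>k\<le>N. 1 * Gamma (of_nat k + b) * (- exp w) ^ k / fact k) has_field_derivative
      (\<Sum>k\<le>N. of_nat k * Gamma (of_nat k + b) * (- exp w) ^ k / fact k)) (at w)"
  proof (intro DERIV_sum)
    fix k
    have "((\<lambda>w. (- exp w) ^ k) has_field_derivative of_nat k * (- exp w) ^ k) (at w)"
    proof -
      have "(- exp v) ^ k = (- 1) ^ k * exp (of_nat k * v)" for v :: complex
        by (simp add: exp_of_nat_mult power_minus [of "exp _"])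
      then show ?thesis by (simp only:) (auto intro!: derivative_eq_intros)
    qed
    from DERIV_cmult [OF this, of "Gamma (of_nat k + b) / fact k"]
    show "((\<lambda>w. 1 * Gamma (of_nat k + b) * (- exp w) ^ k / fact k) has_field_derivative
        of_nat k * Gamma (of_nat k + b) * (- exp w) ^ k / fact k) (at w)"
      by (simp add: mult_ac)
  qed
  ultimately show ?thesis
    unfolding barnes_value_def R_def [symmetric]
    unfolding L_def by (intro DERIV_add DERIV_cmult)
qed

text \<open>
  The condition \<open>- b \<notin> \<nat>\<close> says that the two sequences of poles are disjoint. The predicate is stable under
  \<open>b \<mapsto> b + 1\<close>, which allows recursions over \<open>b\<close> along a fixed contour.
\<close>

definition separating_contour :: "(real \<Rightarrow> complex) \<Rightarrow> complex \<Rightarrow> bool" where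
  "separating_contour \<gamma> b \<longleftrightarrow> vertical_contour \<gamma> \<and> separates_poles \<gamma> b \<and> - b \<notin> \<nat>"

lemma separating_contour_plus_nat:
  assumes "separating_contour \<gamma> b"
  shows "separating_contour \<gamma> (b + of_nat j)"
proof -
  have "left_of_contour \<gamma> (- (b + of_nat j) - of_nat k)" for k
  proof -
    have shift: "- (b + of_nat j) - of_nat k = - b - of_nat (j + k)" by simp
    show ?thesis unfolding shift using assms unfolding separating_contour_def separates_poles_def by blast
  qed
  moreover have "- (b + of_nat j) \<notin> \<nat>"
  proof
    assume "- (b + of_nat j) \<in> \<nat>"
    hence "- (b + of_nat j) + of_nat j \<in> \<nat>" by (rule Nats_add) (rule of_nat_in_Nats)
    moreover have "- (b + of_nat j) + of_nat j = - b" by simp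
    ultimately show False using assms unfolding separating_contour_def by metis
  qed
  ultimately show ?thesis
    using assms unfolding separating_contour_def separates_poles_def by blast
qed

lemma separating_contour_plus_1: "separating_contour \<gamma> b \<Longrightarrow> separating_contour \<gamma> (b + 1)"
  using separating_contour_plus_nat [of \<gamma> b 1] by (simp only: of_nat_1)

definition barnes_integral ::
    "(real \<Rightarrow> complex) \<Rightarrow> complex \<Rightarrow> complex \<Rightarrow> (complex \<Rightarrow> complex) \<Rightarrow> complex" where
  "barnes_integral \<gamma> b w G =
     integral UNIV (\<lambda>s. G (\<gamma> s) * barnes_kernel b w (\<gamma> s) * vector_derivative \<gamma> (at s))"

lemma barnes_value_eq_barnes_integral:
  assumes "separating_contour \<gamma> b"
  shows "\<forall>\<^sub>F N in sequentially. 0 < real N + 1/2 + Re b \<and>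
           (\<forall>w G. \<bar>Im w\<bar> < pi \<longrightarrow> min_exp_type G \<longrightarrow> barnes_value N b w G = barnes_integral \<gamma> b w G)"
proof (rule eventually_conj)
  have "\<forall>\<^sub>F N in sequentially. - Re b < real N"
    by (rule eventually_compose_filterlim [OF eventually_gt_at_top filterlim_real_sequentially])
  then show "\<forall>\<^sub>F N in sequentially. 0 < real N + 1/2 + Re b"
    by eventually_elim simp
  have "\<forall>\<^sub>F N in sequentially. \<forall>w G. \<bar>Im w\<bar> < pi \<longrightarrow> min_exp_type G \<longrightarrow>
           ((\<lambda>z. G z * barnes_kernel b w z) has_infinite_contour_integral barnes_value N b w G) \<gamma>"
    using assms by (intro contour_integral_eq_barnes_value) (auto simp: separating_contour_def)
  then show "\<forall>\<^sub>F N in sequentially. \<forall>w G. \<bar>Im w\<bar> < pi \<longrightarrow> min_exp_type G \<longrightarrow>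
           barnes_value N b w G = barnes_integral \<gamma> b w G"
    by eventually_elim
       (auto simp: barnes_integral_def has_infinite_contour_integral_def intro: integral_unique [symmetric])
qed

lemma has_barnes_integral:
  assumes "separating_contour \<gamma> b" "\<bar>Im w\<bar> < pi" "min_exp_type G"
  shows "((\<lambda>z. G z * barnes_kernel b w z) has_infinite_contour_integral barnes_integral \<gamma> b w G) \<gamma>"
proof -
  have "\<forall>\<^sub>F N in sequentially. \<forall>w G. \<bar>Im w\<bar> < pi \<longrightarrow> min_exp_type G \<longrightarrow>
           ((\<lambda>z. G z * barnes_kernel b w z) has_infinite_contour_integral barnes_value N b w G) \<gamma>"
    using assms by (intro contour_integral_eq_barnes_value) (auto simp: separating_contour_def)
  then obtain N where "((\<lambda>z. G z * barnes_kernel b w z) has_infinite_contour_integral barnes_value N b w G) \<gamma>"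
    using assms(2,3) eventually_happens' [OF sequentially_bot] by blast
  then show ?thesis
    unfolding barnes_integral_def has_infinite_contour_integral_def
    by (intro integrable_integral has_integral_integrable)
qed

lemma barnes_integral_shift:
  assumes "separating_contour \<gamma> b" "\<bar>Im w\<bar> < pi" "min_exp_type P"
  shows "barnes_integral \<gamma> b w (\<lambda>z. - z * P z) = exp w * barnes_integral \<gamma> (b + 1) w (\<lambda>z. P (z + 1))"
proof -
  have g: "min_exp_type (\<lambda>z. - z * P z)" "min_exp_type (\<lambda>z. P (z + 1))"
    by (intro min_exp_type_mult min_exp_type_uminus min_exp_type_translate assms)+
  have "\<forall>\<^sub>F N in sequentially. barnes_value (Suc N) b w (\<lambda>z. - z * P z) = barnes_integral \<gamma> b w (\<lambda>z. - z * P z)"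
    unfolding eventually_sequentially_Suc [of "\<lambda>N. barnes_value N b w (\<lambda>z. - z * P z) = _"]
    using barnes_value_eq_barnes_integral [OF assms(1)] by eventually_elim (use g assms in blast)
  moreover have "\<forall>\<^sub>F N in sequentially. barnes_value N (b + 1) w (\<lambda>z. P (z + 1)) = barnes_integral \<gamma> (b + 1) w (\<lambda>z. P (z + 1))"
    using barnes_value_eq_barnes_integral [OF separating_contour_plus_1 [OF assms(1)]]
    by eventually_elim (use g assms in blast)
  ultimately have "\<forall>\<^sub>F N in sequentially. barnes_integral \<gamma> b w (\<lambda>z. - z * P z) = exp w * barnes_integral \<gamma> (b + 1) w (\<lambda>z. P (z + 1))"
    by eventually_elim (use barnes_value_shift [of _ b w P] in metis)
  then show ?thesis by simp
qed

lemma barnes_integral_rise: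
  assumes "separating_contour \<gamma> b" "\<bar>Im w\<bar> < pi" "min_exp_type P"
  shows "barnes_integral \<gamma> b w (\<lambda>z. (z + b) * P z) = barnes_integral \<gamma> (b + 1) w P"
proof -
  have g: "min_exp_type (\<lambda>z. (z + b) * P z)"
    by (intro min_exp_type_mult min_exp_type_add min_exp_type_ident min_exp_type_const assms)
  have nb: "- b \<notin> \<nat>" using assms(1) by (simp add: separating_contour_def)
  have "\<forall>\<^sub>F N in sequentially. barnes_integral \<gamma> b w (\<lambda>z. (z + b) * P z) = barnes_integral \<gamma> (b + 1) w P"
    using barnes_value_eq_barnes_integral [OF separating_contour_plus_1 [OF assms(1)]]
      barnes_value_eq_barnes_integral [OF assms(1)]
  proof eventually_elim
    case (elim N)
    have "barnes_integral \<gamma> b w (\<lambda>z. (z + b) * P z) = barnes_value N b w (\<lambda>z. (z + b) * P z)"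
      using elim(2) g assms(2) by metis
    also have "\<dots> = barnes_value N (b + 1) w P"
      using elim(2) nb by (intro barnes_value_rise) auto
    also have "\<dots> = barnes_integral \<gamma> (b + 1) w P"
      using elim(1) assms by blast
    finally show ?case .
  qed
  then show ?thesis by simp
qed

text \<open>
  On the line, which has positive abscissa \<open>R\<close>, the integral is of order \<open>exp (x * R)\<close>, and the residue at \<open>k > 0\<close> is of
  order \<open>exp (x * k)\<close>. Only the residue at \<open>0\<close> survives.
\<close>

lemma barnes_value_at_minus_infinity:
  assumes N: "0 < real N + 1/2 + Re b"
  shows "((\<lambda>x. barnes_value N b (of_real x) (\<lambda>_. 1)) \<longlongrightarrow> 2 * of_real pi * \<i> * Gamma b) at_bot"
proof -
  define R where "R = real N + 1/2"
  have e0: "((\<lambda>x :: real. exp (of_real x :: complex)) \<longlongrightarrow> 0) at_bot"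
    by (rule tendsto_norm_zero_cancel) (simp add: exp_at_bot)
  obtain C where C: "\<And>y. norm (barnes_kernel b 0 (Complex R y)) \<le> C * exp (- 1 * \<bar>y\<bar>)"
    using barnes_kernel_line_decay(1) [of 1 0 R b] N half_integer_not_nat pi_gt3 unfolding R_def by auto
  let ?L = "\<lambda>x :: real. integral UNIV (\<lambda>y. 1 * barnes_kernel b (of_real x) (Complex R y))"
  have "norm (?L x) \<le> 2 * C * exp (x * R)" for x
  proof -
    have "norm (?L x) \<le> 2 * (C * exp (x * R)) / 1"
    proof (rule exponential_decay_integral(2))
      show "continuous_on UNIV (\<lambda>y. 1 * barnes_kernel b (of_real x) (Complex R y))"
        using barnes_kernel_line_decay(2) [of 1 "of_real x" R b] N half_integer_not_nat pi_gt3
        unfolding R_def by simp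
      fix y
      have "norm (1 * barnes_kernel b (of_real x) (Complex R y)) = norm (barnes_kernel b 0 (Complex R y)) * exp (x * R)"
        by (simp add: barnes_kernel_def norm_mult)
      also have "\<dots> \<le> C * exp (- 1 * \<bar>y\<bar>) * exp (x * R)"
        by (intro mult_right_mono C) simp
      finally show "norm (1 * barnes_kernel b (of_real x) (Complex R y)) \<le> C * exp (x * R) * exp (- 1 * \<bar>y\<bar>)"
        by (simp add: mult_ac)
    qed simp
    then show ?thesis by simp
  qed
  moreover have "((\<lambda>x. 2 * C * exp (x * R)) \<longlongrightarrow> 0) at_bot"
  proof -
    have "filterlim (\<lambda>x. R * x) at_bot at_bot"
      by (rule filterlim_tendsto_pos_mult_at_bot [OF tendsto_const _ filterlim_ident]) (simp add: R_def)
    hence "filterlim (\<lambda>x. x * R) at_bot at_bot" by (simp only: mult.commute)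
    from tendsto_mult_right_zero [OF filterlim_compose [OF exp_at_bot this], of "2 * C"] show ?thesis .
  qed
  ultimately have L: "(?L \<longlongrightarrow> 0) at_bot"
    by (intro Lim_null_comparison [of ?L "\<lambda>x. 2 * C * exp (x * R)"]) (auto simp: always_eventually)
  have "((\<lambda>x :: real. \<Sum>k\<le>N. 1 * Gamma (of_nat k + b) * (- exp (of_real x)) ^ k / fact k) \<longlongrightarrow>
        (\<Sum>k\<le>N. 1 * Gamma (of_nat k + b) * (- 0) ^ k / fact k)) at_bot"
    by (intro tendsto_intros e0) auto
  also have "(\<Sum>k\<le>N. 1 * Gamma (of_nat k + b) * (- 0) ^ k / fact k) = Gamma b"
  proof -
    have "1 * Gamma (of_nat k + b) * (- 0) ^ k / fact k = (if k = 0 then Gamma b else 0)" for k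
      by (cases k) simp_all
    then show ?thesis by (simp only:) (simp add: sum.delta)
  qed
  finally have S: "((\<lambda>x :: real. \<Sum>k\<le>N. 1 * Gamma (of_nat k + b) * (- exp (of_real x)) ^ k / fact k) \<longlongrightarrow> Gamma b) at_bot" .
  have "((\<lambda>x. barnes_value N b (of_real x) (\<lambda>_. 1)) \<longlongrightarrow> \<i> * 0 + 2 * of_real pi * \<i> * Gamma b) at_bot"
    unfolding barnes_value_def R_def [symmetric] by (intro tendsto_add tendsto_mult tendsto_const L S)
  then show ?thesis by simp
qed

lemma one_plus_exp_slit:
  assumes "\<bar>Im w\<bar> < pi"
  shows "1 + exp w \<notin> \<real>\<^sub>\<le>\<^sub>0"
proof
  assume "1 + exp w \<in> \<real>\<^sub>\<le>\<^sub>0"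
  hence "exp w \<in> \<real>\<^sub>\<le>\<^sub>0" by (auto simp: complex_nonpos_Reals_iff)
  moreover have "Ln (exp w) = w" using assms by (intro Ln_exp) (auto simp: abs_less_iff)
  ultimately have "Im w = pi"
    by (metis Im_Ln_eq_pi complex_nonpos_Reals_iff exp_not_eq_zero complex_eq_iff le_less zero_complex.simps)
  then show False using assms by simp
qed

text \<open>
  Let \<open>B\<close> be the integral as a function of \<open>w\<close>. Shift and rise give \<open>- B' = exp w * (B' + b * B)\<close>, so
  \<open>(1 + exp w) powr b * B\<close> is constant on the strip \<open>\<bar>Im w\<bar> < pi\<close>; its limit at minus infinity is known.
\<close>

theorem barnes_integral_one:
  assumes sep: "separating_contour \<gamma> b" and w: "\<bar>Im w\<bar> < pi"
  shows "barnes_integral \<gamma> b w (\<lambda>_. 1) = 2 * of_real pi * \<i> * Gamma b * (1 + exp w) powr (- b)"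
proof -
  obtain N where N: "0 < real N + 1/2 + Re b"
     "\<And>w G. \<bar>Im w\<bar> < pi \<Longrightarrow> min_exp_type G \<Longrightarrow> barnes_value N b w G = barnes_integral \<gamma> b w G"
    using eventually_happens' [OF sequentially_bot barnes_value_eq_barnes_integral [OF sep]] by blast
  define B where "B = (\<lambda>w. barnes_value N b w (\<lambda>_. 1))"
  define S where "S = {w. \<bar>Im w\<bar> < pi}"
  have "S = {w. - pi < Im w} \<inter> {w. Im w < pi}" by (auto simp: S_def)
  hence "convex S" by (simp add: convex_Int convex_halfspace_Im_gt convex_halfspace_Im_lt)
  have B': "(B has_field_derivative barnes_value N b v (\<lambda>z. z)) (at v)" if "v \<in> S" for v
    unfolding B_def using that N(1) by (intro has_field_derivative_barnes_value) (auto simp: S_def)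
  have ode: "(1 + exp v) * barnes_value N b v (\<lambda>z. z) = - b * exp v * B v" if "v \<in> S" for v
  proof -
    have v: "\<bar>Im v\<bar> < pi" using that by (simp add: S_def)
    note t = min_exp_type_const [of 1] min_exp_type_ident
    have "- barnes_value N b v (\<lambda>z. z) = barnes_value N b v (\<lambda>z. - z * 1)"
      using barnes_value_cmult [of N b v "- 1" "\<lambda>z. z"] by simp
    also have "\<dots> = barnes_integral \<gamma> b v (\<lambda>z. - z * 1)"
      by (intro N v min_exp_type_mult min_exp_type_uminus t)
    also have "\<dots> = exp v * barnes_integral \<gamma> (b + 1) v (\<lambda>_. 1)"
      by (intro barnes_integral_shift sep v t)
    also have "barnes_integral \<gamma> (b + 1) v (\<lambda>_. 1) = barnes_integral \<gamma> b v (\<lambda>z. (z + b) * 1)"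
      by (intro barnes_integral_rise [symmetric] sep v t)
    also have "\<dots> = barnes_value N b v (\<lambda>z. z + b)"
      using N(2) [OF v, of "\<lambda>z. z + b"] min_exp_type_add [OF t(2) min_exp_type_const [of b]] by simp
    also have "\<dots> = barnes_value N b v (\<lambda>z. z) + barnes_value N b v (\<lambda>z. b * 1)"
      using barnes_value_add [OF v N(1) t(2) min_exp_type_const [of b]] by simp
    also have "barnes_value N b v (\<lambda>z. b * 1) = b * B v"
      unfolding B_def by (rule barnes_value_cmult)
    finally show ?thesis by (simp add: algebra_simps) algebra
  qed
  have "((\<lambda>w. (1 + exp w) powr b * B w) has_field_derivative 0) (at v within S)" if v: "v \<in> S" for v
  proof -
    have sl: "1 + exp v \<notin> \<real>\<^sub>\<le>\<^sub>0" using v by (intro one_plus_exp_slit) (simp add: S_def)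
    hence nz: "1 + exp v \<noteq> 0" by auto
    have "((\<lambda>w. 1 + exp w) has_field_derivative exp v) (at v)"
      by (auto intro!: derivative_eq_intros)
    from DERIV_chain2 [OF has_field_derivative_powr [OF sl] this]
    have "((\<lambda>w. (1 + exp w) powr b) has_field_derivative b * (1 + exp v) powr (b - 1) * exp v) (at v)" .
    from DERIV_mult [OF this B' [OF v]]
    have "((\<lambda>w. (1 + exp w) powr b * B w) has_field_derivative
        (b * (1 + exp v) powr (b - 1) * exp v) * B v + barnes_value N b v (\<lambda>z. z) * (1 + exp v) powr b) (at v)" .
    moreover have "(1 + exp v) powr b = (1 + exp v) * (1 + exp v) powr (b - 1)"
      using nz by (simp add: powr_diff)
    hence "(b * (1 + exp v) powr (b - 1) * exp v) * B v + barnes_value N b v (\<lambda>z. z) * (1 + exp v) powr b =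
       (1 + exp v) powr (b - 1) * (b * exp v * B v + (1 + exp v) * barnes_value N b v (\<lambda>z. z))"
      by (simp add: algebra_simps)
    also have "\<dots> = 0" using ode [OF v] by simp
    ultimately show ?thesis by (metis has_field_derivative_at_within)
  qed
  hence "\<exists>c. \<forall>v\<in>S. (1 + exp v) powr b * B v = c"
    by (rule has_field_derivative_zero_constant [OF \<open>convex S\<close>])
  then obtain c where c: "\<And>v. v \<in> S \<Longrightarrow> (1 + exp v) powr b * B v = c" by blast
  have "((\<lambda>x :: real. (1 + exp (of_real x)) powr b * B (of_real x)) \<longlongrightarrow> (1 + 0) powr b * (2 * of_real pi * \<i> * Gamma b)) at_bot"
  proof (intro tendsto_mult tendsto_powr_complex tendsto_add tendsto_const)
    show "((\<lambda>x :: real. exp (of_real x :: complex)) \<longlongrightarrow> 0) at_bot"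
      by (rule tendsto_norm_zero_cancel) (simp add: exp_at_bot)
    show "((\<lambda>x :: real. B (of_real x)) \<longlongrightarrow> 2 * of_real pi * \<i> * Gamma b) at_bot"
      unfolding B_def by (rule barnes_value_at_minus_infinity [OF N(1)])
  qed auto
  moreover have "(\<lambda>x :: real. (1 + exp (of_real x)) powr b * B (of_real x)) = (\<lambda>x. c)"
    by (intro ext c) (simp add: S_def)
  ultimately have "((\<lambda>x :: real. c) \<longlongrightarrow> (1 + 0) powr b * (2 * of_real pi * \<i> * Gamma b)) at_bot" by metis
  from tendsto_unique [OF trivial_limit_at_bot_linorder tendsto_const this]
  have "c = 2 * of_real pi * \<i> * Gamma b" by simp
  with c [of w] w have "(1 + exp w) powr b * B w = 2 * of_real pi * \<i> * Gamma b"
    by (simp add: S_def)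
  moreover have "(1 + exp w) powr b \<noteq> 0" using one_plus_exp_slit [OF w] by auto
  moreover have "B w = barnes_integral \<gamma> b w (\<lambda>_. 1)"
    unfolding B_def by (intro N w min_exp_type_const)
  ultimately show ?thesis by (simp add: powr_minus field_simps)
qed

text \<open>
  Every factor \<open>z + b + i\<close> raises \<open>b\<close> by one, and every factor \<open>- z + i\<close> raises \<open>b\<close> by one and
  contributes \<open>exp w\<close>; the integral of \<open>1\<close> remains.
\<close>

lemma barnes_integral_falling_rising:
  assumes sep: "separating_contour \<gamma> b" and w: "\<bar>Im w\<bar> < pi"
  shows "barnes_integral \<gamma> b w (\<lambda>z. pochhammer (- z) k * pochhammer (z + b) j) =
           2 * of_real pi * \<i> * Gamma (b + of_nat (j + k)) * exp w ^ k * (1 + exp w) powr (- (b + of_nat (j + k)))"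
proof -
  note t = min_exp_type_pochhammer min_exp_type_uminus min_exp_type_add min_exp_type_ident min_exp_type_const min_exp_type_mult
  have rise: "barnes_integral \<gamma> b w (\<lambda>z. pochhammer (z + b) j * P z) = barnes_integral \<gamma> (b + of_nat j) w P"
    if sep: "separating_contour \<gamma> b" and P: "min_exp_type P" for b P
    using sep
  proof (induction j arbitrary: b)
    case (Suc j)
    have "barnes_integral \<gamma> b w (\<lambda>z. pochhammer (z + b) (Suc j) * P z) =
          barnes_integral \<gamma> b w (\<lambda>z. (z + b) * (pochhammer (z + (b + 1)) j * P z))"
      by (simp add: pochhammer_rec mult.assoc add.assoc)
    also have "\<dots> = barnes_integral \<gamma> (b + 1) w (\<lambda>z. pochhammer (z + (b + 1)) j * P z)"
      by (intro barnes_integral_rise Suc.prems w t P)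
    also have "\<dots> = barnes_integral \<gamma> (b + 1 + of_nat j) w P"
      by (intro Suc.IH separating_contour_plus_1 Suc.prems)
    finally show ?case by (simp add: add_ac)
  qed simp
  have fall: "barnes_integral \<gamma> b w (\<lambda>z. pochhammer (- z) k) = exp w ^ k * barnes_integral \<gamma> (b + of_nat k) w (\<lambda>_. 1)"
    if "separating_contour \<gamma> b" for b
    using that
  proof (induction k arbitrary: b)
    case (Suc k)
    have "barnes_integral \<gamma> b w (\<lambda>z. pochhammer (- z) (Suc k)) =
          barnes_integral \<gamma> b w (\<lambda>z. - z * pochhammer (- z + 1) k)"
      by (simp add: pochhammer_rec)
    also have "\<dots> = exp w * barnes_integral \<gamma> (b + 1) w (\<lambda>z. pochhammer (- (z + 1) + 1) k)"
      by (intro barnes_integral_shift Suc.prems w t)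
    also have "\<dots> = exp w * barnes_integral \<gamma> (b + 1) w (\<lambda>z. pochhammer (- z) k)"
      by simp
    also have "\<dots> = exp w * (exp w ^ k * barnes_integral \<gamma> (b + 1 + of_nat k) w (\<lambda>_. 1))"
      by (subst Suc.IH [OF separating_contour_plus_1 [OF Suc.prems]]) rule
    finally show ?case by (simp add: add_ac)
  qed simp
  have "barnes_integral \<gamma> b w (\<lambda>z. pochhammer (- z) k * pochhammer (z + b) j) =
        barnes_integral \<gamma> (b + of_nat j) w (\<lambda>z. pochhammer (- z) k)"
    using rise [OF sep, of "\<lambda>z. pochhammer (- z) k"] t by (simp add: mult.commute)
  also have "\<dots> = exp w ^ k * barnes_integral \<gamma> (b + of_nat j + of_nat k) w (\<lambda>_. 1)"
    by (intro fall separating_contour_plus_nat sep)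
  also have "barnes_integral \<gamma> (b + of_nat j + of_nat k) w (\<lambda>_. 1) =
     2 * of_real pi * \<i> * Gamma (b + of_nat j + of_nat k) * (1 + exp w) powr (- (b + of_nat j + of_nat k))"
    by (intro barnes_integral_one separating_contour_plus_nat sep w)
  finally show ?thesis by (simp add: add_ac mult_ac)
qed

section \<open>Meixner polynomials in rising factorials\<close>

lemma pochhammer_nonzero:
  fixes b :: complex
  assumes "- b \<notin> \<nat>"
  shows "pochhammer b k \<noteq> 0"
proof
  assume "pochhammer b k = 0"
  then obtain j where "b = - of_nat j" unfolding pochhammer_eq_0_iff by blast
  hence "- b = of_nat j" by simp
  then show False using assms by (metis of_nat_in_Nats)
qed

text \<open>
  After multiplication by \<open>pochhammer b n\<close> and reversal of the quotients
  \<open>pochhammer b n / pochhammer b j\<close>, this is the binomial theorem for rising factorials.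
\<close>

lemma chu_vandermonde:
  fixes a b :: complex
  assumes "- b \<notin> \<nat>"
  shows "(\<Sum>j\<le>n. (-1) ^ j * of_nat (n choose j) * pochhammer a j / pochhammer b j) =
           pochhammer (b - a) n / pochhammer b n"
proof -
  note nz = pochhammer_nonzero [OF assms]
  have ratio: "pochhammer b n / pochhammer b j = (-1) ^ (n - j) * pochhammer (1 - b - of_nat n) (n - j)"
    if "j \<le> n" for j
  proof -
    have "pochhammer b n = pochhammer b j * pochhammer (b + of_nat j) (n - j)"
      using that by (rule pochhammer_product)
    moreover have "pochhammer (b + of_nat j) (n - j) = (-1) ^ (n - j) * pochhammer (1 - b - of_nat n) (n - j)"
      using pochhammer_minus [of "- (b + of_nat j)" "n - j"] that
      by (simp add: of_nat_diff algebra_simps)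
    ultimately show ?thesis using nz [of j] by simp
  qed
  have "pochhammer b n * (\<Sum>j\<le>n. (-1) ^ j * of_nat (n choose j) * pochhammer a j / pochhammer b j) =
        (\<Sum>j\<le>n. (-1) ^ j * of_nat (n choose j) * pochhammer a j * (pochhammer b n / pochhammer b j))"
    by (simp add: sum_distrib_left mult_ac)
  also have "\<dots> = (\<Sum>j\<le>n. (-1) ^ n * (of_nat (n choose j) * pochhammer a j * pochhammer (1 - b - of_nat n) (n - j)))"
  proof (intro sum.cong refl)
    fix j assume "j \<in> {..n}"
    hence "(-1 :: complex) ^ n = (-1) ^ j * (-1) ^ (n - j)" by (simp flip: power_add)
    with ratio [of j] \<open>j \<in> {..n}\<close>
    show "(-1) ^ j * of_nat (n choose j) * pochhammer a j * (pochhammer b n / pochhammer b j) =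
        (-1) ^ n * (of_nat (n choose j) * pochhammer a j * pochhammer (1 - b - of_nat n) (n - j))"
      by (simp only: atMost_iff ac_simps)
  qed
  also have "\<dots> = (-1) ^ n * pochhammer (a + (1 - b - of_nat n)) n"
    by (simp add: pochhammer_binomial_sum sum_distrib_left)
  also have "\<dots> = pochhammer (b - a) n"
    using pochhammer_minus [of "a - b" n] by (simp add: algebra_simps)
  finally show ?thesis using nz [of n] by (simp add: field_simps)
qed

text \<open>
  Applied in reverse, the Chu-Vandermonde identity expands \<open>pochhammer a j / pochhammer b j\<close> in the quotients
  \<open>pochhammer (b - a) i / pochhammer b i\<close>. Interchanging the sums leaves a binomial sum.
\<close>

lemma pfaff_transformation:
  fixes a b x :: complex
  assumes "- b \<notin> \<nat>"
  shows "(\<Sum>j\<le>n. of_nat (n choose j) * (- x) ^ j * (pochhammer a j / pochhammer b j)) =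
           (\<Sum>i\<le>n. of_nat (n choose i) * (pochhammer (b - a) i / pochhammer b i) * x ^ i * (1 - x) ^ (n - i))"
proof -
  define d where "d = (\<lambda>i. pochhammer (b - a) i / pochhammer b i)"
  have inv: "pochhammer a j / pochhammer b j = (\<Sum>i\<le>j. (-1) ^ i * of_nat (j choose i) * d i)" for j
    using chu_vandermonde [OF assms, of j "b - a"] by (simp add: d_def)
  have "(\<Sum>j\<le>n. of_nat (n choose j) * (- x) ^ j * (pochhammer a j / pochhammer b j)) =
        (\<Sum>j\<le>n. \<Sum>i\<le>j. of_nat (n choose j) * (- x) ^ j * ((-1) ^ i * of_nat (j choose i) * d i))"
    unfolding inv sum_distrib_left ..
  also have "\<dots> = (\<Sum>i\<le>n. \<Sum>j=i..n. of_nat (n choose j) * (- x) ^ j * ((-1) ^ i * of_nat (j choose i) * d i))"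
  proof -
    have "(\<Sum>(j, i)\<in>Sigma {..n} (\<lambda>j. {..j}). g j i) = (\<Sum>(i, j)\<in>Sigma {..n} (\<lambda>i. {i..n}). g j i)" for g :: "nat \<Rightarrow> nat \<Rightarrow> complex"
      by (intro sum.reindex_bij_witness [of _ "\<lambda>(i, j). (j, i)" "\<lambda>(j, i). (i, j)"]) auto
    then show ?thesis by (simp add: sum.Sigma)
  qed
  also have "\<dots> = (\<Sum>i\<le>n. of_nat (n choose i) * d i * x ^ i * (1 - x) ^ (n - i))"
  proof (intro sum.cong refl)
    fix i assume i: "i \<in> {..n}"
    have "(\<Sum>j=i..n. of_nat (n choose j) * (- x) ^ j * ((-1) ^ i * of_nat (j choose i) * d i)) =
          (\<Sum>m\<le>n - i. of_nat (n choose (i + m)) * (- x) ^ (i + m) * ((-1) ^ i * of_nat ((i + m) choose i) * d i))"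
      using i by (intro sum.reindex_bij_witness [of _ "\<lambda>m. i + m" "\<lambda>j. j - i"]) auto
    also have "\<dots> = (\<Sum>m\<le>n - i. of_nat (n choose i) * d i * x ^ i * (of_nat ((n - i) choose m) * (- x) ^ m * 1 ^ (n - i - m)))"
    proof (intro sum.cong refl)
      fix m assume m: "m \<in> {..n - i}"
      have "(n choose (i + m)) * ((i + m) choose i) = (n choose i) * ((n - i) choose m)"
        using i m choose_mult [of i "i + m" n] by simp
      hence "of_nat (n choose (i + m)) * of_nat ((i + m) choose i) = (of_nat (n choose i) * of_nat ((n - i) choose m) :: complex)"
        by (metis of_nat_mult)
      moreover have "(- x) ^ (i + m) * (-1) ^ i = x ^ i * (- x) ^ m"
      proof -
        have "(- x) ^ i * (-1) ^ i = x ^ i" by (simp flip: power_mult_distrib)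
        then show ?thesis by (simp add: power_add mult.commute mult.left_commute)
      qed
      moreover have "of_nat (n choose (i + m)) * (- x) ^ (i + m) * ((-1) ^ i * of_nat ((i + m) choose i) * d i) =
          (of_nat (n choose (i + m)) * of_nat ((i + m) choose i)) * ((- x) ^ (i + m) * (-1) ^ i) * d i"
        by (simp only: ac_simps)
      ultimately show "of_nat (n choose (i + m)) * (- x) ^ (i + m) * ((-1) ^ i * of_nat ((i + m) choose i) * d i) =
          of_nat (n choose i) * d i * x ^ i * (of_nat ((n - i) choose m) * (- x) ^ m * 1 ^ (n - i - m))"
        by (simp only: ac_simps power_one mult_1_right mult_1_left)
    qed
    also have "\<dots> = of_nat (n choose i) * d i * x ^ i * (- x + 1) ^ (n - i)"
      unfolding binomial_ring sum_distrib_left ..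
    finally show "(\<Sum>j=i..n. of_nat (n choose j) * (- x) ^ j * ((-1) ^ i * of_nat (j choose i) * d i)) =
        of_nat (n choose i) * d i * x ^ i * (1 - x) ^ (n - i)" by simp
  qed
  finally show ?thesis by (simp add: d_def)
qed

lemma pochhammer_minus_nat:
  assumes "j \<le> n"
  shows "pochhammer (- of_nat n :: complex) j / fact j = (-1) ^ j * of_nat (n choose j)"
proof -
  have "of_nat n gchoose j = (-1 :: complex) ^ j * pochhammer (- of_nat n) j / fact j"
    by (rule gbinomial_pochhammer)
  then show ?thesis by (simp add: binomial_gbinomial power_mult_distrib flip: mult.assoc power_add mult_2)
qed

text \<open>
  Pfaff's transformation replaces the factors \<open>(- z)\<^sub>j\<close> of the Meixner polynomial by \<open>(z + b)\<^sub>i\<close>. These are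
  absorbed by the second Gamma factor, so that they do not interfere with the factors \<open>(- z)\<^sub>k\<close> from
  the confluent series, which are absorbed by the first.
\<close>

lemma Meixner_rising:
  assumes b: "- b \<notin> \<nat>" and "c \<noteq> 0"
  shows "Meixner n z b c =
           (\<Sum>i\<le>n. (of_nat (n choose i) * (c - 1) ^ i / (c ^ n * pochhammer b i)) * pochhammer (z + b) i)"
proof -
  define x where "x = 1 - 1 / c"
  have "Meixner n z b c = (\<Sum>j\<le>n. pochhammer (- of_nat n) j * pochhammer (- z) j / pochhammer b j * (x ^ j / fact j))"
    unfolding Meixner_def hyp_2F1_def x_def
    by (intro suminf_finite) (auto simp: pochhammer_of_nat_eq_0_lemma)
  also have "\<dots> = (\<Sum>j\<le>n. of_nat (n choose j) * (- x) ^ j * (pochhammer (- z) j / pochhammer b j))"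
  proof (intro sum.cong refl)
    fix j assume "j \<in> {..n}"
    hence "pochhammer (- of_nat n :: complex) j / fact j = (-1) ^ j * of_nat (n choose j)"
      by (intro pochhammer_minus_nat) simp
    hence "pochhammer (- of_nat n) j * pochhammer (- z) j / pochhammer b j * (x ^ j / fact j) =
        ((-1) ^ j * of_nat (n choose j)) * (pochhammer (- z) j / pochhammer b j) * x ^ j"
      by (simp add: field_simps)
    then show "pochhammer (- of_nat n) j * pochhammer (- z) j / pochhammer b j * (x ^ j / fact j) =
        of_nat (n choose j) * (- x) ^ j * (pochhammer (- z) j / pochhammer b j)"
      by (simp add: power_minus [of x])
  qed
  also have "\<dots> = (\<Sum>i\<le>n. of_nat (n choose i) * (pochhammer (b - (- z)) i / pochhammer b i) * x ^ i * (1 - x) ^ (n - i))"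
    by (rule pfaff_transformation [OF b])
  also have "\<dots> = (\<Sum>i\<le>n. (of_nat (n choose i) * (c - 1) ^ i / (c ^ n * pochhammer b i)) * pochhammer (z + b) i)"
  proof (intro sum.cong refl)
    fix i assume "i \<in> {..n}"
    hence "c ^ n = c ^ i * c ^ (n - i)" by (simp flip: power_add)
    moreover have "x ^ i = (c - 1) ^ i / c ^ i" using \<open>c \<noteq> 0\<close>
      by (simp add: x_def diff_divide_eq_iff flip: power_divide) 
    moreover have "(1 - x) ^ (n - i) = 1 / c ^ (n - i)" by (simp add: x_def power_one_over)
    ultimately show "of_nat (n choose i) * (pochhammer (b - (- z)) i / pochhammer b i) * x ^ i * (1 - x) ^ (n - i) =
       (of_nat (n choose i) * (c - 1) ^ i / (c ^ n * pochhammer b i)) * pochhammer (z + b) i"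
      by (simp add: ac_simps)
  qed
  finally show ?thesis .
qed

lemma min_exp_type_Meixner:
  assumes "- b \<notin> \<nat>" "c \<noteq> 0"
  shows "min_exp_type (\<lambda>z. Meixner n z b c)"
  unfolding Meixner_rising [OF assms]
  by (intro min_exp_type_sum min_exp_type_mult min_exp_type_const min_exp_type_pochhammer min_exp_type_add min_exp_type_ident)

lemma barnes_integral_sum:
  assumes "separating_contour \<gamma> b" "\<bar>Im w\<bar> < pi" "\<And>i. i \<in> I \<Longrightarrow> min_exp_type (F i)"
  shows "barnes_integral \<gamma> b w (\<lambda>z. \<Sum>i\<in>I. C i * F i z) = (\<Sum>i\<in>I. C i * barnes_integral \<gamma> b w (F i))"
proof -
  obtain N where N: "0 < real N + 1/2 + Re b"
     "\<And>w G. \<bar>Im w\<bar> < pi \<Longrightarrow> min_exp_type G \<Longrightarrow> barnes_value N b w G = barnes_integral \<gamma> b w G"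
    using eventually_happens' [OF sequentially_bot barnes_value_eq_barnes_integral [OF assms(1)]] by blast
  have t: "min_exp_type (\<lambda>z. C i * F i z)" if "i \<in> I" for i
    by (intro min_exp_type_mult min_exp_type_const assms that)
  have "barnes_integral \<gamma> b w (\<lambda>z. \<Sum>i\<in>I. C i * F i z) = barnes_value N b w (\<lambda>z. \<Sum>i\<in>I. C i * F i z)"
    by (intro N(2) [symmetric] min_exp_type_sum t assms)
  also have "\<dots> = (\<Sum>i\<in>I. barnes_value N b w (\<lambda>z. C i * F i z))"
    by (intro barnes_value_sum assms N t)
  also have "\<dots> = (\<Sum>i\<in>I. C i * barnes_integral \<gamma> b w (F i))"
    by (intro sum.cong refl) (simp add: barnes_value_cmult N(2) assms)
  finally show ?thesis .
qed

text \<open>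
  The powers of \<open>c - 1\<close> from the expansion of the Meixner polynomial cancel those of \<open>1 - c\<close> from the
  integrals up to sign, so that a Chu-Vandermonde sum remains. The factor \<open>pochhammer (- of_nat k) n\<close>
  vanishes for \<open>k < n\<close>.
\<close>

lemma barnes_integral_falling_Meixner:
  assumes sep: "separating_contour \<gamma> b" and w: "\<bar>Im w\<bar> < pi" and c: "exp w = - c"
  shows "barnes_integral \<gamma> b w (\<lambda>z. pochhammer (- z) k * Meixner n z b c) =
           2 * of_real pi * \<i> * Gamma b * (1 - c) powr (- b) / c ^ n *
           ((- c / (1 - c)) ^ k * pochhammer b k * pochhammer (- of_nat k) n / pochhammer b n)"
proof -
  have b: "- b \<notin> \<nat>" using sep by (simp add: separating_contour_def)
  have c0: "c \<noteq> 0" using c by (metis exp_not_eq_zero neg_equal_0_iff_equal)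
  have slit: "1 - c \<notin> \<real>\<^sub>\<le>\<^sub>0" using one_plus_exp_slit [OF w] c by simp
  hence c1: "1 - c \<noteq> 0" by auto
  define C where "C = (\<lambda>i. of_nat (n choose i) * (c - 1) ^ i / (c ^ n * pochhammer b i))"
  define V where "V = 2 * of_real pi * \<i> * Gamma b * (1 - c) powr (- b) / c ^ n * ((- c / (1 - c)) ^ k * pochhammer b k)"
  have bni: "b \<notin> \<int>\<^sub>\<le>\<^sub>0"
    using b by (auto elim!: nonpos_Ints_cases')
  have "barnes_integral \<gamma> b w (\<lambda>z. pochhammer (- z) k * Meixner n z b c) =
        barnes_integral \<gamma> b w (\<lambda>z. \<Sum>i\<le>n. C i * (pochhammer (- z) k * pochhammer (z + b) i))"
    unfolding Meixner_rising [OF b c0] C_def by (simp add: sum_distrib_left mult_ac)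
  also have "\<dots> = (\<Sum>i\<le>n. C i * barnes_integral \<gamma> b w (\<lambda>z. pochhammer (- z) k * pochhammer (z + b) i))"
    by (intro barnes_integral_sum sep w min_exp_type_mult min_exp_type_pochhammer min_exp_type_uminus
          min_exp_type_add min_exp_type_ident min_exp_type_const)
  also have "\<dots> = (\<Sum>i\<le>n. V * ((-1) ^ i * of_nat (n choose i) * pochhammer (b + of_nat k) i / pochhammer b i))"
  proof (intro sum.cong refl)
    fix i
    have "Gamma (b + of_nat (i + k)) = Gamma b * pochhammer b (k + i)"
      using pochhammer_Gamma [OF bni, of "k + i"] Gamma_nonzero [OF bni] by (simp add: add.commute)
    hence G: "Gamma (b + of_nat (i + k)) = Gamma b * pochhammer b k * pochhammer (b + of_nat k) i"
      by (simp add: pochhammer_product')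
    have "(1 - c) powr (- (b + of_nat (i + k))) = (1 - c) powr (- b - of_nat (i + k))" by (simp add: algebra_simps)
    also have "\<dots> = (1 - c) powr (- b) / ((1 - c) ^ i * (1 - c) ^ k)"
      using c1 by (simp add: powr_diff powr_nat' power_add del: of_nat_add)
    finally have P: "(1 - c) powr (- (b + of_nat (i + k))) = (1 - c) powr (- b) / ((1 - c) ^ i * (1 - c) ^ k)" .
    have "c - 1 = - (1 - c)" by simp
    hence E: "(c - 1) ^ i = (-1) ^ i * (1 - c) ^ i" using power_minus [of "1 - c" i] by simp
    have I: "barnes_integral \<gamma> b w (\<lambda>z. pochhammer (- z) k * pochhammer (z + b) i) =
        2 * of_real pi * \<i> * (Gamma b * pochhammer b k * pochhammer (b + of_nat k) i) * (- c) ^ k *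
        ((1 - c) powr (- b) / ((1 - c) ^ i * (1 - c) ^ k))"
      using barnes_integral_falling_rising [OF sep w, of k i] unfolding c G add_uminus_conv_diff P by (simp only:)
    show "C i * barnes_integral \<gamma> b w (\<lambda>z. pochhammer (- z) k * pochhammer (z + b) i) =
        V * ((-1) ^ i * of_nat (n choose i) * pochhammer (b + of_nat k) i / pochhammer b i)"
      unfolding I C_def V_def E power_divide
      using c0 c1 pochhammer_nonzero [OF b, of i] by (simp add: divide_simps)
  qed
  also have "\<dots> = V * (pochhammer (b - (b + of_nat k)) n / pochhammer b n)"
    unfolding sum_distrib_left [symmetric] chu_vandermonde [OF b] ..
  finally show ?thesis by (simp add: V_def)
qed

section \<open>Newton series under the integral sign\<close>

text \<open>
  With \<open>q = 1 - exp (- \<eta>)\<close> and \<open>r = norm z\<close>, the number \<open>pochhammer r k / fact k * q ^ k\<close> is one term of the binomial series of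
  \<open>(1 - q) powr (- r) = exp (\<eta> * r)\<close>, all of whose terms are nonnegative.
\<close>

lemma norm_pochhammer_le_exp:
  fixes z :: complex
  assumes "\<eta> > 0"
  shows "norm (pochhammer (- z) k / fact k) \<le> (1 / (1 - exp (- \<eta>))) ^ k * exp (\<eta> * norm z)"
proof -
  define q where "q = 1 - exp (- \<eta>)"
  have q: "0 < q" "q < 1" using assms by (auto simp: q_def)
  define r where "r = norm z"
  have r: "r \<ge> 0" by (simp add: r_def)
  have summand: "((- r) gchoose j) * (- q) ^ j = pochhammer r j / fact j * q ^ j" for j
  proof -
    have "(-1) ^ j * pochhammer r j / fact j * ((-1) ^ j * q ^ j) = ((-1) ^ j * (-1) ^ j) * (pochhammer r j / fact j * q ^ j)"
      by simp
    also have "(-1) ^ j * (-1) ^ j = (1 :: real)" by (simp flip: power_mult_distrib)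
    finally show ?thesis by (simp add: gbinomial_pochhammer power_minus [of q])
  qed
  have "(\<lambda>j. ((- r) gchoose j) * (- q) ^ j) sums (1 + - q) powr (- r)"
    using q by (intro gen_binomial_real) auto
  hence sums: "(\<lambda>j. pochhammer r j / fact j * q ^ j) sums (1 - q) powr (- r)"
    unfolding summand by simp
  have poch: "pochhammer r j \<ge> 0" for j using r by (simp add: pochhammer_prod prod_nonneg)
  have "pochhammer r k / fact k * q ^ k \<le> (1 - q) powr (- r)"
    using sum_le_suminf [OF sums_summable [OF sums], of "{k}"] poch q sums_unique [OF sums] by simp
  also have "(1 - q) powr (- r) = exp (\<eta> * r)"
    by (simp add: q_def powr_def)
  finally have "pochhammer r k / fact k \<le> (1 / q) ^ k * exp (\<eta> * r)"
    using q by (simp add: field_simps power_divide)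
  moreover have "norm (pochhammer (- z) k) \<le> pochhammer r k"
  proof -
    have "norm (- z + of_nat j) \<le> r + of_nat j" for j
      using norm_triangle_ineq [of "- z" "of_nat j"] by (simp add: r_def)
    then show ?thesis unfolding pochhammer_prod prod_norm [symmetric] by (intro prod_mono) auto
  qed
  hence "norm (pochhammer (- z) k / fact k) \<le> pochhammer r k / fact k"
    by (simp add: norm_divide divide_right_mono)
  ultimately show ?thesis unfolding q_def r_def by linarith
qed

lemma summable_inverse_pochhammer:
  fixes \<alpha> x :: complex
  assumes "- \<alpha> \<notin> \<nat>"
  shows "summable (\<lambda>k. norm (x ^ k / pochhammer \<alpha> k) * p ^ k)"
proof -
  obtain M :: nat where M: "norm \<alpha> + 2 * norm x * \<bar>p\<bar> + 1 \<le> real M" using real_arch_simple by blast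
  show ?thesis
  proof (rule summable_ratio_test [of "1 / 2" M])
    fix k assume "M \<le> k"
    hence k: "norm \<alpha> + 2 * norm x * \<bar>p\<bar> + 1 \<le> real k" using M by linarith
    have "real k \<le> norm (\<alpha> + of_nat k) + norm \<alpha>"
      using norm_triangle_ineq4 [of "\<alpha> + of_nat k" \<alpha>] by simp
    moreover have "0 \<le> norm x * \<bar>p\<bar>" by simp
    ultimately have *: "2 * (norm x * \<bar>p\<bar>) \<le> norm (\<alpha> + of_nat k)" "0 < norm (\<alpha> + of_nat k)" using k by argo+
    define u where "u = norm x * \<bar>p\<bar> / norm (\<alpha> + of_nat k)"
    have "u \<le> 1 / 2" using * by (simp add: u_def divide_simps)
    have "norm (norm (x ^ Suc k / pochhammer \<alpha> (Suc k)) * p ^ Suc k) =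
        u * norm (norm (x ^ k / pochhammer \<alpha> k) * p ^ k)"
      by (simp add: u_def pochhammer_Suc norm_mult norm_divide norm_power abs_mult ac_simps)
    also have "\<dots> \<le> 1 / 2 * norm (norm (x ^ k / pochhammer \<alpha> k) * p ^ k)"
      using \<open>u \<le> 1 / 2\<close> by (intro mult_right_mono) auto
    finally show "norm (norm (x ^ Suc k / pochhammer \<alpha> (Suc k)) * p ^ Suc k) \<le>
        1 / 2 * norm (norm (x ^ k / pochhammer \<alpha> k) * p ^ k)" .
  qed simp
qed

text \<open>
  With \<open>p = 1 / (1 - exp (- \<eta>))\<close>, the bound for rising factorials compares the tail with that of
  \<open>\<Sum>k. norm (a k) * p ^ k\<close>. Since \<open>\<eta>\<close> may be arbitrarily small, \<open>p\<close> may be arbitrarily large, which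
  is why convergence is assumed for every \<open>p\<close>.
\<close>

lemma newton_series_tail:
  fixes a :: "nat \<Rightarrow> complex"
  assumes "\<eta> > 0" and summ: "\<And>p. summable (\<lambda>k. norm (a k) * p ^ k)"
  shows "summable (\<lambda>k. norm (a k * (pochhammer (- z) k / fact k)))"
    and "\<exists>\<tau>. \<tau> \<longlonglongrightarrow> 0 \<and> (\<forall>K z. norm ((\<Sum>k. a k * (pochhammer (- z) k / fact k)) -
       (\<Sum>k<K. a k * (pochhammer (- z) k / fact k))) \<le> \<tau> K * exp (\<eta> * norm z))"
proof -
  define p where "p = 1 / (1 - exp (- \<eta>))"
  have p: "p > 0" using assms(1) by (simp add: p_def)
  define \<tau> where "\<tau> = (\<lambda>K. \<Sum>k. norm (a (k + K)) * p ^ (k + K))"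
  have bd: "norm (a k * (pochhammer (- z) k / fact k)) \<le> exp (\<eta> * norm z) * (norm (a k) * p ^ k)" for k z
  proof -
    have "norm (a k) * norm (pochhammer (- z) k / fact k) \<le> norm (a k) * (p ^ k * exp (\<eta> * norm z))"
      unfolding p_def by (intro mult_left_mono norm_pochhammer_le_exp assms(1)) simp
    then show ?thesis unfolding norm_mult by (simp only: ac_simps)
  qed
  have sn: "summable (\<lambda>k. norm (a k * (pochhammer (- z) k / fact k)))" for z
    by (rule summable_comparison_test' [where N = 0 and g = "\<lambda>k. exp (\<eta> * norm z) * (norm (a k) * p ^ k)"])
       (use bd summ in \<open>auto intro: summable_mult\<close>)
  have "\<tau> \<longlonglongrightarrow> 0"
    unfolding \<tau>_def by (rule suminf_exist_split2) (rule summ)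
  moreover have "norm ((\<Sum>k. a k * (pochhammer (- z) k / fact k)) - (\<Sum>k<K. a k * (pochhammer (- z) k / fact k)))
        \<le> \<tau> K * exp (\<eta> * norm z)" for K z
  proof -
    let ?f = "\<lambda>k. a k * (pochhammer (- z) k / fact k)"
    have "(\<Sum>k. ?f k) - (\<Sum>k<K. ?f k) = (\<Sum>k. ?f (k + K))"
      using suminf_split_initial_segment [OF summable_norm_cancel [OF sn], of z K] by simp
    also have "norm \<dots> \<le> (\<Sum>k. norm (?f (k + K)))"
      by (intro summable_norm summable_ignore_initial_segment sn)
    also have "\<dots> \<le> (\<Sum>k. exp (\<eta> * norm z) * (norm (a (k + K)) * p ^ (k + K)))"
      by (intro suminf_le bd summable_ignore_initial_segment sn summable_mult
            summable_ignore_initial_segment [OF summ [of p]])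
    also have "\<dots> = exp (\<eta> * norm z) * \<tau> K"
      unfolding \<tau>_def by (intro suminf_mult summable_ignore_initial_segment [OF summ [of p]])
    finally show ?thesis by (simp add: mult.commute)
  qed
  ultimately show "\<exists>\<tau>. \<tau> \<longlonglongrightarrow> 0 \<and> (\<forall>K z. norm ((\<Sum>k. a k * (pochhammer (- z) k / fact k)) -
       (\<Sum>k<K. a k * (pochhammer (- z) k / fact k))) \<le> \<tau> K * exp (\<eta> * norm z))" by blast
  show "summable (\<lambda>k. norm (a k * (pochhammer (- z) k / fact k)))" by (rule sn)
qed

lemma min_exp_type_newton_series:
  fixes a :: "nat \<Rightarrow> complex"
  assumes summ: "\<And>p. summable (\<lambda>k. norm (a k) * p ^ k)"
  shows "min_exp_type (\<lambda>z. \<Sum>k. a k * (pochhammer (- z) k / fact k))"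
  unfolding min_exp_type_def
proof (intro conjI allI impI)
  let ?F = "\<lambda>z. \<Sum>k. a k * (pochhammer (- z) k / fact k)"
  let ?S = "\<lambda>K z. \<Sum>k<K. a k * (pochhammer (- z) k / fact k)"
  obtain \<tau> where \<tau>: "\<tau> \<longlonglongrightarrow> 0" "\<And>K z. norm (?F z - ?S K z) \<le> \<tau> K * exp (1 * norm z)"
    using newton_series_tail(2) [of 1 a, OF zero_less_one summ] by blast
  show "?F holomorphic_on UNIV"
  proof (rule holomorphic_uniform_sequence [where f = ?S])
    show "?S K holomorphic_on UNIV" for K
    proof -
      have "min_exp_type (\<lambda>z. \<Sum>k<K. (a k / fact k) * pochhammer (- z) k)"
        by (intro min_exp_type_sum min_exp_type_mult min_exp_type_const min_exp_type_pochhammer min_exp_type_uminus)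
      then show ?thesis by (simp add: min_exp_type_def)
    qed
    show "\<exists>d>0. cball x d \<subseteq> UNIV \<and> uniform_limit (cball x d) ?S ?F sequentially" for x
    proof (intro exI [of _ 1] conjI)
      have "uniform_limit (cball x 1) (\<lambda>K z. ?F z - ?S K z) (\<lambda>_. 0) sequentially"
      proof (rule uniform_limitI)
        fix e :: real assume "e > 0"
        have "(\<lambda>K. \<tau> K * exp (norm x + 1)) \<longlonglongrightarrow> 0" using tendsto_mult_left_zero [OF \<tau>(1)] .
        hence "\<forall>\<^sub>F K in sequentially. \<tau> K * exp (norm x + 1) < e" using \<open>e > 0\<close> by (rule order_tendstoD)
        then show "\<forall>\<^sub>F K in sequentially. \<forall>z\<in>cball x 1. dist (?F z - ?S K z) 0 < e"
        proof eventually_elim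
          case (elim K)
          have t0: "\<tau> K \<ge> 0" using order_trans [OF norm_ge_zero \<tau>(2) [of 0 K]] by simp
          show ?case
          proof
            fix z assume "z \<in> cball x 1"
            hence "norm z \<le> norm x + 1" using norm_triangle_ineq2 [of z x] by (simp add: dist_norm norm_minus_commute)
            hence "\<tau> K * exp (1 * norm z) \<le> \<tau> K * exp (norm x + 1)" using t0 by (intro mult_left_mono) auto
            then show "dist (?F z - ?S K z) 0 < e" using \<tau>(2) [of z K] elim by simp
          qed
        qed
      qed
      then show "uniform_limit (cball x 1) ?S ?F sequentially"
        by (simp add: uniform_limit_iff dist_norm norm_minus_commute)
    qed auto
  qed auto
  fix \<eta> :: real assume "\<eta> > 0"
  obtain \<sigma> where "\<And>K z. norm (?F z - ?S K z) \<le> \<sigma> K * exp (\<eta> * norm z)"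
    using newton_series_tail(2) [of \<eta> a, OF \<open>\<eta> > 0\<close> summ] by blast
  from this [of _ 0] show "\<exists>K. \<forall>z. norm (?F z) \<le> K * exp (\<eta> * norm z)" by auto
qed

lemma norm_barnes_value_le:
  assumes "0 \<le> \<eta>" "\<eta> < pi - \<bar>Im w\<bar>" "0 < real N + 1/2 + Re b"
  shows "\<exists>M. \<forall>G K. min_exp_type G \<longrightarrow> (\<forall>z. norm (G z) \<le> K * exp (\<eta> * norm z)) \<longrightarrow>
           norm (barnes_value N b w G) \<le> K * M"
proof -
  define R where "R = real N + 1/2"
  have "\<exists>M\<ge>0. \<forall>G K. continuous_on UNIV G \<longrightarrow> (\<forall>z. norm (G z) \<le> K * exp (\<eta> * norm z)) \<longrightarrow>
       (\<lambda>y. G (Complex R y) * barnes_kernel b w (Complex R y)) integrable_on UNIV \<and>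
       norm (integral UNIV (\<lambda>y. G (Complex R y) * barnes_kernel b w (Complex R y))) \<le> K * M"
    unfolding R_def using assms half_integer_not_nat by (intro barnes_line_integral_bound) auto
  then obtain M where M: "\<And>G K. continuous_on UNIV G \<Longrightarrow> (\<And>z. norm (G z) \<le> K * exp (\<eta> * norm z)) \<Longrightarrow>
       norm (integral UNIV (\<lambda>y. G (Complex R y) * barnes_kernel b w (Complex R y))) \<le> K * M" by blast
  define c where "c = (\<lambda>k. norm (Gamma (of_nat k + b) * (- exp w) ^ k / fact k))"
  define M' where "M' = (\<Sum>k\<le>N. exp (\<eta> * real k) * c k)"
  have "norm (barnes_value N b w G) \<le> K * (M + 2 * pi * M')"
    if G: "min_exp_type G" "\<And>z. norm (G z) \<le> K * exp (\<eta> * norm z)" for G K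
  proof -
    have 1: "norm (\<i> * integral UNIV (\<lambda>y. G (Complex R y) * barnes_kernel b w (Complex R y))) \<le> K * M"
      using M [OF min_exp_type_continuous [OF G(1)] G(2)] by (simp add: norm_mult)
    have "norm (\<Sum>k\<le>N. G (of_nat k) * Gamma (of_nat k + b) * (- exp w) ^ k / fact k) \<le> (\<Sum>k\<le>N. K * (exp (\<eta> * real k) * c k))"
    proof (rule sum_norm_le)
      fix k
      have "norm (G (of_nat k)) * c k \<le> (K * exp (\<eta> * norm (of_nat k :: complex))) * c k"
        by (intro mult_right_mono G) (simp add: c_def)
      then show "norm (G (of_nat k) * Gamma (of_nat k + b) * (- exp w) ^ k / fact k) \<le> K * (exp (\<eta> * real k) * c k)"
        by (simp add: c_def norm_mult norm_divide mult_ac)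
    qed
    then have 2: "norm (2 * of_real pi * \<i> * (\<Sum>k\<le>N. G (of_nat k) * Gamma (of_nat k + b) * (- exp w) ^ k / fact k)) \<le> 2 * pi * (K * M')"
    proof -
      assume le: "norm (\<Sum>k\<le>N. G (of_nat k) * Gamma (of_nat k + b) * (- exp w) ^ k / fact k) \<le> (\<Sum>k\<le>N. K * (exp (\<eta> * real k) * c k))"
      have "norm (2 * of_real pi * \<i> :: complex) = 2 * pi" by (simp add: norm_mult)
      then show ?thesis
        unfolding norm_mult [of "2 * of_real pi * \<i>"] M'_def sum_distrib_left [of K] using mult_left_mono [OF le, of "2 * pi"] by simp
    qed
    show ?thesis
      unfolding barnes_value_def R_def [symmetric]
      using norm_triangle_mono [OF 1 2] by (simp add: algebra_simps)
  qed
  then show ?thesis by blast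
qed

text \<open>
  On the contour itself the tails cannot be estimated; the exchange takes place for \<open>barnes_value\<close>, whose
  index \<open>N\<close> is the same for all partial sums.
\<close>

lemma barnes_integral_newton_series:
  assumes sep: "separating_contour \<gamma> b" and w: "\<bar>Im w\<bar> < pi" and M: "min_exp_type M"
    and summ: "\<And>p. summable (\<lambda>k. norm (a k) * p ^ k)"
  shows "(\<lambda>k. a k / fact k * barnes_integral \<gamma> b w (\<lambda>z. pochhammer (- z) k * M z)) sums
           barnes_integral \<gamma> b w (\<lambda>z. (\<Sum>k. a k * (pochhammer (- z) k / fact k)) * M z)"
proof -
  let ?F = "\<lambda>z. \<Sum>k. a k * (pochhammer (- z) k / fact k)"
  let ?S = "\<lambda>K z. \<Sum>k<K. a k * (pochhammer (- z) k / fact k)"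
  obtain N where N: "0 < real N + 1/2 + Re b"
     "\<And>w G. \<bar>Im w\<bar> < pi \<Longrightarrow> min_exp_type G \<Longrightarrow> barnes_value N b w G = barnes_integral \<gamma> b w G"
    using eventually_happens' [OF sequentially_bot barnes_value_eq_barnes_integral [OF sep]] by blast
  \<comment> \<open>The tail of the series and the factor \<open>M\<close> may each grow at rate \<open>\<eta>\<close>.\<close>
  define \<eta> where "\<eta> = (pi - \<bar>Im w\<bar>) / 4"
  have \<eta>: "0 < \<eta>" "0 \<le> 2 * \<eta>" "2 * \<eta> < pi - \<bar>Im w\<bar>" using w by (auto simp: \<eta>_def)
  obtain \<tau> where \<tau>: "\<tau> \<longlonglongrightarrow> 0" "\<And>K z. norm (?F z - ?S K z) \<le> \<tau> K * exp (\<eta> * norm z)"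
    using newton_series_tail(2) [of \<eta> a, OF \<eta>(1) summ] by blast
  obtain C where C: "C \<ge> 0" "\<And>z. norm (M z) \<le> C * exp (\<eta> * norm z)"
    using min_exp_type_bound [OF M \<eta>(1)] by blast
  obtain D where D: "\<And>G K. min_exp_type G \<Longrightarrow> (\<And>z. norm (G z) \<le> K * exp (2 * \<eta> * norm z)) \<Longrightarrow>
           norm (barnes_value N b w G) \<le> K * D"
    using norm_barnes_value_le [OF \<eta>(2,3) N(1)] by blast
  have FM: "min_exp_type (\<lambda>z. ?F z * M z)"
    by (intro min_exp_type_mult min_exp_type_newton_series M summ)
  have tm: "min_exp_type (\<lambda>z. pochhammer (- z) k * M z)" for k
    by (intro min_exp_type_mult min_exp_type_pochhammer min_exp_type_uminus M)
  have SM_eq: "(\<lambda>z. ?S K z * M z) = (\<lambda>z. \<Sum>k<K. a k / fact k * (pochhammer (- z) k * M z))" for K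
    by (rule ext) (simp add: sum_distrib_left ac_simps)
  have SM: "min_exp_type (\<lambda>z. ?S K z * M z)" for K
    unfolding SM_eq by (intro min_exp_type_sum min_exp_type_mult min_exp_type_const tm)
  have partial: "(\<Sum>k<K. a k / fact k * barnes_integral \<gamma> b w (\<lambda>z. pochhammer (- z) k * M z)) =
      barnes_value N b w (\<lambda>z. ?S K z * M z)" for K
    unfolding N(2) [OF w SM] unfolding SM_eq by (rule barnes_integral_sum [symmetric, OF sep w tm])
  have bound: "norm (barnes_value N b w (\<lambda>z. ?S K z * M z) - barnes_value N b w (\<lambda>z. ?F z * M z)) \<le> \<tau> K * C * D" for K
  proof -
    have neg: "min_exp_type (\<lambda>z. - 1 * (?S K z * M z))" by (intro min_exp_type_mult [OF min_exp_type_const] SM)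
    have "barnes_value N b w (\<lambda>z. ?F z * M z + - 1 * (?S K z * M z)) =
        barnes_value N b w (\<lambda>z. ?F z * M z) + - 1 * barnes_value N b w (\<lambda>z. ?S K z * M z)"
      unfolding barnes_value_add [OF w N(1) FM neg] barnes_value_cmult ..
    hence "norm (barnes_value N b w (\<lambda>z. ?S K z * M z) - barnes_value N b w (\<lambda>z. ?F z * M z)) =
        norm (barnes_value N b w (\<lambda>z. ?F z * M z + - 1 * (?S K z * M z)))"
      by (simp add: norm_minus_commute)
    also have "\<dots> \<le> \<tau> K * C * D"
    proof (rule D [OF min_exp_type_add [OF FM neg]])
      fix z
      have "norm (?F z * M z + - 1 * (?S K z * M z)) = norm (?F z - ?S K z) * norm (M z)"
        unfolding norm_mult [symmetric] by (simp add: algebra_simps)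
      also have "\<dots> \<le> (\<tau> K * exp (\<eta> * norm z)) * (C * exp (\<eta> * norm z))"
        by (intro mult_mono \<tau> C order_trans [OF norm_ge_zero \<tau>(2)] norm_ge_zero)
      also have "\<dots> = \<tau> K * C * exp (2 * \<eta> * norm z)" by (simp add: mult_exp_exp)
      finally show "norm (?F z * M z + - 1 * (?S K z * M z)) \<le> \<tau> K * C * exp (2 * \<eta> * norm z)" .
    qed
    finally show ?thesis .
  qed
  have "(\<lambda>K. \<tau> K * C * D) \<longlonglongrightarrow> 0"
    using tendsto_mult_left_zero [OF tendsto_mult_left_zero [OF \<tau>(1)]] .
  with always_eventually [OF allI [OF bound]]
  have "(\<lambda>K. barnes_value N b w (\<lambda>z. ?S K z * M z) - barnes_value N b w (\<lambda>z. ?F z * M z)) \<longlonglongrightarrow> 0"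
    by (rule Lim_null_comparison)
  hence "(\<lambda>K. barnes_value N b w (\<lambda>z. ?S K z * M z)) \<longlonglongrightarrow> barnes_value N b w (\<lambda>z. ?F z * M z)"
    by (rule Lim_null [THEN iffD2])
  then show ?thesis unfolding sums_def partial N(2) [OF w FM, symmetric] .
qed

section \<open>Kummer's transformation and the evaluation of the integral\<close>

lemma summable_hyp_1F1:
  fixes A B x :: complex
  assumes "- B \<notin> \<nat>"
  shows "summable (\<lambda>k. norm (pochhammer A k / pochhammer B k * (x ^ k / fact k)))"
proof -
  have "summable (\<lambda>k. norm (x ^ k / pochhammer B k * (pochhammer (- (- A)) k / fact k)))"
    by (rule newton_series_tail(1) [OF zero_less_one summable_inverse_pochhammer [OF assms]])
  then show ?thesis by (simp add: mult_ac)
qed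

text \<open>
  The coefficients of the Cauchy product of the two series on the right are Chu-Vandermonde sums.
\<close>

lemma kummer_transformation:
  assumes B: "- B \<notin> \<nat>"
  shows "hyp_1F1 A B (- t) = exp (- t) * hyp_1F1 (B - A) B t"
proof -
  define u where "u = (\<lambda>k. pochhammer (B - A) k / pochhammer B k * (t ^ k / fact k))"
  define v where "v = (\<lambda>k. (- t) ^ k /\<^sub>R fact k)"
  have "(\<lambda>n. \<Sum>i\<le>n. u i * v (n - i)) sums ((\<Sum>k. u k) * (\<Sum>k. v k))"
    unfolding u_def v_def by (intro Cauchy_product_sums summable_hyp_1F1 B summable_norm_exp)
  moreover have "(\<Sum>i\<le>n. u i * v (n - i)) = pochhammer A n / pochhammer B n * ((- t) ^ n / fact n)" for n
  proof -
    have "(\<Sum>i\<le>n. u i * v (n - i)) = (\<Sum>i\<le>n. (- t) ^ n / fact n *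
        ((-1) ^ i * of_nat (n choose i) * pochhammer (B - A) i / pochhammer B i))"
    proof (intro sum.cong refl)
      fix i assume i: "i \<in> {..n}"
      have "of_nat (n choose i) = (fact n / (fact i * fact (n - i)) :: complex)"
        using i by (intro binomial_fact) simp
      moreover have "(- t) ^ n * (-1) ^ i = t ^ i * (- t) ^ (n - i)"
      proof -
        have "(- t) ^ n = (- t) ^ i * (- t) ^ (n - i)" using i by (simp flip: power_add)
        moreover have "(- t) ^ i * (-1) ^ i = t ^ i" by (simp flip: power_mult_distrib)
        ultimately show ?thesis by (metis mult.assoc mult.commute)
      qed
      moreover have "(- t) ^ n / fact n * ((-1) ^ i * (fact n / (fact i * fact (n - i))) * pochhammer (B - A) i / pochhammer B i) =
          ((- t) ^ n * (-1) ^ i) / (fact i * fact (n - i)) * (pochhammer (B - A) i / pochhammer B i)"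
        by simp
      ultimately show "u i * v (n - i) = (- t) ^ n / fact n *
        ((-1) ^ i * of_nat (n choose i) * pochhammer (B - A) i / pochhammer B i)"
        by (simp add: u_def v_def scaleR_conv_of_real divide_inverse mult_ac)
    qed
    also have "\<dots> = (- t) ^ n / fact n * (pochhammer A n / pochhammer B n)"
      unfolding sum_distrib_left [symmetric] chu_vandermonde [OF B] by simp
    finally show ?thesis by (simp add: ac_simps)
  qed
  moreover have "(\<Sum>k. v k) = exp (- t)" by (simp add: v_def exp_def)
  ultimately show ?thesis
    unfolding hyp_1F1_def using sums_unique by (metis (no_types, lifting) mult.commute u_def suminf_cong)
qed

text \<open>
  The terms with \<open>k < n\<close> vanish. With \<open>k = l + n\<close> the factor \<open>pochhammer (- of_nat k) n\<close> turns \<open>1 / fact k\<close>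
  into \<open>(-1) ^ n / fact l\<close>, which leaves a confluent series at \<open>- t\<close>.
\<close>

lemma sum_falling_hyp_1F1:
  assumes \<alpha>: "- \<alpha> \<notin> \<nat>" and \<beta>: "- \<beta> \<notin> \<nat>"
  shows "(\<lambda>k. (- t) ^ k / (pochhammer \<alpha> k * fact k) * (pochhammer \<beta> k * pochhammer (- of_nat k) n / pochhammer \<beta> n)) sums
           (t ^ n * exp (- t) / pochhammer \<alpha> n * hyp_1F1 (\<alpha> - \<beta>) (\<alpha> + of_nat n) t)"
proof -
  let ?f = "\<lambda>k. (- t) ^ k / (pochhammer \<alpha> k * fact k) * (pochhammer \<beta> k * pochhammer (- of_nat k) n / pochhammer \<beta> n)"
  let ?A = "\<beta> + of_nat n" and ?B = "\<alpha> + of_nat n"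
  have B: "- ?B \<notin> \<nat>"
  proof
    assume "- ?B \<in> \<nat>"
    hence "- ?B + of_nat n \<in> \<nat>" by (rule Nats_add) (rule of_nat_in_Nats)
    moreover have "- ?B + of_nat n = - \<alpha>" by simp
    ultimately show False using \<alpha> by metis
  qed
  have shifted: "?f (l + n) = t ^ n / pochhammer \<alpha> n * (pochhammer ?A l / pochhammer ?B l * ((- t) ^ l / fact l))" for l
  proof -
    have 1: "pochhammer \<beta> (l + n) = pochhammer \<beta> n * pochhammer ?A l" "pochhammer \<alpha> (l + n) = pochhammer \<alpha> n * pochhammer ?B l"
      by (metis add.commute pochhammer_product')+
    have 2: "pochhammer (- of_nat (l + n) :: complex) n = (-1) ^ n * pochhammer (1 + of_nat l) n"
      using pochhammer_minus [of "of_nat (l + n) :: complex" n] by (simp add: add.commute)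
    have 3: "fact (l + n) = fact l * pochhammer (1 + of_nat l :: complex) n"
      unfolding pochhammer_fact by (rule pochhammer_product')
    have 4: "(- t) ^ (l + n) * (-1) ^ n = (- t) ^ l * t ^ n"
    proof -
      have "(- t) ^ n * (-1) ^ n = t ^ n" by (simp flip: power_mult_distrib)
      then show ?thesis by (simp add: power_add mult.assoc)
    qed
    have nz: "pochhammer (1 + of_nat l :: complex) n \<noteq> 0" "pochhammer \<beta> n \<noteq> 0"
      using 3 fact_nonzero [of "l + n", where 'a = complex] pochhammer_nonzero [OF \<beta>] by auto
    have "?f (l + n) = ((- t) ^ (l + n) * (-1) ^ n) / (pochhammer \<alpha> n * pochhammer ?B l * fact l) * pochhammer ?A l"
      unfolding 1 2 3 using nz by (simp add: ac_simps)
    then show ?thesis unfolding 4 by (simp add: ac_simps)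
  qed
  have "(\<lambda>l. pochhammer ?A l / pochhammer ?B l * ((- t) ^ l / fact l)) sums hyp_1F1 ?A ?B (- t)"
    unfolding hyp_1F1_def by (intro summable_sums summable_norm_cancel [OF summable_hyp_1F1 [OF B]])
  hence "(\<lambda>l. ?f (l + n)) sums (t ^ n / pochhammer \<alpha> n * hyp_1F1 ?A ?B (- t))"
    unfolding shifted by (rule sums_mult)
  hence "?f sums (t ^ n / pochhammer \<alpha> n * hyp_1F1 ?A ?B (- t))"
    by (subst (asm) sums_zero_iff_shift) (simp_all add: pochhammer_of_nat_eq_0_lemma)
  then show ?thesis by (simp add: kummer_transformation [OF B] mult.assoc)
qed

theorem theorem18:
  fixes n :: nat and t \<alpha> \<beta> c :: complex and \<gamma> :: "real \<Rightarrow> complex"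
  assumes "- \<alpha> \<notin> \<nat>" and "- \<beta> \<notin> \<nat>"
    and "c \<notin> \<real>\<^sub>\<ge>\<^sub>0"
    and "vertical_contour \<gamma>" and "separates_poles \<gamma> \<beta>"
  shows "((\<lambda>z. hyp_1F1 (- z) \<alpha> (t * (1 - c) / c) * Meixner n z \<beta> c
              * Gamma (- z) * Gamma (z + \<beta>) * (- c) powr z)
          has_infinite_contour_integral
            (2 * complex_of_real pi * \<i> * Gamma \<beta>) *
            (t ^ n * exp (- t) / ((1 - c) powr \<beta> * pochhammer \<alpha> n * c ^ n)
             * hyp_1F1 (\<alpha> - \<beta>) (\<alpha> + of_nat n) t)) \<gamma>"
proof -
  have sep: "separating_contour \<gamma> \<beta>" using assms by (simp add: separating_contour_def)
  have c0: "c \<noteq> 0" using assms(3) by auto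
  have slit: "- c \<notin> \<real>\<^sub>\<le>\<^sub>0" using assms(3) by (simp add: complex_nonpos_Reals_iff complex_nonneg_Reals_iff)
  define w where "w = Ln (- c)"
  have cw: "exp w = - c" using c0 by (simp add: w_def)
  have w: "\<bar>Im w\<bar> < pi"
    using Im_Ln_less_pi [OF slit] mpi_less_Im_Ln [of "- c"] c0 by (simp add: w_def abs_less_iff)
  have c1: "1 - c \<noteq> 0" using one_plus_exp_slit [OF w] cw by auto
  define x where "x = t * (1 - c) / c"
  define a where "a = (\<lambda>k. x ^ k / pochhammer \<alpha> k)"
  define M where "M = (\<lambda>z. Meixner n z \<beta> c)"
  define V where "V = 2 * of_real pi * \<i> * Gamma \<beta> * (1 - c) powr (- \<beta>) / c ^ n"
  let ?F = "\<lambda>z. \<Sum>k. a k * (pochhammer (- z) k / fact k)"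
  have summ: "summable (\<lambda>k. norm (a k) * p ^ k)" for p
    unfolding a_def by (rule summable_inverse_pochhammer [OF assms(1)])
  have M: "min_exp_type M" unfolding M_def by (rule min_exp_type_Meixner [OF assms(2) c0])
  have FM: "min_exp_type (\<lambda>z. ?F z * M z)" by (intro min_exp_type_mult min_exp_type_newton_series summ M)
  have "(\<lambda>k. a k / fact k * barnes_integral \<gamma> \<beta> w (\<lambda>z. pochhammer (- z) k * M z)) sums
      barnes_integral \<gamma> \<beta> w (\<lambda>z. ?F z * M z)"
    by (rule barnes_integral_newton_series [OF sep w M summ])
  moreover have "a k / fact k * barnes_integral \<gamma> \<beta> w (\<lambda>z. pochhammer (- z) k * M z) =
      V * ((- t) ^ k / (pochhammer \<alpha> k * fact k) * (pochhammer \<beta> k * pochhammer (- of_nat k) n / pochhammer \<beta> n))" for k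
  proof -
    \<comment> \<open>This cancellation explains the choice of the argument \<open>t * (1 - c) / c\<close>.\<close>
    have "x * (- c / (1 - c)) = - t" using c0 c1 by (simp add: x_def field_simps)
    hence "x ^ k * (- c / (1 - c)) ^ k = (- t) ^ k" by (metis power_mult_distrib)
    moreover have "x ^ k / pochhammer \<alpha> k / fact k * (V * ((- c / (1 - c)) ^ k * pochhammer \<beta> k * pochhammer (- of_nat k) n / pochhammer \<beta> n)) =
        V * ((x ^ k * (- c / (1 - c)) ^ k) / (pochhammer \<alpha> k * fact k) * (pochhammer \<beta> k * pochhammer (- of_nat k) n / pochhammer \<beta> n))"
      by (simp add: ac_simps del: power_divide)
    ultimately show ?thesis
      unfolding M_def barnes_integral_falling_Meixner [OF sep w cw] V_def [symmetric] a_def by (simp only:)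
  qed
  ultimately have "(\<lambda>k. V * ((- t) ^ k / (pochhammer \<alpha> k * fact k) * (pochhammer \<beta> k * pochhammer (- of_nat k) n / pochhammer \<beta> n))) sums
      barnes_integral \<gamma> \<beta> w (\<lambda>z. ?F z * M z)" by simp
  from sums_unique2 [OF this sums_mult [OF sum_falling_hyp_1F1 [OF assms(1,2)]]]
  have closed_form: "barnes_integral \<gamma> \<beta> w (\<lambda>z. ?F z * M z) =
      2 * complex_of_real pi * \<i> * Gamma \<beta> *
      (t ^ n * exp (- t) / ((1 - c) powr \<beta> * pochhammer \<alpha> n * c ^ n) * hyp_1F1 (\<alpha> - \<beta>) (\<alpha> + of_nat n) t)"
    using c1 by (simp add: V_def powr_minus divide_inverse mult_ac)
  have integrand: "?F z * M z * barnes_kernel \<beta> w z =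
      hyp_1F1 (- z) \<alpha> (t * (1 - c) / c) * Meixner n z \<beta> c * Gamma (- z) * Gamma (z + \<beta>) * (- c) powr z" for z
  proof -
    have "hyp_1F1 (- z) \<alpha> x = ?F z" by (simp add: hyp_1F1_def a_def mult_ac)
    moreover have "(- c) powr z = exp (w * z)" using c0 by (simp add: powr_def w_def mult.commute)
    ultimately show ?thesis by (simp add: M_def barnes_kernel_def x_def mult_ac)
  qed
  show ?thesis
    using has_barnes_integral [OF sep w FM] unfolding integrand closed_form .
qed

end
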